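(* Let $\beta=\sigma+i\tau\in\mathbb{C}\setminus\{0\}$ be such that $|\sigma|<\frac{\sigma_1}{2}$. Then, in distribution as $n\to\infty$, $$\frac{\mathcal{Z}_n(\beta)-\mathbb{E}\mathcal{Z}_n(\beta)}{\sqrt{\operatorname{Var}\mathcal{Z}_n(\beta)}}\longrightarrow\begin{cases}N_{\mathbb{C}}(0,1), & \text{if }\tau\ne0,\\ N_{\mathbb{R}}(0,1), & \text{if }\tau=0.\end{cases}$$
   Context: GREM. Fix $d\in\mathbb{N}$, variances $a_1,\dots,a_d>0$, branching exponents $\alpha_1,\dots,\alpha_d>1$, and sequences of natural numbers $N_{n,1},\dots,N_{n,d}$ with $\lim_{n\to\infty}N_{n,j}/\alpha_j^n=1$ for each $j$. Let $\mathbb{S}_n=\{\varepsilon=(\varepsilon_1,\dots,\varepsilon_d)\in\mathbb{N}^d:1\le\varepsilon_j\le N_{n,j},\ 1\le j\le d\}$. Let $\{\xi_{\varepsilon_1\dots\varepsilon_j}:1\le j\le d,\ 1\le\varepsilon_i\le N_{n,i}\}$ be independent real standard normal random variables, $X_\varepsilon=\sum_{j=1}^d\sqrt{a_j}\,\xi_{\varepsilon_1\dots\varepsilon_j}$, and $\mathcal{Z}_n(\beta)=\sum_{\varepsilon\in\mathbb{S}_n}e^{\beta\sqrt n X_\varepsilon}$, $\beta=\sigma+i\tau\in\mathbb{C}$. Put $\sigma_j=\sqrt{2\log\alpha_j/a_j}$; it is assumed throughout that $\sigma_1<\dots<\sigma_d$. For a complex random variable $Z$, $\operatorname{Var}Z=\mathbb{E}|Z|^2-|\mathbb{E}Z|^2$.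 $N_{\mathbb{R}}(0,\theta^2)$ is the real Gaussian law with mean zero and variance $\theta^2$; $N_{\mathbb{C}}(0,\theta^2)$ is the law of $X+iY$ with $X,Y\sim N_{\mathbb{R}}(0,\theta^2/2)$ independent. *)

theory Defs
  imports "HOL-Probability.Probability"
begin

text \<open>
  A multi-index $(\varepsilon_1,\dots,\varepsilon_j)$ is a list of length $j$, whose entry
  $\varepsilon_{i+1}$ is the list element at position $i$. The parameters $a$, $\alpha$ and the
  level sizes $N_{n,j}$ are functions of the level $j$ of which only the values for
  $1 \le j \le d$ are used. In the definitions below \<open>N\<close> stands for the level sizes
  $j \mapsto N_{n,j}$ at a fixed $n$.
\<close>

definition multi_indices :: "(nat \<Rightarrow> nat) \<Rightarrow> nat \<Rightarrow> nat list set" where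
  "multi_indices N j = {e. length e = j \<and> (\<forall>i\<in>{1..j}. 1 \<le> e ! (i - 1) \<and> e ! (i - 1) \<le> N i)}"

definition grem_X :: "nat \<Rightarrow> (nat \<Rightarrow> real) \<Rightarrow> (nat list \<Rightarrow> 'w \<Rightarrow> real) \<Rightarrow> nat list \<Rightarrow> 'w \<Rightarrow> real" where
  "grem_X d a \<xi> e \<omega> = (\<Sum>j=1..d. sqrt (a j) * \<xi> (take j e) \<omega>)"

definition grem_Z ::
  "nat \<Rightarrow> (nat \<Rightarrow> real) \<Rightarrow> (nat \<Rightarrow> nat) \<Rightarrow> (nat list \<Rightarrow> 'w \<Rightarrow> real) \<Rightarrow> nat \<Rightarrow> complex \<Rightarrow> 'w \<Rightarrow> complex" where
  "grem_Z d a N \<xi> n \<beta> \<omega> =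
     (\<Sum>e\<in>multi_indices N d. exp (\<beta> * complex_of_real (sqrt (real n) * grem_X d a \<xi> e \<omega>)))"

definition grem_sigma :: "(nat \<Rightarrow> real) \<Rightarrow> (nat \<Rightarrow> real) \<Rightarrow> nat \<Rightarrow> real" where
  "grem_sigma a \<alpha> j = sqrt (2 * ln (\<alpha> j) / a j)"

text \<open>
  The probability space is allowed to depend on $n$; no relation is imposed between the
  variables belonging to different $n$.
\<close>

locale grem =
  fixes d :: nat
    and a \<alpha> :: "nat \<Rightarrow> real"
    and N :: "nat \<Rightarrow> nat \<Rightarrow> nat"
    and M :: "nat \<Rightarrow> 'w measure"
    and \<xi> :: "nat \<Rightarrow> nat list \<Rightarrow> 'w \<Rightarrow> real"
  assumes d_ge_1: "d \<ge> 1"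
    and a_pos: "\<And>j. j \<in> {1..d} \<Longrightarrow> a j > 0"
    and alpha_gt_1: "\<And>j. j \<in> {1..d} \<Longrightarrow> \<alpha> j > 1"
    and N_asymp: "\<And>j. j \<in> {1..d} \<Longrightarrow> (\<lambda>n. real (N n j) / \<alpha> j ^ n) \<longlonglongrightarrow> 1"
    and sigma_increasing: "strict_mono_on {1..d} (grem_sigma a \<alpha>)"
    and prob_space_M: "\<And>n. prob_space (M n)"
    and xi_indep: "\<And>n. prob_space.indep_vars (M n) (\<lambda>_. borel) (\<xi> n)
                     (\<Union>j\<in>{1..d}. multi_indices (N n) j)"
    and xi_normal: "\<And>n j e. j \<in> {1..d} \<Longrightarrow> e \<in> multi_indices (N n) j \<Longrightarrow>
                     distributed (M n) lborel (\<xi> n e) std_normal_density"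

definition complex_variance :: "'w measure \<Rightarrow> ('w \<Rightarrow> complex) \<Rightarrow> real" where
  "complex_variance M Z = (\<integral>\<omega>. (cmod (Z \<omega>))\<^sup>2 \<partial>M) - (cmod (\<integral>\<omega>. Z \<omega> \<partial>M))\<^sup>2"

text \<open>
  The centred Gaussian laws are parametrised by the variance $v = \theta^2 > 0$, and both are
  measures on the complex plane: the real one is carried by the real axis.
\<close>

definition real_gaussian :: "real \<Rightarrow> real measure" where
  "real_gaussian v = density lborel (normal_density 0 (sqrt v))"

definition N_R :: "real \<Rightarrow> complex measure" where
  "N_R v = distr (real_gaussian v) borel complex_of_real"

definition N_C :: "real \<Rightarrow> complex measure" where
  "N_C v = distr (real_gaussian (v / 2) \<Otimes>\<^sub>M real_gaussian (v / 2)) borel (\<lambda>(x, y). Complex x y)"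

text \<open>
  The library's \<open>weak_conv_m\<close> is formulated through distribution functions and hence is
  restricted to measures on the reals.
\<close>

definition conv_in_distribution ::
  "(nat \<Rightarrow> 'w measure) \<Rightarrow> (nat \<Rightarrow> 'w \<Rightarrow> complex) \<Rightarrow> complex measure \<Rightarrow> bool" where
  "conv_in_distribution M X \<mu> \<longleftrightarrow>
     (\<forall>f :: complex \<Rightarrow> real. continuous_on UNIV f \<longrightarrow> bounded (range f) \<longrightarrow>
        (\<lambda>n. \<integral>z. f z \<partial>(distr (M n) borel (X n))) \<longlonglongrightarrow> (\<integral>z. f z \<partial>\<mu>))"

end

theory Submission
  imports Defs
begin

text \<open>
  Grouping by the first coordinate, $\mathcal{Z}_n = \sum_i W_i$ with independent summands
  $W_i = e^{\beta\sqrt{n a_1}\,\xi_i}\, T_i$, where $T_i$ is the partition function of the subtree of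
  $i$ and is independent of $\xi_i$. Put $Y_i = W_i - E\,W_i$. A Rosenthal type inequality for exponents
  $p = 2 + s$ slightly above $2$ shows, by induction over the levels from the leaves to the root, that
  $E|T_i|^p \le C\,(E|T_i|^2)^{p/2}$ with $C$ independent of $n$. As $|\sigma| < \sigma_1/2$, this yields
  Lyapunov's condition for $\sum_i Y_i$, regardless of which levels dominate the variance. If
  $\tau \neq 0$, then $|E\,W_i^2| \le e^{-2\tau^2 a_1 n} E|W_i|^2$, so the pseudo-variance
  $\sum_i E\,Y_i^2$ is negligible and the limit is isotropic; if $\tau = 0$, everything is real.
\<close>

text \<open>The size of s decides the range of \<beta>. With c = \<beta> sqrt(n a_j) and p = 2 + s,
  passing one level multiplies E|T|^p by e^{p^2 (Re c)^2 / 2}, but (E|T|^2)^{p/2} only by e^{p (Re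
  c)^2}. The excess e^{p s (Re c)^2 / 2} has to be repaid by the factor N_{n,j}^{-s/2} that summing
  over N_{n,j} children provides. This amounts to (2 + s) \<sigma>^2 a_j < log \<alpha>_j, which for
  s near 0 becomes |\<sigma>| < \<sigma>_j / 2, whereas fourth moments would only reach \<sigma>^2 <
  \<sigma>_j^2 / 8. For such fractional p there is no multinomial expansion of |S|^p, hence the
  detour through a Rosenthal type inequality. Below the root the reference quantity is E|T|^2 and
  not the variance, because the mean of T enters the next level as well and either part may
  dominate. The limit law is reached through a quantitative comparison of characteristic functions.
  The normalised sums have second moments at most 1, so bounded continuous test functions may be
  replaced by trigonometric polynomials up to an error that grows quadratically.\<close>

lemma borel_measurable_cnj [measurable]: "cnj \<in> borel_measurable borel"
  by (intro borel_measurable_continuous_onI continuous_intros)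

section \<open>Moments of sums of independent complex variables\<close>

lemma norm_integral_le_integral:
  fixes f :: "'a \<Rightarrow> 'b::{banach, second_countable_topology}"
  assumes "integrable M f" "integrable M g" "\<And>x. norm (f x) \<le> g x"
  shows "norm (\<integral>x. f x \<partial>M) \<le> (\<integral>x. g x \<partial>M)"
  using assms by (intro order_trans[OF integral_norm_bound integral_mono]) auto

text \<open>Scaling to x + y = 1 reduces the claim to u \<le> u^s on [0, 1].\<close>

lemma powr_subadditive:
  fixes x y s :: real
  assumes "0 \<le> x" "0 \<le> y" "0 < s" "s \<le> 1"
  shows "(x + y) powr s \<le> x powr s + y powr s"
proof (cases "x + y = 0")
  case False
  then have pos: "x + y > 0" using assms by linarith
  have le: "u \<le> u powr s" if "0 \<le> u" "u \<le> 1" for u :: real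
    using powr_mono'[of s 1 u] that assms by (cases "u = 0") auto
  have "1 = x / (x + y) + y / (x + y)" using pos by (simp flip: add_divide_distrib)
  also have "\<dots> \<le> (x / (x + y)) powr s + (y / (x + y)) powr s"
    using assms pos by (intro add_mono le) auto
  also have "\<dots> = (x powr s + y powr s) / (x + y) powr s"
    using assms pos by (simp add: powr_divide add_divide_distrib)
  finally show ?thesis using pos by (simp add: field_simps)
qed (use assms in auto)

text \<open>The s-th power is not Lipschitz near 0; the factor \<open>x\<close> in front repairs
  this. With y = x u everything reduces to |u^s - 1| \<le> |u - 1|, which holds because s \<le>
  1.\<close>

lemma powr_diff_mult_le:
  fixes x y t s :: real
  assumes "0 \<le> x" "0 \<le> y" "\<bar>y - x\<bar> \<le> t" "0 < s" "s \<le> 1"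
  shows "x * \<bar>y powr s - x powr s\<bar> \<le> x powr s * t"
proof (cases "x = 0")
  case False
  then have x: "x > 0" using assms by simp
  define u where "u = y / x"
  have u: "u \<ge> 0" "y = x * u" using x assms by (auto simp: u_def)
  have "\<bar>u powr s - 1\<bar> \<le> \<bar>u - 1\<bar>"
  proof (cases "u \<ge> 1")
    case True
    then have "1 \<le> u powr s" "u powr s \<le> u powr 1"
      using assms by (intro ge_one_powr_ge_zero powr_mono; simp)+
    then show ?thesis using True by simp
  next
    case False
    then have "u powr 1 \<le> u powr s" "u powr s \<le> 1" 
      using assms u powr_mono'[of s 1 u] by (auto intro!: powr_le1)
    then show ?thesis using False u by simp
  qed
  then have "x powr s * (x * \<bar>u powr s - 1\<bar>) \<le> x powr s * (x * \<bar>u - 1\<bar>)"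
    using x by (intro mult_left_mono) auto
  also have "x * \<bar>u - 1\<bar> = \<bar>y - x\<bar>" using x u by (simp add: abs_mult_pos' algebra_simps)
  also have "x powr s * (x * \<bar>u powr s - 1\<bar>) = x * \<bar>y powr s - x powr s\<bar>"
  proof -
    have "y powr s - x powr s = x powr s * (u powr s - 1)"
      using x u by (simp add: powr_mult algebra_simps)
    then show ?thesis using x by (simp add: abs_mult)
  qed
  also have "x powr s * \<bar>y - x\<bar> \<le> x powr s * t" using assms by (intro mult_left_mono) auto
  finally show ?thesis .
qed auto

text \<open>The map z \<mapsto> cnj z |z|^s is homogeneous of degree 1 + s, so an increment
  \<open>y\<close> should cost |y| times an s-th power. The difference splits into cnj y |z + y|^s,
  bounded by subadditivity, and cnj z (|z + y|^s - |z|^s), bounded by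
  \<open>powr_diff_mult_le\<close>. Each part contributes one |z|^s, hence the 2.\<close>

lemma cnj_powr_Lipschitz:
  fixes z y :: complex and s :: real
  assumes "0 < s" "s \<le> 1"
  shows "cmod (cnj (z + y) * of_real (cmod (z + y) powr s) - cnj z * of_real (cmod z powr s))
           \<le> cmod y * (2 * cmod z powr s + cmod y powr s)"
proof -
  have "cnj (z + y) * of_real (cmod (z + y) powr s) - cnj z * of_real (cmod z powr s) =
      cnj y * of_real (cmod (z + y) powr s) + cnj z * of_real (cmod (z + y) powr s - cmod z powr s)"
    by (simp add: algebra_simps)
  also have "cmod \<dots> \<le> cmod y * cmod (z + y) powr s + cmod z * \<bar>cmod (z + y) powr s - cmod z powr s\<bar>"
    by (intro norm_triangle_le add_mono) (simp_all add: norm_mult flip: of_real_diff)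
  also have "\<dots> \<le> cmod y * (cmod z powr s + cmod y powr s) + cmod z powr s * cmod y"
  proof (intro add_mono mult_left_mono)
    have "cmod (z + y) powr s \<le> (cmod z + cmod y) powr s"
      using assms by (intro powr_mono2 norm_triangle_ineq) auto
    also have "\<dots> \<le> cmod z powr s + cmod y powr s"
      using assms by (intro powr_subadditive) auto
    finally show "cmod (z + y) powr s \<le> cmod z powr s + cmod y powr s" .
    show "cmod z * \<bar>cmod (z + y) powr s - cmod z powr s\<bar> \<le> cmod z powr s * cmod y"
      using assms norm_triangle_ineq3[of "z + y" z] by (intro powr_diff_mult_le) auto
  qed auto
  finally show ?thesis by (simp add: algebra_simps)
qed

lemma powr_le_one_plus_powr:
  fixes x p q :: real
  assumes "0 \<le> x" "0 \<le> p" "p \<le> q"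
  shows "x powr p \<le> 1 + x powr q"
proof (cases "x \<le> 1")
  case True
  then have "x powr p \<le> 1" using assms by (intro powr_le1) auto
  then show ?thesis by (simp add: add_increasing2)
next
  case False
  then have "x powr p \<le> x powr q" using assms by (intro powr_mono) auto
  then show ?thesis by simp
qed

lemma norm_add_powr_le:
  fixes x y :: "'b::real_normed_vector"
  assumes "0 \<le> p"
  shows "norm (x + y) powr p \<le> 2 powr p * (norm x powr p + norm y powr p)"
proof -
  have "norm (x + y) powr p \<le> (2 * max (norm x) (norm y)) powr p"
    using assms norm_triangle_ineq[of x y] by (intro powr_mono2) auto
  also have "\<dots> = 2 powr p * max (norm x) (norm y) powr p"
    by (simp add: powr_mult)
  also have "\<dots> \<le> 2 powr p * (norm x powr p + norm y powr p)"
    by (intro mult_left_mono) (auto simp: max_def)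
  finally show ?thesis .
qed

lemma powr_2_norm: "norm x powr 2 = (norm x)\<^sup>2"
  by (cases "norm x = 0") auto

lemma square_powr_half: "0 \<le> x \<Longrightarrow> (x\<^sup>2) powr (p / 2) = x powr p" for x p :: real
  using powr_powr[of x 2 "p / 2"] by (cases "x = 0") simp_all

lemma square_le_one_plus_powr:
  fixes x p :: real
  assumes "0 \<le> x" "2 \<le> p"
  shows "x\<^sup>2 \<le> 1 + x powr p"
  using powr_le_one_plus_powr[of x 2 p] assms by (cases "x = 0") auto

lemma powr_le_one_plus_square:
  fixes x p :: real
  assumes "0 \<le> x" "0 \<le> p" "p \<le> 2"
  shows "x powr p \<le> 1 + x\<^sup>2"
  using powr_le_one_plus_powr[of x p 2] assms by (cases "x = 0") auto

section \<open>Moments of order 2 and 2 + s under independence\<close>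

context prob_space
begin

lemma integrable_square_of_powr:
  fixes Y :: "'a \<Rightarrow> 'b::{banach, second_countable_topology}"
  assumes [measurable]: "Y \<in> borel_measurable M"
    and "integrable M (\<lambda>\<omega>. norm (Y \<omega>) powr p)" "2 \<le> p"
  shows "integrable M (\<lambda>\<omega>. (norm (Y \<omega>))\<^sup>2)"
proof (rule Bochner_Integration.integrable_bound[where f="\<lambda>\<omega>. 1 + norm (Y \<omega>) powr p"])
  show "AE x in M. norm ((norm (Y x))\<^sup>2) \<le> norm (1 + norm (Y x) powr p)"
    using square_le_one_plus_powr[of _ p] assms by (intro AE_I2) (auto simp: abs_of_nonneg)
qed (use assms in auto)

lemma integrable_powr_of_square:
  fixes Y :: "'a \<Rightarrow> 'b::{banach, second_countable_topology}"
  assumes [measurable]: "Y \<in> borel_measurable M"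
    and "integrable M (\<lambda>\<omega>. (norm (Y \<omega>))\<^sup>2)" "0 \<le> p" "p \<le> 2"
  shows "integrable M (\<lambda>\<omega>. norm (Y \<omega>) powr p)"
proof (rule Bochner_Integration.integrable_bound[where f="\<lambda>\<omega>. 1 + (norm (Y \<omega>))\<^sup>2"])
  show "AE x in M. norm (norm (Y x) powr p) \<le> norm (1 + (norm (Y x))\<^sup>2)"
    using powr_le_one_plus_square[of _ p] assms by (intro AE_I2) (auto simp: abs_of_nonneg)
qed (use assms in auto)

lemma integrable_of_square:
  fixes Y :: "'a \<Rightarrow> 'b::{banach, second_countable_topology}"
  assumes [measurable]: "Y \<in> borel_measurable M"
    and "integrable M (\<lambda>\<omega>. (norm (Y \<omega>))\<^sup>2)"
  shows "integrable M Y"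
  using integrable_powr_of_square[of Y 1] assms by (simp flip: integrable_norm_iff[of Y])

lemma indep_vars_sum_complex:
  fixes X :: "'i \<Rightarrow> 'a \<Rightarrow> complex"
  assumes I: "finite I" "i \<notin> I" and indep: "indep_vars (\<lambda>_. borel) X (insert i I)"
  shows "indep_var borel (X i) borel (\<lambda>\<omega>. \<Sum>i\<in>I. X i \<omega>)"
proof -
  have "indep_var
    borel ((\<lambda>f. f i) \<circ> (\<lambda>\<omega>. restrict (\<lambda>i. X i \<omega>) {i}))
    borel ((\<lambda>f. \<Sum>i\<in>I. f i) \<circ> (\<lambda>\<omega>. restrict (\<lambda>i. X i \<omega>) I))"
    using I by (intro indep_var_compose[OF indep_var_restrict[OF indep]]) auto
  also have "((\<lambda>f. f i) \<circ> (\<lambda>\<omega>. restrict (\<lambda>i. X i \<omega>) {i})) = X i"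
    by auto
  also have "((\<lambda>f. \<Sum>i\<in>I. f i) \<circ> (\<lambda>\<omega>. restrict (\<lambda>i. X i \<omega>) I)) = (\<lambda>\<omega>. \<Sum>i\<in>I. X i \<omega>)"
    by (auto cong: rev_conj_cong)
  finally show ?thesis .
qed

text \<open>Centred independent variables are orthogonal in L^2. Integrability and value form one
  conjunction because the induction step needs both for the partial sum.\<close>

lemma square_moment_indep_sum:
  fixes Y :: "'i \<Rightarrow> 'a \<Rightarrow> complex"
  assumes "finite I" "indep_vars (\<lambda>_. borel) Y I"
    and "\<And>i. i \<in> I \<Longrightarrow> integrable M (\<lambda>\<omega>. (cmod (Y i \<omega>))\<^sup>2)"
    and "\<And>i. i \<in> I \<Longrightarrow> expectation (Y i) = 0"
  shows "integrable M (\<lambda>\<omega>. (cmod (\<Sum>i\<in>I. Y i \<omega>))\<^sup>2) \<and>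
    expectation (\<lambda>\<omega>. (cmod (\<Sum>i\<in>I. Y i \<omega>))\<^sup>2) = (\<Sum>i\<in>I. expectation (\<lambda>\<omega>. (cmod (Y i \<omega>))\<^sup>2))"
  using assms
proof (induction I rule: finite_induct)
  case (insert i I)
  define S where "S = (\<lambda>\<omega>. \<Sum>i\<in>I. Y i \<omega>)"
  have ind: "indep_vars (\<lambda>_. borel) Y I"
    using insert.prems(1) by (rule indep_vars_subset) auto
  have [measurable]: "Y j \<in> borel_measurable M" if "j \<in> insert i I" for j
    using insert.prems(1) that by (auto simp: indep_vars_def)
  have [measurable]: "Y i \<in> borel_measurable M" "S \<in> borel_measurable M"
    by (auto simp: S_def)
  have S: "integrable M (\<lambda>\<omega>. (cmod (S \<omega>))\<^sup>2)"
    "expectation (\<lambda>\<omega>. (cmod (S \<omega>))\<^sup>2) = (\<Sum>i\<in>I. expectation (\<lambda>\<omega>. (cmod (Y i \<omega>))\<^sup>2))"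
    using insert.IH[OF ind] insert.prems by (auto simp: S_def)
  have i2: "integrable M (\<lambda>\<omega>. (cmod (Y i \<omega>))\<^sup>2)" using insert.prems by auto
  have iS: "integrable M S" and iY: "integrable M (Y i)"
    using integrable_of_square[of S] integrable_of_square[of "Y i"] S i2 by auto
  have "indep_var borel (Y i) borel S"
    using indep_vars_sum_complex[OF insert.hyps insert.prems(1)] by (simp add: S_def)
  then have iv: "indep_var borel (Y i) borel (\<lambda>\<omega>. cnj (S \<omega>))"
    using indep_var_compose[of borel "Y i" borel S "\<lambda>x. x" borel cnj borel] by (simp add: comp_def)
  have icS: "integrable M (\<lambda>\<omega>. cnj (S \<omega>))" using iS by simp
  have cross: "integrable M (\<lambda>\<omega>. Y i \<omega> * cnj (S \<omega>))" "expectation (\<lambda>\<omega>. Y i \<omega> * cnj (S \<omega>)) = 0"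
    using indep_var_lebesgue_integral[OF iv iY icS] indep_var_integrable[OF iv iY icS] insert.prems(3)
    by auto
  define P where "P = (\<lambda>\<omega>. Re (Y i \<omega> * cnj (S \<omega>)))"
  have P: "integrable M P" "expectation P = 0"
    using cross integral_Re[OF cross(1)] integrable_Re[OF cross(1)] by (simp_all add: P_def del: times_complex.sel)
  have eq: "(cmod (\<Sum>i\<in>insert i I. Y i \<omega>))\<^sup>2 = (cmod (Y i \<omega>))\<^sup>2 + ((cmod (S \<omega>))\<^sup>2 + 2 * P \<omega>)" for \<omega>
  proof -
    have "(cmod (a + b))\<^sup>2 = (cmod a)\<^sup>2 + ((cmod b)\<^sup>2 + 2 * Re (a * cnj b))" for a b
      by (simp only: cmod_power2) (simp add: power2_eq_square algebra_simps)
    moreover have "(\<Sum>i\<in>insert i I. Y i \<omega>) = Y i \<omega> + S \<omega>"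
      using insert.hyps by (simp add: S_def)
    ultimately show ?thesis unfolding P_def by metis
  qed
  show ?case
    unfolding eq using insert.hyps S i2 P by simp
qed simp

text \<open>
  A Rosenthal type inequality. With $F(z) = \overline{z}\,|z|^s$ one has $|S|^{2+s} = \sum_i Y_i F(S)$,
  and $E\,Y_i F(S - Y_i) = 0$ by independence; the increments $F(S) - F(S - Y_i)$ are controlled by
  \<open>cnj_powr_Lipschitz\<close>.
\<close>

lemma powr_moment_indep_sum:
  fixes Y :: "'i \<Rightarrow> 'a \<Rightarrow> complex"
  assumes fin: "finite I" and ind: "indep_vars (\<lambda>_. borel) Y I"
    and s: "0 < s" "s \<le> 1"
    and int: "\<And>i. i \<in> I \<Longrightarrow> integrable M (\<lambda>\<omega>. cmod (Y i \<omega>) powr (2 + s))"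
    and mean: "\<And>i. i \<in> I \<Longrightarrow> expectation (Y i) = 0"
    and V: "(\<Sum>i\<in>I. expectation (\<lambda>\<omega>. (cmod (Y i \<omega>))\<^sup>2)) \<le> V" "V > 0"
  shows "integrable M (\<lambda>\<omega>. cmod (\<Sum>i\<in>I. Y i \<omega>) powr (2 + s))"
    and "expectation (\<lambda>\<omega>. cmod (\<Sum>i\<in>I. Y i \<omega>) powr (2 + s))
      \<le> 4 * V powr ((2 + s) / 2) + (\<Sum>i\<in>I. expectation (\<lambda>\<omega>. cmod (Y i \<omega>) powr (2 + s)))"
proof -
  have Ym[measurable]: "Y j \<in> borel_measurable M" if "j \<in> I" for j
    using ind that by (auto simp: indep_vars_def)
  have int2: "integrable M (\<lambda>\<omega>. (cmod (Y i \<omega>))\<^sup>2)" if "i \<in> I" for i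
    using integrable_square_of_powr[OF Ym[OF that] int[OF that]] s by simp
  have int1: "integrable M (Y i)" if "i \<in> I" for i
    using integrable_of_square[OF Ym[OF that] int2[OF that]] .
  define F where "F = (\<lambda>z. cnj z * of_real (cmod z powr s))"
  have [measurable]: "F \<in> borel_measurable borel"
    unfolding F_def by (intro borel_measurable_times borel_measurable_of_real) measurable
  define S where "S = (\<lambda>\<omega>. \<Sum>i\<in>I. Y i \<omega>)"
  define R where "R = (\<lambda>i \<omega>. \<Sum>j\<in>I - {i}. Y j \<omega>)"
  have [measurable]: "S \<in> borel_measurable M" unfolding S_def by measurable
  have Rm[measurable]: "R i \<in> borel_measurable M" for i
    unfolding R_def by measurable
  have SR: "S \<omega> = R i \<omega> + Y i \<omega>" if "i \<in> I" for i \<omega>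
    using fin that by (simp add: S_def R_def sum.remove[of I i])
  have R2: "integrable M (\<lambda>\<omega>. (cmod (R i \<omega>))\<^sup>2)" "expectation (\<lambda>\<omega>. (cmod (R i \<omega>))\<^sup>2) \<le> V" 
    if "i \<in> I" for i
  proof -
    have *: "integrable M (\<lambda>\<omega>. (cmod (R i \<omega>))\<^sup>2) \<and> expectation (\<lambda>\<omega>. (cmod (R i \<omega>))\<^sup>2) = 
      (\<Sum>j\<in>I - {i}. expectation (\<lambda>\<omega>. (cmod (Y j \<omega>))\<^sup>2))"
      unfolding R_def using fin int2 mean
      by (intro square_moment_indep_sum indep_vars_subset[OF ind]) auto
    then show "integrable M (\<lambda>\<omega>. (cmod (R i \<omega>))\<^sup>2)" by simp
    have "(\<Sum>j\<in>I - {i}. expectation (\<lambda>\<omega>. (cmod (Y j \<omega>))\<^sup>2)) \<le> (\<Sum>j\<in>I. expectation (\<lambda>\<omega>. (cmod (Y j \<omega>))\<^sup>2))"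
      using fin by (intro sum_mono2) auto
    then show "expectation (\<lambda>\<omega>. (cmod (R i \<omega>))\<^sup>2) \<le> V"
      using * V by simp
  qed
  have Rs: "integrable M (\<lambda>\<omega>. cmod (R i \<omega>) powr s)" 
      "expectation (\<lambda>\<omega>. cmod (R i \<omega>) powr s) \<le> 2 * V powr (s / 2)" if "i \<in> I" for i
  proof -
    show int: "integrable M (\<lambda>\<omega>. cmod (R i \<omega>) powr s)"
      using integrable_powr_of_square[OF Rm R2(1)[OF that], of s] s by simp
    \<comment> \<open>After scaling by sqrt V, the pointwise bound t^s \<le> 1 + t^2 replaces
      Jensen's inequality; the price is the factor 2 in \<open>Rs\<close>.\<close>
    have le: "x powr s \<le> V powr (s / 2) * (1 + x\<^sup>2 / V)" if "x \<ge> 0" for x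
    proof -
      have "(x / sqrt V) powr s \<le> 1 + (x / sqrt V)\<^sup>2"
        using that V s by (intro powr_le_one_plus_square) auto
      moreover have "sqrt V powr s = V powr (s / 2)"
        using V by (simp add: powr_half_sqrt[symmetric] powr_powr)
      ultimately show ?thesis using that V by (simp add: powr_divide power_divide field_simps)
    qed
    have "expectation (\<lambda>\<omega>. cmod (R i \<omega>) powr s) \<le> 
        expectation (\<lambda>\<omega>. V powr (s / 2) * (1 + (cmod (R i \<omega>))\<^sup>2 / V))"
      using R2[OF that] int le by (intro integral_mono) auto
    also have "\<dots> = V powr (s / 2) * (1 + expectation (\<lambda>\<omega>. (cmod (R i \<omega>))\<^sup>2) / V)"
      using R2[OF that] by (simp add: prob_space)
    also have "\<dots> \<le> V powr (s / 2) * (1 + 1)"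
      using R2[OF that] V by (intro mult_left_mono add_mono) auto
    finally show "expectation (\<lambda>\<omega>. cmod (R i \<omega>) powr s) \<le> 2 * V powr (s / 2)" by simp
  qed
  have iv: "indep_var borel (Y i) borel (R i)" if "i \<in> I" for i
    unfolding R_def using fin that
    by (intro indep_vars_sum_complex) (auto simp: insert_absorb ind)
  \<comment> \<open>|Y_i| times the bound of \<open>cnj_powr_Lipschitz\<close> at z = R_i, y = Y_i.
    Since Y_i and R_i are independent, the mixed term has a product expectation.\<close>
  define B where "B = (\<lambda>i \<omega>. 2 * ((cmod (Y i \<omega>))\<^sup>2 * cmod (R i \<omega>) powr s) + cmod (Y i \<omega>) powr (2 + s))"
  have B: "integrable M (B i)"
     "expectation (B i) = 2 * (expectation (\<lambda>\<omega>. (cmod (Y i \<omega>))\<^sup>2) * expectation (\<lambda>\<omega>. cmod (R i \<omega>) powr s))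
        + expectation (\<lambda>\<omega>. cmod (Y i \<omega>) powr (2 + s))" if "i \<in> I" for i
  proof -
    have iv2: "indep_var borel (\<lambda>\<omega>. (cmod (Y i \<omega>))\<^sup>2) borel (\<lambda>\<omega>. cmod (R i \<omega>) powr s)"
      using indep_var_compose[OF iv[OF that], of "\<lambda>x. (cmod x)\<^sup>2" borel "\<lambda>x. cmod x powr s" borel]
      by (simp add: comp_def)
    note 1 = indep_var_lebesgue_integral[OF iv2 int2[OF that] Rs(1)[OF that]]
    note 2 = indep_var_integrable[OF iv2 int2[OF that] Rs(1)[OF that]]
    show "integrable M (B i)" unfolding B_def using 2 int[OF that] by simp
    show "expectation (B i) = 2 * (expectation (\<lambda>\<omega>. (cmod (Y i \<omega>))\<^sup>2) * expectation (\<lambda>\<omega>. cmod (R i \<omega>) powr s))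
        + expectation (\<lambda>\<omega>. cmod (Y i \<omega>) powr (2 + s))" unfolding B_def using 1 2 int[OF that] by simp
  qed
  have bound: "cmod (Y i \<omega> * (F (S \<omega>) - F (R i \<omega>))) \<le> B i \<omega>" if "i \<in> I" for i \<omega>
  proof -
    have "cmod (Y i \<omega> * (F (S \<omega>) - F (R i \<omega>))) \<le> 
        cmod (Y i \<omega>) * (cmod (Y i \<omega>) * (2 * cmod (R i \<omega>) powr s + cmod (Y i \<omega>) powr s))"
      unfolding F_def SR[OF that] norm_mult[of "Y i \<omega>"]
      by (intro mult_left_mono cnj_powr_Lipschitz s) auto
    also have "\<dots> = B i \<omega>"
      by (cases "Y i \<omega> = 0") (auto simp: B_def algebra_simps power2_eq_square powr_add)
    finally show ?thesis .
  qed
  have iD: "integrable M (\<lambda>\<omega>. Y i \<omega> * (F (S \<omega>) - F (R i \<omega>)))" if "i \<in> I" for i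
  proof (rule Bochner_Integration.integrable_bound[OF B(1)[OF that]])
    show "(\<lambda>\<omega>. Y i \<omega> * (F (S \<omega>) - F (R i \<omega>))) \<in> borel_measurable M"
      using that by measurable
    show "AE x in M. cmod (Y i x * (F (S x) - F (R i x))) \<le> norm (B i x)"
      using bound[OF that] by (auto intro: order_trans[OF _ abs_ge_self])
  qed
  have iR: "integrable M (\<lambda>\<omega>. Y i \<omega> * F (R i \<omega>)) \<and> expectation (\<lambda>\<omega>. Y i \<omega> * F (R i \<omega>)) = 0"
    if "i \<in> I" for i
  proof -
    have iv2: "indep_var borel (Y i) borel (\<lambda>\<omega>. F (R i \<omega>))"
      using indep_var_compose[OF iv[OF that], of "\<lambda>x. x" borel F borel]
      by (simp add: comp_def)
    have "integrable M (\<lambda>\<omega>. cmod (R i \<omega>) powr (1 + s))"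
      using integrable_powr_of_square[OF Rm R2(1)[OF that], of "1 + s"] s by simp
    moreover have "cmod (F (R i \<omega>)) = cmod (R i \<omega>) powr (1 + s)" for \<omega>
      by (cases "R i \<omega> = 0") (auto simp: F_def norm_mult powr_add)
    ultimately have "integrable M (\<lambda>\<omega>. F (R i \<omega>))"
      by (subst integrable_norm_iff[symmetric]) auto
    then show ?thesis
      using indep_var_lebesgue_integral[OF iv2 int1[OF that]] indep_var_integrable[OF iv2 int1[OF that]] 
       mean[OF that] by auto
  qed
  have eq: "of_real (cmod (S \<omega>) powr (2 + s)) = 
     (\<Sum>i\<in>I. Y i \<omega> * (F (S \<omega>) - F (R i \<omega>)) + Y i \<omega> * F (R i \<omega>))" for \<omega>
  proof -
    have "(\<Sum>i\<in>I. Y i \<omega> * (F (S \<omega>) - F (R i \<omega>)) + Y i \<omega> * F (R i \<omega>)) = S \<omega> * F (S \<omega>)"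
      by (simp add: S_def sum_distrib_right algebra_simps)
    also have "\<dots> = of_real ((cmod (S \<omega>))\<^sup>2 * cmod (S \<omega>) powr s)"
      by (simp only: F_def of_real_mult complex_norm_square mult.assoc)
    also have "(cmod (S \<omega>))\<^sup>2 * cmod (S \<omega>) powr s = cmod (S \<omega>) powr (2 + s)"
      by (cases "S \<omega> = 0") (auto simp: powr_add)
    finally show ?thesis by simp
  qed
  \<comment> \<open>The identity \<open>eq\<close> also yields the integrability of |S|^(2+s), as
    every term on its right-hand side is integrable.\<close>
  have "integrable M (\<lambda>\<omega>. complex_of_real (cmod (S \<omega>) powr (2 + s)))"
    unfolding eq using iD iR by (intro Bochner_Integration.integrable_sum Bochner_Integration.integrable_add) auto
  from integrable_Re[OF this] show int_S: "integrable M (\<lambda>\<omega>. cmod (\<Sum>i\<in>I. Y i \<omega>) powr (2 + s))"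
    by (simp add: S_def)
  have "complex_of_real (expectation (\<lambda>\<omega>. cmod (S \<omega>) powr (2 + s))) = 
      expectation (\<lambda>\<omega>. complex_of_real (cmod (S \<omega>) powr (2 + s)))" by simp
  also have "\<dots> = (\<Sum>i\<in>I. expectation (\<lambda>\<omega>. Y i \<omega> * (F (S \<omega>) - F (R i \<omega>))))"
    unfolding eq using iD iR by (subst Bochner_Integration.integral_sum) auto
  finally have "expectation (\<lambda>\<omega>. cmod (S \<omega>) powr (2 + s)) \<le> 
      cmod (\<Sum>i\<in>I. expectation (\<lambda>\<omega>. Y i \<omega> * (F (S \<omega>) - F (R i \<omega>))))"
    by (metis abs_ge_self norm_of_real)
  also have "\<dots> \<le> (\<Sum>i\<in>I. expectation (B i))"
  proof (intro sum_norm_le)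
    fix i assume i: "i \<in> I"
    show "cmod (expectation (\<lambda>\<omega>. Y i \<omega> * (F (S \<omega>) - F (R i \<omega>)))) \<le> expectation (B i)"
      by (rule norm_integral_le_integral[OF iD[OF i] B(1)[OF i]]) (rule bound[OF i])
  qed
  \<comment> \<open>The 4 is the 2 in \<open>B\<close> times the 2 in \<open>Rs\<close>.\<close>
  also have "\<dots> \<le> (\<Sum>i\<in>I. 4 * V powr (s / 2) * expectation (\<lambda>\<omega>. (cmod (Y i \<omega>))\<^sup>2)
      + expectation (\<lambda>\<omega>. cmod (Y i \<omega>) powr (2 + s)))"
  proof (intro sum_mono)
    fix i assume i: "i \<in> I"
    have "expectation (\<lambda>\<omega>. (cmod (Y i \<omega>))\<^sup>2) * expectation (\<lambda>\<omega>. cmod (R i \<omega>) powr s) \<le> 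
       expectation (\<lambda>\<omega>. (cmod (Y i \<omega>))\<^sup>2) * (2 * V powr (s / 2))"
      by (intro mult_left_mono Rs(2) i) auto
    then show "expectation (B i) \<le> 4 * V powr (s / 2) * expectation (\<lambda>\<omega>. (cmod (Y i \<omega>))\<^sup>2)
      + expectation (\<lambda>\<omega>. cmod (Y i \<omega>) powr (2 + s))"
      unfolding B(2)[OF i] by (simp add: algebra_simps)
  qed
  also have "\<dots> = 4 * V powr (s / 2) * (\<Sum>i\<in>I. expectation (\<lambda>\<omega>. (cmod (Y i \<omega>))\<^sup>2))
      + (\<Sum>i\<in>I. expectation (\<lambda>\<omega>. cmod (Y i \<omega>) powr (2 + s)))"
    unfolding sum.distrib sum_distrib_left ..
  also have "\<dots> \<le> 4 * V powr (s / 2) * V + (\<Sum>i\<in>I. expectation (\<lambda>\<omega>. cmod (Y i \<omega>) powr (2 + s)))"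
    by (intro add_right_mono mult_left_mono V) auto
  also have "4 * V powr (s / 2) * V = 4 * (V powr (s / 2) * V)" by simp
  also have "V powr (s / 2) * V = V powr ((2 + s) / 2)"
    using V(2) by (simp add: add_divide_distrib powr_add)
  finally show "expectation (\<lambda>\<omega>. cmod (\<Sum>i\<in>I. Y i \<omega>) powr (2 + s))
      \<le> 4 * V powr ((2 + s) / 2) + (\<Sum>i\<in>I. expectation (\<lambda>\<omega>. cmod (Y i \<omega>) powr (2 + s)))"
    by (simp add: S_def)
qed

end

section \<open>Characteristic functions of sums of independent variables\<close>

text \<open>Interpolates the two Taylor remainders of the characteristic function, so that a moment
  of order 2 + s controls the error. The 6 cancels the 1/6 in \<open>char_approx3'\<close>.\<close>

lemma min_cube_le_powr:
  fixes x s :: real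
  assumes "0 \<le> s" "s \<le> 1"
  shows "min (6 * x\<^sup>2) (\<bar>x\<bar> ^ 3) \<le> 6 * \<bar>x\<bar> powr (2 + s)"
proof (cases "\<bar>x\<bar> \<le> 1")
  case True
  then have "\<bar>x\<bar> powr 3 \<le> \<bar>x\<bar> powr (2 + s)"
    using assms by (intro powr_mono') auto
  also have "\<dots> \<le> 6 * \<bar>x\<bar> powr (2 + s)" by simp
  finally show ?thesis by (cases "x = 0") (auto simp: min_le_iff_disj)
next
  case False
  then have "\<bar>x\<bar> powr 2 \<le> \<bar>x\<bar> powr (2 + s)"
    using assms by (intro powr_mono) auto
  then show ?thesis by (cases "x = 0") (auto simp: min_le_iff_disj)
qed

lemma exp_minus_approx:
  fixes x :: real
  assumes "0 \<le> x"
  shows "\<bar>exp (- x) - (1 - x)\<bar> \<le> x\<^sup>2"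
proof -
  have "1 - x \<le> exp (- x)" using exp_ge_add_one_self[of "- x"] by simp
  moreover have "exp (- x) \<le> 1 - x + x\<^sup>2"
  proof -
    have "exp (- x) \<le> 1 / (1 + x)"
      using exp_ge_add_one_self[of x] assms by (simp add: exp_minus field_simps)
    also have "\<dots> \<le> 1 - x + x\<^sup>2"
      using assms by (simp add: field_simps power2_eq_square)
    finally show ?thesis .
  qed
  ultimately show ?thesis by simp
qed

context prob_space
begin

text \<open>Lyapunov's theorem with an explicit error, since the summands and their probability
  space change with n. All factors have modulus at most 1, so the two products differ by at most the
  sum of the differences of their factors. Both the characteristic function of U_i and exp(- v_i /
  2) are close to 1 - v_i / 2; the second error is at most v_i^2 \<le> \<delta> v_i.\<close>

lemma char_indep_sum_approx:
  fixes U :: "'i \<Rightarrow> 'a \<Rightarrow> real"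
  assumes fin: "finite I" and ind: "indep_vars (\<lambda>_. borel) U I"
    and s: "0 < s" "s \<le> 1"
    and int: "\<And>i. i \<in> I \<Longrightarrow> integrable M (\<lambda>\<omega>. \<bar>U i \<omega>\<bar> powr (2 + s))"
    and int2: "\<And>i. i \<in> I \<Longrightarrow> integrable M (\<lambda>\<omega>. (U i \<omega>)\<^sup>2)"
    and mean: "\<And>i. i \<in> I \<Longrightarrow> expectation (U i) = 0"
    and small: "\<And>i. i \<in> I \<Longrightarrow> expectation (\<lambda>\<omega>. (U i \<omega>)\<^sup>2) \<le> \<delta>" 
    and V: "V = (\<Sum>i\<in>I. expectation (\<lambda>\<omega>. (U i \<omega>)\<^sup>2))"
  shows "cmod (expectation (\<lambda>\<omega>. iexp (\<Sum>i\<in>I. U i \<omega>)) - exp (- V / 2)) \<le>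
     (\<Sum>i\<in>I. expectation (\<lambda>\<omega>. \<bar>U i \<omega>\<bar> powr (2 + s))) + \<delta> * V"
proof -
  have Um[measurable]: "U j \<in> borel_measurable M" if "j \<in> I" for j
    using ind that by (auto simp: indep_vars_def)
  define v where "v = (\<lambda>i. expectation (\<lambda>\<omega>. (U i \<omega>)\<^sup>2))"
  have v0: "v i \<ge> 0" for i by (simp add: v_def)
  have one: "cmod (char (distr M borel (U i)) 1 - exp (- v i / 2)) \<le> 
      expectation (\<lambda>\<omega>. \<bar>U i \<omega>\<bar> powr (2 + s)) + \<delta> * v i" if i: "i \<in> I" for i
  proof -
    have int1: "integrable M (U i)"
      using square_integrable_imp_integrable[OF Um[OF i] int2[OF i]] .
    have "cmod (char (distr M borel (U i)) 1 - (1 - 1\<^sup>2 * v i / 2)) \<le>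
       (1\<^sup>2 / 6) * expectation (\<lambda>x. min (6 * (U i x)^2) (\<bar>1\<bar> * \<bar>U i x\<bar>^3))"
      using i int1 int2 mean by (intro char_approx3') (auto simp: v_def)
    also have "\<dots> \<le> (1\<^sup>2 / 6) * expectation (\<lambda>x. 6 * \<bar>U i x\<bar> powr (2 + s))"
    proof (intro mult_left_mono integral_mono)
      show "integrable M (\<lambda>x. min (6 * (U i x)^2) (\<bar>1\<bar> * \<bar>U i x\<bar>^3))"
        by (rule Bochner_Integration.integrable_bound[where f="\<lambda>x. 6 * (U i x)\<^sup>2"])
           (use i int2 in auto)
    qed (use min_cube_le_powr[of s] s int i in auto)
    finally have 1: "cmod (char (distr M borel (U i)) 1 - of_real (1 - v i / 2)) \<le>
       expectation (\<lambda>x. \<bar>U i x\<bar> powr (2 + s))" by simp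
    have "\<bar>exp (- (v i / 2)) - (1 - v i / 2)\<bar> \<le> (v i / 2)\<^sup>2"
      using v0[of i] by (intro exp_minus_approx) auto
    also have "\<dots> \<le> v i * v i" using v0[of i] by (simp add: power2_eq_square)
    also have "\<dots> \<le> \<delta> * v i" using v0[of i] small[OF i] by (intro mult_right_mono) (auto simp: v_def)
    finally have 2: "cmod (of_real (1 - v i / 2) - of_real (exp (- v i / 2))) \<le> \<delta> * v i"
      by (simp only: of_real_diff[symmetric] norm_of_real) (simp add: abs_minus_commute)
    show ?thesis using norm_triangle_mono[OF 1 2] by simp
  qed
  have "expectation (\<lambda>\<omega>. iexp (\<Sum>i\<in>I. U i \<omega>)) = char (distr M borel (\<lambda>\<omega>. \<Sum>i\<in>I. U i \<omega>)) 1"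
    by (simp add: char_def integral_distr)
  also have "\<dots> = (\<Prod>i\<in>I. char (distr M borel (U i)) 1)"
    by (rule char_distr_sum[OF ind])
  finally have eq: "expectation (\<lambda>\<omega>. iexp (\<Sum>i\<in>I. U i \<omega>)) = \<dots>" .
  have "exp (- V / 2) = (\<Prod>i\<in>I. exp (- v i / 2))"
    using fin by (simp add: V v_def exp_sum[symmetric] sum_negf sum_divide_distrib)
  then have "cmod (expectation (\<lambda>\<omega>. iexp (\<Sum>i\<in>I. U i \<omega>)) - exp (- V / 2)) =
     cmod ((\<Prod>i\<in>I. char (distr M borel (U i)) 1) - (\<Prod>i\<in>I. of_real (exp (- v i / 2))))"
    unfolding eq by simp
  also have "\<dots> \<le> (\<Sum>i\<in>I. cmod (char (distr M borel (U i)) 1 - of_real (exp (- v i / 2))))"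
  proof (intro norm_prod_diff)
    show "cmod (char (distr M borel (U i)) 1) \<le> 1" if "i \<in> I" for i
      using that by (intro real_distribution.cmod_char_le_1 real_distribution_distr) auto
    show "cmod (of_real (exp (- v i / 2))) \<le> 1" if "i \<in> I" for i
      using v0[of i] by simp
  qed
  also have "\<dots> \<le> (\<Sum>i\<in>I. expectation (\<lambda>\<omega>. \<bar>U i \<omega>\<bar> powr (2 + s)) + \<delta> * v i)"
    using one by (intro sum_mono) simp
  also have "\<dots> = (\<Sum>i\<in>I. expectation (\<lambda>\<omega>. \<bar>U i \<omega>\<bar> powr (2 + s))) + \<delta> * V"
    by (simp add: sum.distrib V v_def sum_distrib_left)
  finally show ?thesis .
qed

text \<open>Cramer-Wold: the real projections U_i = Re (w Y_i) / sqrt V are fed into the real case.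
  As (Re z)^2 = (|z|^2 + Re (z^2)) / 2, their total variance is (|w|^2 + Re (w^2 q)) / 2, where
  \<open>q\<close> is the pseudo-variance relative to \<open>V\<close>. Here \<delta> bounds the
  share of a single summand in the variance.\<close>

lemma char_indep_sum_complex_approx:
  fixes Y :: "'i \<Rightarrow> 'a \<Rightarrow> complex" and w q :: complex
  assumes fin: "finite I" and ind: "indep_vars (\<lambda>_. borel) Y I"
    and s: "0 < s" "s \<le> 1"
    and int: "\<And>i. i \<in> I \<Longrightarrow> integrable M (\<lambda>\<omega>. cmod (Y i \<omega>) powr (2 + s))"
    and mean: "\<And>i. i \<in> I \<Longrightarrow> expectation (Y i) = 0"
    and V: "V = (\<Sum>i\<in>I. expectation (\<lambda>\<omega>. (cmod (Y i \<omega>))\<^sup>2))" "V > 0"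
    and small: "\<And>i. i \<in> I \<Longrightarrow> expectation (\<lambda>\<omega>. (cmod (Y i \<omega>))\<^sup>2) \<le> \<delta> * V" 
    and q: "(\<Sum>i\<in>I. expectation (\<lambda>\<omega>. (Y i \<omega>)\<^sup>2)) = q * of_real V"
  shows "cmod (expectation (\<lambda>\<omega>. iexp (Re (w * ((\<Sum>i\<in>I. Y i \<omega>) / of_real (sqrt V)))))
        - exp (- ((cmod w)\<^sup>2 + Re (w\<^sup>2 * q)) / 4)) \<le>
     cmod w powr (2 + s) * ((\<Sum>i\<in>I. expectation (\<lambda>\<omega>. cmod (Y i \<omega>) powr (2 + s))) / V powr ((2 + s) / 2))
       + \<delta> * (cmod w) ^ 4"
proof -
  let ?p = "2 + s"
  have Ym[measurable]: "Y j \<in> borel_measurable M" if "j \<in> I" for j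
    using ind that by (auto simp: indep_vars_def)
  have int2: "integrable M (\<lambda>\<omega>. (cmod (Y i \<omega>))\<^sup>2)" if "i \<in> I" for i
    using integrable_square_of_powr[OF Ym[OF that] int[OF that]] s by simp
  have int1: "integrable M (Y i)" if "i \<in> I" for i
    using integrable_of_square[OF Ym[OF that] int2[OF that]] .
  have intsq: "integrable M (\<lambda>\<omega>. (Y i \<omega>)\<^sup>2)" if "i \<in> I" for i
    using int2[OF that] Ym[OF that]
    by (subst integrable_norm_iff[symmetric]) (simp_all add: norm_power)
  define U where "U = (\<lambda>i \<omega>. Re (w * Y i \<omega>) / sqrt V)"
  have indU: "indep_vars (\<lambda>_. borel) U I"
    unfolding U_def by (rule indep_vars_compose2[OF ind, where Y="\<lambda>i z. Re (w * z) / sqrt V"]) measurable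
  have Um: "U i \<in> borel_measurable M" if "i \<in> I" for i
    using indU that by (auto simp: indep_vars_def)
  have Uabs: "\<bar>U i \<omega>\<bar> \<le> cmod w * cmod (Y i \<omega>) / sqrt V" for i \<omega>
    using abs_Re_le_cmod[of "w * Y i \<omega>"] V by (simp add: U_def norm_mult divide_right_mono)
  have Up: "\<bar>U i \<omega>\<bar> powr ?p \<le> cmod w powr ?p * (cmod (Y i \<omega>) powr ?p / V powr (?p / 2))" for i \<omega>
  proof -
    have "\<bar>U i \<omega>\<bar> powr ?p \<le> (cmod w * cmod (Y i \<omega>) / sqrt V) powr ?p"
      using Uabs s by (intro powr_mono2) auto
    also have "sqrt V = V powr (1 / 2)" using V by (simp add: powr_half_sqrt)
    finally show ?thesis using V by (simp add: powr_mult powr_divide powr_powr)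
  qed
  have Usq: "(U i \<omega>)\<^sup>2 = ((cmod w)\<^sup>2 * (cmod (Y i \<omega>))\<^sup>2 + Re (w\<^sup>2 * (Y i \<omega>)\<^sup>2)) / (2 * V)" for i \<omega>
  proof -
    have "(Re z)\<^sup>2 = ((cmod z)\<^sup>2 + Re (z\<^sup>2)) / 2" for z
      unfolding cmod_power2 Re_power2 by simp
    from this[of "w * Y i \<omega>"] show ?thesis
      using V by (simp only: U_def power_divide norm_mult power_mult_distrib) simp
  qed
  have intR: "integrable M (\<lambda>\<omega>. Re (w\<^sup>2 * (Y i \<omega>)\<^sup>2))"
    "expectation (\<lambda>\<omega>. Re (w\<^sup>2 * (Y i \<omega>)\<^sup>2)) = Re (w\<^sup>2 * expectation (\<lambda>\<omega>. (Y i \<omega>)\<^sup>2))" if "i \<in> I" for i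
  proof -
    have i: "integrable M (\<lambda>\<omega>. w\<^sup>2 * (Y i \<omega>)\<^sup>2)" using intsq[OF that] by (rule integrable_mult_right)
    then show "integrable M (\<lambda>\<omega>. Re (w\<^sup>2 * (Y i \<omega>)\<^sup>2))" by (rule integrable_Re)
    show "expectation (\<lambda>\<omega>. Re (w\<^sup>2 * (Y i \<omega>)\<^sup>2)) = Re (w\<^sup>2 * expectation (\<lambda>\<omega>. (Y i \<omega>)\<^sup>2))"
      unfolding integral_Re[OF i] by simp
  qed
  have EU2: "expectation (\<lambda>\<omega>. (U i \<omega>)\<^sup>2) = ((cmod w)\<^sup>2 * expectation (\<lambda>\<omega>. (cmod (Y i \<omega>))\<^sup>2)
      + Re (w\<^sup>2 * expectation (\<lambda>\<omega>. (Y i \<omega>)\<^sup>2))) / (2 * V)" if "i \<in> I" for i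
    unfolding Usq using int2[OF that] intR[OF that] by (simp del: times_complex.sel)
  have intU2: "integrable M (\<lambda>\<omega>. (U i \<omega>)\<^sup>2)" if "i \<in> I" for i
    unfolding Usq using int2[OF that] intR[OF that] by (simp del: times_complex.sel)
  have EU2_le: "expectation (\<lambda>\<omega>. (U i \<omega>)\<^sup>2) \<le> (cmod w)\<^sup>2 * expectation (\<lambda>\<omega>. (cmod (Y i \<omega>))\<^sup>2) / V" if "i \<in> I" for i
  proof -
    have "(U i \<omega>)\<^sup>2 \<le> (cmod w)\<^sup>2 * (cmod (Y i \<omega>))\<^sup>2 / V" for \<omega>
      using power_mono[OF Uabs, of i \<omega> 2] V by (simp add: power_divide power_mult_distrib)
    then have "expectation (\<lambda>\<omega>. (U i \<omega>)\<^sup>2) \<le> expectation (\<lambda>\<omega>. (cmod w)\<^sup>2 * (cmod (Y i \<omega>))\<^sup>2 / V)"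
      using intU2[OF that] int2[OF that] by (intro integral_mono) auto
    then show ?thesis by simp
  qed
  have sumU2: "(\<Sum>i\<in>I. expectation (\<lambda>\<omega>. (U i \<omega>)\<^sup>2)) = ((cmod w)\<^sup>2 + Re (w\<^sup>2 * q)) / 2"
  proof -
    have "(\<Sum>i\<in>I. expectation (\<lambda>\<omega>. (U i \<omega>)\<^sup>2)) = ((cmod w)\<^sup>2 * V + Re (w\<^sup>2 * (\<Sum>i\<in>I. expectation (\<lambda>\<omega>. (Y i \<omega>)\<^sup>2)))) / (2 * V)"
    proof -
      have "(\<Sum>i\<in>I. expectation (\<lambda>\<omega>. (U i \<omega>)\<^sup>2)) = (\<Sum>i\<in>I. ((cmod w)\<^sup>2 * expectation (\<lambda>\<omega>. (cmod (Y i \<omega>))\<^sup>2)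
          + Re (w\<^sup>2 * expectation (\<lambda>\<omega>. (Y i \<omega>)\<^sup>2))) / (2 * V))"
        by (intro sum.cong EU2 refl)
      also have "\<dots> = ((cmod w)\<^sup>2 * (\<Sum>i\<in>I. expectation (\<lambda>\<omega>. (cmod (Y i \<omega>))\<^sup>2))
          + Re (w\<^sup>2 * (\<Sum>i\<in>I. expectation (\<lambda>\<omega>. (Y i \<omega>)\<^sup>2)))) / (2 * V)"
        by (simp only: sum_divide_distrib[symmetric] sum.distrib sum_distrib_left Re_sum)
      finally show ?thesis unfolding V(1)[symmetric] .
    qed
    also have "w\<^sup>2 * (\<Sum>i\<in>I. expectation (\<lambda>\<omega>. (Y i \<omega>)\<^sup>2)) = of_real V * (w\<^sup>2 * q)"
      unfolding q by simp
    also have "Re (of_real V * (w\<^sup>2 * q)) = V * Re (w\<^sup>2 * q)" by (simp only: Re_complex_of_real times_complex.sel) simp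
    also have "((cmod w)\<^sup>2 * V + V * Re (w\<^sup>2 * q)) / (2 * V) = ((cmod w)\<^sup>2 + Re (w\<^sup>2 * q)) / 2"
      using V(2) by (simp only: mult.commute[of "(cmod w)\<^sup>2"] distrib_left[symmetric] mult.commute[of 2]) simp
    finally show ?thesis .
  qed
  have sumU2_le: "(\<Sum>i\<in>I. expectation (\<lambda>\<omega>. (U i \<omega>)\<^sup>2)) \<le> (cmod w)\<^sup>2"
  proof -
    have "(\<Sum>i\<in>I. expectation (\<lambda>\<omega>. (U i \<omega>)\<^sup>2)) \<le> (\<Sum>i\<in>I. (cmod w)\<^sup>2 * expectation (\<lambda>\<omega>. (cmod (Y i \<omega>))\<^sup>2) / V)"
      by (intro sum_mono EU2_le)
    also have "\<dots> = (cmod w)\<^sup>2 * V / V"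
      unfolding V(1) sum_divide_distrib[symmetric] sum_distrib_left[symmetric] ..
    finally show ?thesis using V by simp
  qed
  have intUp: "integrable M (\<lambda>\<omega>. \<bar>U i \<omega>\<bar> powr ?p)" if "i \<in> I" for i
    by (rule Bochner_Integration.integrable_bound[where f="\<lambda>\<omega>. cmod w powr ?p * (cmod (Y i \<omega>) powr ?p / V powr (?p / 2))"])
       (use Up int[OF that] Um[OF that] in auto)
  have small': "expectation (\<lambda>\<omega>. (U i \<omega>)\<^sup>2) \<le> (cmod w)\<^sup>2 * \<delta>" if "i \<in> I" for i
  proof -
    have "expectation (\<lambda>\<omega>. (U i \<omega>)\<^sup>2) \<le> (cmod w)\<^sup>2 * (\<delta> * V) / V"
      using small[OF that] V by (intro order_trans[OF EU2_le[OF that]] divide_right_mono mult_left_mono) auto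
    then show ?thesis using V by simp
  qed
  have meanU: "expectation (U i) = 0" if "i \<in> I" for i
  proof -
    have i: "integrable M (\<lambda>\<omega>. w * Y i \<omega>)" using int1[OF that] by (rule integrable_mult_right)
    have "expectation (U i) = Re (expectation (\<lambda>\<omega>. w * Y i \<omega>)) / sqrt V"
      unfolding U_def integral_Re[OF i, symmetric] by simp
    then show ?thesis using mean[OF that] by simp
  qed
  have sumU: "Re (w * ((\<Sum>i\<in>I. Y i \<omega>) / of_real (sqrt V))) = (\<Sum>i\<in>I. U i \<omega>)" for \<omega>
  proof -
    have "w * ((\<Sum>i\<in>I. Y i \<omega>) / of_real (sqrt V)) = (\<Sum>i\<in>I. w * Y i \<omega>) / of_real (sqrt V)"
      by (simp add: sum_distrib_left)
    then show ?thesis by (simp only: Re_divide_of_real U_def Re_sum sum_divide_distrib)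
  qed
  have "cmod (expectation (\<lambda>\<omega>. iexp (\<Sum>i\<in>I. U i \<omega>)) - exp (- (((cmod w)\<^sup>2 + Re (w\<^sup>2 * q)) / 2) / 2)) \<le>
     (\<Sum>i\<in>I. expectation (\<lambda>\<omega>. \<bar>U i \<omega>\<bar> powr ?p)) + (cmod w)\<^sup>2 * \<delta> * (((cmod w)\<^sup>2 + Re (w\<^sup>2 * q)) / 2)"
    by (rule char_indep_sum_approx[OF fin indU s intUp intU2 meanU small' sumU2[symmetric]])
  also have "(\<Sum>i\<in>I. expectation (\<lambda>\<omega>. \<bar>U i \<omega>\<bar> powr ?p)) \<le>
     (\<Sum>i\<in>I. expectation (\<lambda>\<omega>. cmod w powr ?p * (cmod (Y i \<omega>) powr ?p / V powr (?p / 2))))"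
    using intUp int Up by (intro sum_mono integral_mono) auto
  also have "\<dots> = cmod w powr ?p * ((\<Sum>i\<in>I. expectation (\<lambda>\<omega>. cmod (Y i \<omega>) powr ?p)) / V powr (?p / 2))"
    by (simp add: sum_distrib_left sum_divide_distrib)
  also have "(cmod w)\<^sup>2 * \<delta> * (((cmod w)\<^sup>2 + Re (w\<^sup>2 * q)) / 2) \<le> (cmod w)\<^sup>2 * \<delta> * (cmod w)\<^sup>2"
  proof (cases "I = {}")
    case True
    then show ?thesis using V by simp
  next
    case False
    then obtain i where "i \<in> I" by blast
    \<comment> \<open>The sign of \<delta> has to be extracted from the smallness of one summand;
      this is why the empty index set, excluded by V > 0, is split off.\<close>
    have "0 \<le> expectation (\<lambda>\<omega>. (cmod (Y i \<omega>))\<^sup>2)" by simp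
    also note small[OF \<open>i \<in> I\<close>]
    finally have "\<delta> \<ge> 0" using V by (simp add: zero_le_mult_iff)
    then show ?thesis using sumU2_le unfolding sumU2 by (intro mult_left_mono) auto
  qed
  also have "(cmod w)\<^sup>2 * \<delta> * (cmod w)\<^sup>2 = \<delta> * cmod w ^ 4" by (simp add: power2_eq_square power4_eq_xxxx)
  finally have "cmod (expectation (\<lambda>\<omega>. iexp (\<Sum>i\<in>I. U i \<omega>)) - exp (- (((cmod w)\<^sup>2 + Re (w\<^sup>2 * q)) / 2) / 2)) \<le>
     cmod w powr ?p * ((\<Sum>i\<in>I. expectation (\<lambda>\<omega>. cmod (Y i \<omega>) powr ?p)) / V powr (?p / 2)) + \<delta> * cmod w ^ 4"
    by simp
  moreover have "- (x / 2) / 2 = - x / 4" for x :: real by simp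
  ultimately show ?thesis unfolding sumU by metis
qed

end

section \<open>Weak convergence on the complex plane\<close>

text \<open>The complex span of the characters of the plane. On it, convergence of expectations is
  the pointwise convergence of characteristic functions; being an algebra
  (\<open>trig_poly_mult\<close>), it contains polynomials in sines.\<close>

inductive trig_poly :: "(complex \<Rightarrow> complex) \<Rightarrow> bool" where
  char: "trig_poly (\<lambda>z. iexp (s * Re z + t * Im z))"
| scale: "trig_poly f \<Longrightarrow> trig_poly (\<lambda>z. c * f z)"
| add: "trig_poly f \<Longrightarrow> trig_poly g \<Longrightarrow> trig_poly (\<lambda>z. f z + g z)"

lemma trig_poly_const: "trig_poly (\<lambda>z. c)"
  using trig_poly.scale[OF trig_poly.char[of 0 0], of c] by simp

lemma trig_poly_mult:
  assumes "trig_poly f" "trig_poly g"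
  shows "trig_poly (\<lambda>z. f z * g z)"
  using assms
proof (induction f rule: trig_poly.induct)
  case (char s t)
  from char.prems show ?case
  proof (induction g rule: trig_poly.induct)
    case (char s' t')
    have "iexp (s * Re z + t * Im z) * iexp (s' * Re z + t' * Im z) =
        iexp ((s + s') * Re z + (t + t') * Im z)" for z
      by (simp add: exp_add[symmetric] algebra_simps)
    then show ?case using trig_poly.char[of "s + s'" "t + t'"] by simp
  next
    case (scale g c)
    then show ?case
      using trig_poly.scale[of "\<lambda>z. iexp (s * Re z + t * Im z) * g z" c] by (simp add: mult.left_commute)
  next
    case (add g h)
    then show ?case by (simp add: trig_poly.add distrib_left)
  qed
next
  case (scale f c)
  then show ?case using trig_poly.scale[of "\<lambda>z. f z * g z" c] by (simp add: mult.assoc)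
next
  case (add f h)
  then show ?case by (simp add: trig_poly.add distrib_right)
qed

lemma trig_poly_sin: "trig_poly (\<lambda>z. of_real (sin (s * Re z + t * Im z)))"
proof -
  have "trig_poly (\<lambda>z. 1 / (2 * \<i>) * iexp (s * Re z + t * Im z)
       + (- 1 / (2 * \<i>)) * iexp (- s * Re z + - t * Im z))"
    by (intro trig_poly.intros)
  moreover have "of_real (sin x) = 1 / (2 * \<i>) * iexp x + (- 1 / (2 * \<i>)) * iexp (- x)" for x :: real
    by (simp add: sin_of_real[symmetric] sin_exp_eq field_simps exp_minus)
  then have "of_real (sin (s * Re z + t * Im z)) = 1 / (2 * \<i>) * iexp (s * Re z + t * Im z)
       + (- 1 / (2 * \<i>)) * iexp (- s * Re z + - t * Im z)" for z
    by (metis (no_types, lifting) minus_add_distrib mult_minus_left)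
  ultimately show ?thesis by simp
qed

lemma trig_poly_continuous: "trig_poly f \<Longrightarrow> continuous_on UNIV f"
  by (induction rule: trig_poly.induct) (auto intro!: continuous_intros)

lemma trig_poly_bounded: "trig_poly f \<Longrightarrow> \<exists>B. \<forall>z. cmod (f z) \<le> B"
proof (induction rule: trig_poly.induct)
  case (char s t)
  show ?case by (intro exI[of _ 1]) (simp del: of_real_add of_real_mult)
next
  case (scale f c)
  then obtain B where "\<forall>z. cmod (f z) \<le> B" by blast
  then show ?case by (intro exI[of _ "cmod c * B"]) (simp add: norm_mult mult_left_mono)
next
  case (add f g)
  then obtain B C where "\<forall>z. cmod (f z) \<le> B" "\<forall>z. cmod (g z) \<le> C" by blast
  then show ?case by (intro exI[of _ "B + C"]) (auto intro: norm_triangle_mono)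
qed

text \<open>A real linear functional on the plane is determined by its values at 1 and \<i>, so on
  the point with coordinates sin(Re z / L), sin(Im z / L) it is a combination of two sines. Products
  and sums stay in the algebra.\<close>

lemma trig_poly_real_polynomial:
  fixes P :: "complex \<Rightarrow> real"
  assumes "real_polynomial_function P"
  shows "trig_poly (\<lambda>z. of_real (P (Complex (sin (Re z / L)) (sin (Im z / L)))))"
  using assms
proof (induction rule: real_polynomial_function.induct)
  case (linear f)
  then interpret f: bounded_linear f .
  have "f (Complex a b) = f 1 * a + f \<i> * b" for a b
  proof -
    have "Complex a b = a *\<^sub>R 1 + b *\<^sub>R \<i>" by (simp add: complex_eq_iff)
    then show ?thesis by (simp only: f.add f.scaleR) simp
  qed
  moreover have "trig_poly (\<lambda>z. of_real (f 1) * of_real (sin (1 / L * Re z + 0 * Im z)) +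
      of_real (f \<i>) * of_real (sin (0 * Re z + 1 / L * Im z)))"
    by (intro trig_poly.add trig_poly.scale trig_poly_sin)
  ultimately show ?case by simp
next
  case (add f g)
  then show ?case by (simp add: trig_poly.add)
next
  case (mult f g)
  then show ?case by (simp add: trig_poly_mult)
qed (rule trig_poly_const)

text \<open>The imaginary part of the Taylor bound of order 1 for e^{ix}. It makes L sin(x / L) - x
  of order x^2 / L.\<close>

lemma abs_sin_minus_le:
  fixes x :: real
  shows "\<bar>sin x - x\<bar> \<le> x\<^sup>2 / 2"
proof -
  have "\<bar>Im (iexp x - (\<Sum>k\<le>1. (\<i> * x)^k / fact k))\<bar> \<le> \<bar>x\<bar>^(Suc 1) / fact (Suc 1)"
    by (rule order_trans[OF abs_Im_le_cmod iexp_approx1])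
  then show ?thesis by (simp add: Im_exp numeral_2_eq_2)
qed

text \<open>
  Since $L \sin(x/L) \to x$ locally uniformly, $f(z)$ is close to
  $f(L\sin(\Re z/L), L\sin(\Im z/L))$ on a large disc. The latter only involves values of $f$ on a
  compact square, so Stone--Weierstrass makes it uniformly close, on the whole plane, to a
  trigonometric polynomial.
\<close>

lemma trig_poly_approx:
  fixes f :: "complex \<Rightarrow> real"
  assumes cont: "continuous_on UNIV f" and B: "\<And>z. \<bar>f z\<bar> \<le> B" and "e > 0"
  obtains g where "trig_poly (\<lambda>z. of_real (g z))" "\<And>z. \<bar>f z - g z\<bar> \<le> e + e * (cmod z)\<^sup>2"
proof -
  \<comment> \<open>Outside the disc of radius R the allowance e |z|^2 already exceeds 2 B, the
    trivial bound for the difference of two values of f. The added 1 keeps R positive when B =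
    0.\<close>
  define R where "R = sqrt (2 * B / e) + 1"
  have B0: "0 \<le> B" using B[of 0] by linarith
  have R: "R > 0" "2 * B \<le> e * R\<^sup>2"
  proof -
    show "R > 0" using B0 \<open>e > 0\<close> by (simp add: R_def add_nonneg_pos)
    have "2 * B / e = (sqrt (2 * B / e))\<^sup>2" using B0 \<open>e > 0\<close> by simp
    also have "\<dots> \<le> R\<^sup>2" using B0 \<open>e > 0\<close> by (intro power_mono) (auto simp: R_def)
    finally show "2 * B \<le> e * R\<^sup>2" using \<open>e > 0\<close> by (simp add: field_simps)
  qed
  have "uniformly_continuous_on (cball 0 R) f"
    using cont by (intro compact_uniformly_continuous) (auto intro: continuous_on_subset)
  then obtain \<delta> where \<delta>: "\<delta> > 0" 
    "\<And>z w. z \<in> cball 0 R \<Longrightarrow> w \<in> cball 0 R \<Longrightarrow> dist w z < \<delta> \<Longrightarrow> dist (f w) (f z) < e / 2"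
    using \<open>e > 0\<close> unfolding uniformly_continuous_on_def by (metis half_gt_zero)
  \<comment> \<open>On the disc, L sin(x / L) in both coordinates moves z by at most |z|^2 / (2 L)
    \<le> R^2 / L, which this choice pushes below the modulus of continuity \<delta>.\<close>
  define L where "L = R\<^sup>2 / \<delta> + 1"
  have L: "L > 0" "R\<^sup>2 / L < \<delta>"
    using \<delta>(1) R by (auto simp: L_def field_simps add_pos_nonneg add_nonneg_pos)
  define S where "S = (\<lambda>z. Complex (sin (Re z / L)) (sin (Im z / L)))"
  have near: "\<bar>f z - f (of_real L * S z)\<bar> \<le> e / 2" if "cmod z \<le> R" for z
  proof -
    have s: "\<bar>L * sin (x / L)\<bar> \<le> \<bar>x\<bar>" for x
      using abs_sin_x_le_abs_x[of "x / L"] L by (simp add: abs_mult field_simps)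
    have sq: "(cmod w)\<^sup>2 = (Re w)\<^sup>2 + (Im w)\<^sup>2" for w by (simp add: cmod_power2)
    have "(L * sin (Re z / L))\<^sup>2 \<le> (Re z)\<^sup>2" "(L * sin (Im z / L))\<^sup>2 \<le> (Im z)\<^sup>2"
      using s by (auto intro: abs_le_square_iff[THEN iffD1])
    then have "(cmod (of_real L * S z))\<^sup>2 \<le> (cmod z)\<^sup>2"
      unfolding sq by (simp add: S_def)
    then have 1: "cmod (of_real L * S z) \<le> R" using that by (simp add: abs_le_square_iff[symmetric])
    have d: "\<bar>L * sin (x / L) - x\<bar> \<le> x\<^sup>2 / (2 * L)" for x
    proof -
      have "L * \<bar>sin (x / L) - x / L\<bar> \<le> L * ((x / L)\<^sup>2 / 2)"
        using L by (intro mult_left_mono abs_sin_minus_le) auto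
      also have "L * \<bar>sin (x / L) - x / L\<bar> = \<bar>L * (sin (x / L) - x / L)\<bar>"
        using L by (simp add: abs_mult)
      finally show ?thesis using L by (simp add: right_diff_distrib power2_eq_square)
    qed
    have "cmod (of_real L * S z - z) \<le> \<bar>Re (of_real L * S z - z)\<bar> + \<bar>Im (of_real L * S z - z)\<bar>"
      by (rule cmod_le)
    also have "\<dots> \<le> (Re z)\<^sup>2 / (2 * L) + (Im z)\<^sup>2 / (2 * L)"
      using d[of "Re z"] d[of "Im z"] by (simp add: S_def)
    also have "\<dots> = (cmod z)\<^sup>2 / (2 * L)" by (simp add: sq add_divide_distrib)
    also have "\<dots> \<le> R\<^sup>2 / L" using that L R by (intro frac_le power_mono) auto
    also have "\<dots> < \<delta>" by fact
    finally have "dist (of_real L * S z) z < \<delta>" by (simp add: dist_norm)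
    then have "dist (f (of_real L * S z)) (f z) < e / 2" using that 1 by (intro \<delta>(2)) auto
    then show ?thesis by (simp add: dist_real_def abs_minus_commute)
  qed
  \<comment> \<open>\<open>S z\<close> has modulus at most 1 + 1, so this disc contains every point
    at which the polynomial is evaluated, for all z in the plane.\<close>
  have "continuous_on (cball 0 2) (\<lambda>w. f (of_real L * w))"
    by (intro continuous_on_compose2[OF cont] continuous_intros) auto
  from Stone_Weierstrass_real_polynomial_function[OF compact_cball this, of "e / 2"] \<open>e > 0\<close>
  obtain P where P: "real_polynomial_function P" 
      "\<And>w. w \<in> cball 0 2 \<Longrightarrow> \<bar>f (of_real L * w) - P w\<bar> < e / 2" by auto
  show thesis
  proof (rule that)
    show "trig_poly (\<lambda>z. of_real (P (S z)))"
      unfolding S_def by (rule trig_poly_real_polynomial[OF P(1)])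
    fix z
    have "cmod (S z) \<le> \<bar>Re (S z)\<bar> + \<bar>Im (S z)\<bar>" by (rule cmod_le)
    also have "\<dots> \<le> 1 + 1" unfolding S_def by (intro add_mono) auto
    finally have 1: "\<bar>f (of_real L * S z) - P (S z)\<bar> < e / 2" by (intro P(2)) auto
    have 2: "\<bar>f z - f (of_real L * S z)\<bar> \<le> e / 2 + e * (cmod z)\<^sup>2"
    proof (cases "cmod z \<le> R")
      case True
      then show ?thesis using near[OF True] \<open>e > 0\<close> by (simp add: add_increasing2)
    next
      case False
      have "\<bar>f z - f (of_real L * S z)\<bar> \<le> 2 * B" using B[of z] B[of "of_real L * S z"] by linarith
      also note R(2)
      also have "e * R\<^sup>2 \<le> e * (cmod z)\<^sup>2" using False R \<open>e > 0\<close> by (intro mult_left_mono power_mono) auto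
      finally show ?thesis using \<open>e > 0\<close> by simp
    qed
    show "\<bar>f z - P (S z)\<bar> \<le> e + e * (cmod z)\<^sup>2" using 1 2 by linarith
  qed
qed

text \<open>The common second moment bound \<open>K\<close> plays the part of tightness: it turns
  the pointwise error e + e |z|^2 of \<open>trig_poly_approx\<close> into an error e + e K of the
  expectations. Trigonometric polynomials converge by linearity, and three errors of size \<epsilon>
  / 3 remain.\<close>

lemma tendsto_integral_of_char:
  fixes M :: "nat \<Rightarrow> 'a measure" and X :: "nat \<Rightarrow> 'a \<Rightarrow> complex" and \<mu> :: "complex measure"
  assumes M: "\<And>n. prob_space (M n)" and X[measurable]: "\<And>n. X n \<in> borel_measurable (M n)"
    and \<mu>: "prob_space \<mu>" "sets \<mu> = sets borel"
    and tight: "\<And>n. integrable (M n) (\<lambda>\<omega>. (cmod (X n \<omega>))\<^sup>2)"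
      "\<forall>\<^sub>F n in sequentially. (\<integral>\<omega>. (cmod (X n \<omega>))\<^sup>2 \<partial>M n) \<le> K"
    and tight': "integrable \<mu> (\<lambda>z. (cmod z)\<^sup>2)" "(\<integral>z. (cmod z)\<^sup>2 \<partial>\<mu>) \<le> K"
    and char: "\<And>s t. (\<lambda>n. \<integral>\<omega>. iexp (s * Re (X n \<omega>) + t * Im (X n \<omega>)) \<partial>M n)
      \<longlonglongrightarrow> (\<integral>z. iexp (s * Re z + t * Im z) \<partial>\<mu>)"
    and f: "continuous_on UNIV f" "bounded (range f)"
  shows "(\<lambda>n. \<integral>\<omega>. (f (X n \<omega>) :: real) \<partial>M n) \<longlonglongrightarrow> (\<integral>z. f z \<partial>\<mu>)"
proof -
  interpret M: prob_space "M n" for n by (rule M)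
  interpret \<mu>: prob_space \<mu> by (rule \<mu>)
  have [measurable_cong]: "sets \<mu> = sets borel" by (rule \<mu>)
  have K0: "K \<ge> 0" by (rule order_trans[OF _ tight'(2)]) simp
  have trig_int: "integrable (M n) (\<lambda>\<omega>. g (X n \<omega>))" "integrable \<mu> g" if g: "trig_poly g" for g n
  proof -
    have [measurable]: "g \<in> borel_measurable borel"
      by (intro borel_measurable_continuous_onI trig_poly_continuous g)
    obtain B where "\<And>z. cmod (g z) \<le> B" using trig_poly_bounded[OF g] by metis
    then show "integrable (M n) (\<lambda>\<omega>. g (X n \<omega>))" "integrable \<mu> g"
      by (auto intro!: M.integrable_const_bound[of _ B] \<mu>.integrable_const_bound[of _ B])
  qed
  have trig: "(\<lambda>n. \<integral>\<omega>. g (X n \<omega>) \<partial>M n) \<longlonglongrightarrow> (\<integral>z. g z \<partial>\<mu>)" if "trig_poly g" for g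
    using that
  proof (induction rule: trig_poly.induct)
    case (scale g c)
    then show ?case by (auto simp: intro!: tendsto_mult_left)
  next
    case (add g h)
    then show ?case using trig_int by (auto intro!: tendsto_add)
  qed (rule char)
  obtain B where B: "\<And>z. \<bar>f z\<bar> \<le> B" using f(2) by (auto simp: bounded_iff)
  have [measurable]: "f \<in> borel_measurable borel" using f(1) by (rule borel_measurable_continuous_onI)
  have f_int: "integrable (M n) (\<lambda>\<omega>. f (X n \<omega>))" "integrable \<mu> f" for n
    using B by (auto intro!: M.integrable_const_bound[of _ B] \<mu>.integrable_const_bound[of _ B])
  show ?thesis
  proof (rule tendstoI)
    fix \<epsilon> :: real assume "\<epsilon> > 0"
    define e where "e = \<epsilon> / 3 / (1 + K)"
    have e: "e > 0" "e + e * K = \<epsilon> / 3" 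
    proof -
      show "e > 0" using \<open>\<epsilon> > 0\<close> K0 by (simp add: e_def)
      have "e + e * K = e * (1 + K)" by (simp add: algebra_simps)
      moreover have "1 + K \<noteq> 0" using K0 by simp
      then have "e * (1 + K) = \<epsilon> / 3" 
        using nonzero_eq_divide_eq[of "1 + K" e "\<epsilon> / 3"] e_def by blast
      ultimately show "e + e * K = \<epsilon> / 3" by simp
    qed
    obtain g where g: "trig_poly (\<lambda>z. of_real (g z))" "\<And>z. \<bar>f z - g z\<bar> \<le> e + e * (cmod z)\<^sup>2"
      using trig_poly_approx[OF f(1) B e(1)] by metis
    have g_int: "integrable (M n) (\<lambda>\<omega>. g (X n \<omega>))" "integrable \<mu> g" for n
      using integrable_Re[OF trig_int(1)[OF g(1), of n]] integrable_Re[OF trig_int(2)[OF g(1)]] by auto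
    have close_\<mu>: "\<bar>(\<integral>z. f z \<partial>\<mu>) - (\<integral>z. g z \<partial>\<mu>)\<bar> \<le> \<epsilon> / 3"
    proof -
      have "\<bar>(\<integral>z. f z \<partial>\<mu>) - (\<integral>z. g z \<partial>\<mu>)\<bar> = norm (\<integral>z. f z - g z \<partial>\<mu>)"
        using f_int g_int by simp
      also have "\<dots> \<le> (\<integral>z. e + e * (cmod z)\<^sup>2 \<partial>\<mu>)"
        using g(2) f_int g_int tight' by (intro norm_integral_le_integral) auto
      also have "\<dots> = e + e * (\<integral>z. (cmod z)\<^sup>2 \<partial>\<mu>)" using tight' by (simp add: \<mu>.prob_space)
      also have "\<dots> \<le> e + e * K" using tight' e by (intro add_left_mono mult_left_mono) auto
      finally show ?thesis using e by simp
    qed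
    have close_X: "\<bar>(\<integral>\<omega>. f (X n \<omega>) \<partial>M n) - (\<integral>\<omega>. g (X n \<omega>) \<partial>M n)\<bar> \<le> \<epsilon> / 3" 
      if "(\<integral>\<omega>. (cmod (X n \<omega>))\<^sup>2 \<partial>M n) \<le> K" for n
    proof -
      have "\<bar>(\<integral>\<omega>. f (X n \<omega>) \<partial>M n) - (\<integral>\<omega>. g (X n \<omega>) \<partial>M n)\<bar> = norm (\<integral>\<omega>. f (X n \<omega>) - g (X n \<omega>) \<partial>M n)"
        using f_int g_int by simp
      also have "\<dots> \<le> (\<integral>\<omega>. e + e * (cmod (X n \<omega>))\<^sup>2 \<partial>M n)"
        using g(2) f_int g_int tight by (intro norm_integral_le_integral) auto
      also have "\<dots> = e + e * (\<integral>\<omega>. (cmod (X n \<omega>))\<^sup>2 \<partial>M n)" using tight by (simp add: M.prob_space)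
      also have "\<dots> \<le> e + e * K" using that e by (intro add_left_mono mult_left_mono) auto
      finally show ?thesis using e by simp
    qed
    have "(\<lambda>n. \<integral>\<omega>. g (X n \<omega>) \<partial>M n) \<longlonglongrightarrow> (\<integral>z. g z \<partial>\<mu>)"
      using tendsto_Re[OF trig[OF g(1)]] by simp
    then have "\<forall>\<^sub>F n in sequentially. dist (\<integral>\<omega>. g (X n \<omega>) \<partial>M n) (\<integral>z. g z \<partial>\<mu>) < \<epsilon> / 3"
      using \<open>\<epsilon> > 0\<close> by (intro tendstoD) auto
    with tight(2) show "\<forall>\<^sub>F n in sequentially. dist (\<integral>\<omega>. f (X n \<omega>) \<partial>M n) (\<integral>z. f z \<partial>\<mu>) < \<epsilon>"
    proof eventually_elim
      case (elim n)
      then show ?case using close_X[of n] close_\<mu> unfolding dist_real_def by linarith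
    qed
  qed
qed

section \<open>Gaussian moments\<close>

text \<open>Completing the square, the shift of the integration variable by Re c absorbs the real
  part of c. What is left is the characteristic function at Im c, so no contour integral
  occurs.\<close>

lemma (in prob_space) std_normal_exp_moment:
  fixes X :: "'a \<Rightarrow> real" and c :: complex
  assumes X: "distributed M lborel X std_normal_density"
  shows "integrable M (\<lambda>\<omega>. exp (c * of_real (X \<omega>)))"
    and "expectation (\<lambda>\<omega>. exp (c * of_real (X \<omega>))) = exp (c\<^sup>2 / 2)"
proof -
  define u where "u = Re c"
  define v where "v = Im c"
  have c: "c = of_real u + \<i> * of_real v" by (simp add: u_def v_def complex_eq_iff)
  have [measurable]: "X \<in> borel_measurable M" using X by (auto dest: distributed_measurable)
  have d: "distr M lborel X = std_normal_distribution" using distributed_distr_eq_density[OF X] .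
  interpret N: real_distribution std_normal_distribution by (rule real_dist_normal_dist)
  \<comment> \<open>The form \<open>u + 1 * x\<close> is that of the affine substitution used for
    \<open>i2\<close> and for the integral below.\<close>
  have key: "std_normal_density (u + 1 * x) *\<^sub>R exp (c * of_real (u + 1 * x)) =
      exp (of_real (u\<^sup>2 / 2) + \<i> * of_real (u * v)) * (std_normal_density x *\<^sub>R iexp (v * x))" for x
  proof -
    have "std_normal_density (u + x) * exp (u * (u + x)) = exp (u\<^sup>2 / 2) * std_normal_density x"
      by (simp add: std_normal_density_def flip: exp_add) (simp add: power2_eq_square field_simps)
    then have "complex_of_real (std_normal_density (u + x)) * exp (of_real (u * (u + x))) =
      exp (of_real (u\<^sup>2 / 2)) * of_real (std_normal_density x)"
      by (simp only: exp_of_real flip: of_real_mult)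
    moreover have "exp (c * of_real (u + x)) =
        exp (of_real (u * (u + x))) * (exp (\<i> * of_real (u * v)) * iexp (v * x))"
      by (simp add: c algebra_simps flip: exp_add)
    ultimately show ?thesis by (simp add: scaleR_conv_of_real exp_add)
  qed
  have i1: "integrable lborel (\<lambda>x. std_normal_density x *\<^sub>R iexp (v * x))"
  proof -
    have "integrable std_normal_distribution (\<lambda>x. iexp (v * x))"
      by (rule N.integrable_const_bound[of _ 1]) auto
    then show ?thesis by (subst (asm) integrable_density) auto
  qed
  have i2: "integrable lborel (\<lambda>x. std_normal_density x *\<^sub>R exp (c * of_real x))"
    by (subst lborel_integrable_real_affine_iff[of 1 _ u, symmetric])
       (auto simp only: key intro!: integrable_mult_right i1)
  have "(\<integral>x. std_normal_density x *\<^sub>R exp (c * of_real x) \<partial>lborel) =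
      (\<integral>x. std_normal_density (u + 1 * x) *\<^sub>R exp (c * of_real (u + 1 * x)) \<partial>lborel)"
    by (subst lborel_integral_real_affine[of 1 _ u]) auto
  also have "\<dots> = exp (of_real (u\<^sup>2 / 2) + \<i> * of_real (u * v)) *
      (\<integral>x. std_normal_density x *\<^sub>R iexp (v * x) \<partial>lborel)"
    unfolding key by (rule integral_mult_right_zero)
  also have "(\<integral>x. std_normal_density x *\<^sub>R iexp (v * x) \<partial>lborel) = char std_normal_distribution v"
    unfolding char_def by (subst integral_density) auto
  also have "exp (of_real (u\<^sup>2 / 2) + \<i> * of_real (u * v)) * char std_normal_distribution v = exp (c\<^sup>2 / 2)"
    by (simp add: char_std_normal_distribution c exp_of_real[symmetric] exp_add[symmetric] del: exp_of_real)
       (intro arg_cong[where f = exp], simp add: power2_eq_square field_simps)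
  finally have eq: "(\<integral>x. std_normal_density x *\<^sub>R exp (c * of_real x) \<partial>lborel) = exp (c\<^sup>2 / 2)" .
  have "integrable (distr M lborel X) (\<lambda>x. exp (c * of_real x))"
    unfolding d using i2 by (subst integrable_density) auto
  then show "integrable M (\<lambda>\<omega>. exp (c * of_real (X \<omega>)))" by (subst (asm) integrable_distr_eq) auto
  have "expectation (\<lambda>\<omega>. exp (c * of_real (X \<omega>))) = (\<integral>x. exp (c * of_real x) \<partial>distr M lborel X)"
    by (subst integral_distr) auto
  also have "\<dots> = exp (c\<^sup>2 / 2)"
    unfolding d using eq by (subst integral_density) auto
  finally show "expectation (\<lambda>\<omega>. exp (c * of_real (X \<omega>))) = exp (c\<^sup>2 / 2)" .
qed

text \<open>|e^{cX}|^p is e^{p Re(c) X}, so this is the exponential moment at the real point p Re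
  c.\<close>

lemma (in prob_space) std_normal_norm_exp_powr_moment:
  fixes X :: "'a \<Rightarrow> real" and c :: complex
  assumes X: "distributed M lborel X std_normal_density"
  shows "integrable M (\<lambda>\<omega>. cmod (exp (c * of_real (X \<omega>))) powr p)"
    and "expectation (\<lambda>\<omega>. cmod (exp (c * of_real (X \<omega>))) powr p) = exp (p\<^sup>2 * (Re c)\<^sup>2 / 2)"
proof -
  have eq: "cmod (exp (c * of_real x)) powr p = Re (exp (of_real (p * Re c) * of_real x))" for x
    by (simp add: norm_exp_eq_Re powr_def Re_exp mult_ac)
  note m = std_normal_exp_moment[OF X, of "of_real (p * Re c)"]
  show "integrable M (\<lambda>\<omega>. cmod (exp (c * of_real (X \<omega>))) powr p)"
    unfolding eq using m(1) by (rule integrable_Re)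
  have "expectation (\<lambda>\<omega>. cmod (exp (c * of_real (X \<omega>))) powr p) = Re (exp ((of_real (p * Re c))\<^sup>2 / 2))"
    unfolding eq integral_Re[OF m(1)] m(2) ..
  also have "(of_real (p * Re c))\<^sup>2 / 2 = complex_of_real (p\<^sup>2 * (Re c)\<^sup>2 / 2)"
    by (simp add: power_mult_distrib)
  finally show "expectation (\<lambda>\<omega>. cmod (exp (c * of_real (X \<omega>))) powr p) = exp (p\<^sup>2 * (Re c)\<^sup>2 / 2)"
    by (simp only: exp_of_real Re_complex_of_real)
qed

lemma real_gaussian_moments:
  assumes "v > 0"
  shows "real_distribution (real_gaussian v)"
    and "char (real_gaussian v) t = exp (- v * t\<^sup>2 / 2)"
    and "integrable (real_gaussian v) (\<lambda>x. x\<^sup>2)"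
    and "(\<integral>x. x\<^sup>2 \<partial>real_gaussian v) = v"
proof -
  interpret N: real_distribution std_normal_distribution by (rule real_dist_normal_dist)
  have "distributed std_normal_distribution lborel (\<lambda>x. x) std_normal_density"
    by (simp add: distributed_def distr_id2)
  from N.normal_density_affine[OF this, of "sqrt v" 0] assms
  have "distributed std_normal_distribution lborel (\<lambda>x. sqrt v * x) (normal_density 0 (sqrt v))" by simp
  then have "distr std_normal_distribution lborel (\<lambda>x. sqrt v * x) = real_gaussian v"
    unfolding real_gaussian_def by (rule distributed_distr_eq_density)
  then have eq: "real_gaussian v = distr std_normal_distribution borel (\<lambda>x. sqrt v * x)"
    by (metis distr_cong sets_lborel)
  show "real_distribution (real_gaussian v)" unfolding eq by (rule N.real_distribution_distr) simp
  have "char (real_gaussian v) t = char std_normal_distribution (sqrt v * t)"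
    unfolding eq char_def by (subst integral_distr) (auto simp: mult_ac)
  also have "\<dots> = exp (- v * t\<^sup>2 / 2)"
    using assms by (simp add: char_std_normal_distribution power_mult_distrib)
  finally show "char (real_gaussian v) t = exp (- v * t\<^sup>2 / 2)" .
  have m: "integrable std_normal_distribution (\<lambda>x. x\<^sup>2)" "(\<integral>x. x\<^sup>2 \<partial>std_normal_distribution) = 1"
    using integrable_std_normal_distribution_moment[of 2] std_normal_distribution_even_moments(1)[of 1] by auto
  show "integrable (real_gaussian v) (\<lambda>x. x\<^sup>2)"
    unfolding eq using m assms by (subst integrable_distr_eq) (auto simp: power_mult_distrib)
  show "(\<integral>x. x\<^sup>2 \<partial>real_gaussian v) = v"
    unfolding eq using m assms by (subst integral_distr) (auto simp: power_mult_distrib)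
qed

lemma N_R_moments:
  assumes "v > 0"
  shows "prob_space (N_R v)" "sets (N_R v) = sets borel"
    and "(\<integral>z. iexp (s * Re z + t * Im z) \<partial>N_R v) = exp (- v * s\<^sup>2 / 2)"
    and "integrable (N_R v) (\<lambda>z. (cmod z)\<^sup>2)"
    and "(\<integral>z. (cmod z)\<^sup>2 \<partial>N_R v) = v"
proof -
  interpret G: real_distribution "real_gaussian v" by (rule real_gaussian_moments(1)[OF assms])
  show "prob_space (N_R v)" unfolding N_R_def by (rule G.prob_space_distr) simp
  show "sets (N_R v) = sets borel" by (simp add: N_R_def)
  show "(\<integral>z. iexp (s * Re z + t * Im z) \<partial>N_R v) = exp (- v * s\<^sup>2 / 2)"
    unfolding N_R_def real_gaussian_moments(2)[OF assms, symmetric] char_def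
    by (subst integral_distr) auto
  show "integrable (N_R v) (\<lambda>z. (cmod z)\<^sup>2)" "(\<integral>z. (cmod z)\<^sup>2 \<partial>N_R v) = v"
    unfolding N_R_def using real_gaussian_moments[OF assms] 
    by (auto simp: integrable_distr_eq integral_distr)
qed

lemma N_C_moments:
  assumes "v > 0"
  shows "prob_space (N_C v)" "sets (N_C v) = sets borel"
    and "(\<integral>z. iexp (s * Re z + t * Im z) \<partial>N_C v) = exp (- v * (s\<^sup>2 + t\<^sup>2) / 4)"
    and "integrable (N_C v) (\<lambda>z. (cmod z)\<^sup>2)"
    and "(\<integral>z. (cmod z)\<^sup>2 \<partial>N_C v) = v"
proof -
  let ?G = "real_gaussian (v / 2)"
  have v2: "v / 2 > 0" using assms by simp
  note gm = real_gaussian_moments[OF v2]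
  interpret G: real_distribution ?G by (rule gm(1))
  interpret GG: pair_prob_space ?G ?G ..
  have [measurable_cong]: "sets ?G = sets borel" by (simp add: real_gaussian_def)
  have meas[measurable]: "(\<lambda>(x, y). Complex x y) \<in> borel_measurable (?G \<Otimes>\<^sub>M ?G)"
    unfolding Complex_eq by measurable
  show "prob_space (N_C v)" unfolding N_C_def by (rule GG.prob_space_distr) simp
  show "sets (N_C v) = sets borel" by (simp add: N_C_def)
  have int: "integrable (?G \<Otimes>\<^sub>M ?G) (\<lambda>(x, y). iexp (s * x) * iexp (t * y))"
    by (rule GG.integrable_const_bound[of _ 1]) (auto simp: norm_mult)
  have "(\<integral>z. iexp (s * Re z + t * Im z) \<partial>N_C v) = (\<integral>(x, y). iexp (s * x) * iexp (t * y) \<partial>(?G \<Otimes>\<^sub>M ?G))"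
    unfolding N_C_def by (subst integral_distr) (auto simp: case_prod_beta' exp_add distrib_left)
  also have "\<dots> = (\<integral>x. \<integral>y. iexp (s * x) * iexp (t * y) \<partial>?G \<partial>?G)"
    using GG.integral_fst'[OF int] by simp
  also have "\<dots> = char ?G s * char ?G t" by (simp add: char_def)
  also have "\<dots> = exp (- v * (s\<^sup>2 + t\<^sup>2) / 4)"
    unfolding gm(2) by (simp add: exp_add[symmetric] field_simps flip: of_real_mult)
  finally show "(\<integral>z. iexp (s * Re z + t * Im z) \<partial>N_C v) = exp (- v * (s\<^sup>2 + t\<^sup>2) / 4)" .
  have 1: "integrable (?G \<Otimes>\<^sub>M ?G) (\<lambda>p. (fst p)\<^sup>2)" "(\<integral>p. (fst p)\<^sup>2 \<partial>(?G \<Otimes>\<^sub>M ?G)) = v / 2"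
     "integrable (?G \<Otimes>\<^sub>M ?G) (\<lambda>p. (snd p)\<^sup>2)" "(\<integral>p. (snd p)\<^sup>2 \<partial>(?G \<Otimes>\<^sub>M ?G)) = v / 2"
  proof -
    have fst: "distr (?G \<Otimes>\<^sub>M ?G) ?G fst = ?G" by (rule G.distr_pair_fst)
    have snd: "distr (?G \<Otimes>\<^sub>M ?G) ?G snd = ?G"
    proof -
      have "distr (?G \<Otimes>\<^sub>M ?G) ?G snd = distr (distr (?G \<Otimes>\<^sub>M ?G) (?G \<Otimes>\<^sub>M ?G) (\<lambda>(x, y). (y, x))) ?G snd"
        by (metis GG.distr_pair_swap)
      also have "\<dots> = distr (?G \<Otimes>\<^sub>M ?G) ?G fst"
        by (subst distr_distr) (auto simp: comp_def case_prod_beta)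
      finally show ?thesis using fst by simp
    qed
    have "integrable (distr (?G \<Otimes>\<^sub>M ?G) ?G fst) (\<lambda>x. x\<^sup>2)" "(\<integral>x. x\<^sup>2 \<partial>distr (?G \<Otimes>\<^sub>M ?G) ?G fst) = v / 2"
      unfolding fst using gm by auto
    then show "integrable (?G \<Otimes>\<^sub>M ?G) (\<lambda>p. (fst p)\<^sup>2)" "(\<integral>p. (fst p)\<^sup>2 \<partial>(?G \<Otimes>\<^sub>M ?G)) = v / 2"
      by (auto simp: integrable_distr_eq integral_distr)
    have "integrable (distr (?G \<Otimes>\<^sub>M ?G) ?G snd) (\<lambda>x. x\<^sup>2)" "(\<integral>x. x\<^sup>2 \<partial>distr (?G \<Otimes>\<^sub>M ?G) ?G snd) = v / 2"
      unfolding snd using gm by auto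
    then show "integrable (?G \<Otimes>\<^sub>M ?G) (\<lambda>p. (snd p)\<^sup>2)" "(\<integral>p. (snd p)\<^sup>2 \<partial>(?G \<Otimes>\<^sub>M ?G)) = v / 2"
      by (auto simp: integrable_distr_eq integral_distr)
  qed
  have eq: "(cmod (case p of (x, y) \<Rightarrow> Complex x y))\<^sup>2 = (fst p)\<^sup>2 + (snd p)\<^sup>2" for p
    by (cases p) (simp add: cmod_power2)
  show "integrable (N_C v) (\<lambda>z. (cmod z)\<^sup>2)" "(\<integral>z. (cmod z)\<^sup>2 \<partial>N_C v) = v"
    unfolding N_C_def using 1 by (simp_all add: integrable_distr_eq integral_distr eq)
qed

section \<open>Exponential sums over a Gaussian tree\<close>

lemma (in prob_space) square_moment_centered:
  fixes Z :: "'a \<Rightarrow> complex"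
  assumes [measurable]: "Z \<in> borel_measurable M" and int: "integrable M (\<lambda>\<omega>. (cmod (Z \<omega>))\<^sup>2)"
  shows "integrable M (\<lambda>\<omega>. (cmod (Z \<omega> - expectation Z))\<^sup>2)"
    and "expectation (\<lambda>\<omega>. (cmod (Z \<omega> - expectation Z))\<^sup>2) =
      expectation (\<lambda>\<omega>. (cmod (Z \<omega>))\<^sup>2) - (cmod (expectation Z))\<^sup>2"
proof -
  define m where "m = expectation Z"
  have iZ: "integrable M Z" using integrable_of_square[OF _ int] by simp
  have i2: "integrable M (\<lambda>\<omega>. Re (Z \<omega> * cnj m))"
    using iZ by (intro integrable_Re integrable_mult_left) auto
  have e2: "expectation (\<lambda>\<omega>. Re (Z \<omega> * cnj m)) = (cmod m)\<^sup>2"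
  proof -
    have "expectation (\<lambda>\<omega>. Re (Z \<omega> * cnj m)) = Re (expectation (\<lambda>\<omega>. Z \<omega> * cnj m))"
      using iZ by (intro integral_Re integrable_mult_left) auto
    also have "\<dots> = (cmod m)\<^sup>2" by (simp add: m_def flip: complex_norm_square of_real_power)
    finally show ?thesis .
  qed
  have eq: "(cmod (z - m))\<^sup>2 = (cmod z)\<^sup>2 - 2 * Re (z * cnj m) + (cmod m)\<^sup>2" for z
    by (simp only: cmod_power2) (simp add: power2_eq_square algebra_simps)
  have "integrable M (\<lambda>\<omega>. (cmod (Z \<omega> - m))\<^sup>2)"
    unfolding eq using int i2
    by (intro Bochner_Integration.integrable_add Bochner_Integration.integrable_diff integrable_mult_right) auto
  then show "integrable M (\<lambda>\<omega>. (cmod (Z \<omega> - expectation Z))\<^sup>2)" by (simp add: m_def)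
  have "expectation (\<lambda>\<omega>. (cmod (Z \<omega> - m))\<^sup>2) = 
     expectation (\<lambda>\<omega>. (cmod (Z \<omega>))\<^sup>2) - 2 * expectation (\<lambda>\<omega>. Re (Z \<omega> * cnj m)) + (cmod m)\<^sup>2"
    unfolding eq using int i2 by (simp add: prob_space del: times_complex.sel)
  then show "expectation (\<lambda>\<omega>. (cmod (Z \<omega> - expectation Z))\<^sup>2) =
      expectation (\<lambda>\<omega>. (cmod (Z \<omega>))\<^sup>2) - (cmod (expectation Z))\<^sup>2"
    using e2 by (simp add: m_def)
qed

text \<open>
  The argument \<open>r\<close> is the number of levels below the node \<open>e\<close>. With
  $c_j = \beta\sqrt{n a_j}$ the sum at the root of a tree with $d$ levels is $\mathcal{Z}_n(\beta)$.
  By symmetry its first two moments depend on \<open>e\<close> only through its length \<open>k\<close>; they are given by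
  \<open>tree_mean\<close> and \<open>tree_sqmean\<close>.
\<close>

primrec tree_sum :: "(nat \<Rightarrow> nat) \<Rightarrow> (nat \<Rightarrow> complex) \<Rightarrow> nat \<Rightarrow> nat list \<Rightarrow> (nat list \<Rightarrow> real) \<Rightarrow> complex" where
  "tree_sum N c 0 e x = 1"
| "tree_sum N c (Suc r) e x = (\<Sum>i=1..N (Suc (length e)).
     exp (c (Suc (length e)) * of_real (x (e @ [i]))) * tree_sum N c r (e @ [i]) x)"

primrec tree_mean :: "(nat \<Rightarrow> nat) \<Rightarrow> (nat \<Rightarrow> complex) \<Rightarrow> nat \<Rightarrow> nat \<Rightarrow> complex" where
  "tree_mean N c 0 k = 1"
| "tree_mean N c (Suc r) k = of_nat (N (Suc k)) * (exp ((c (Suc k))\<^sup>2 / 2) * tree_mean N c r (Suc k))"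

text \<open>The variance of the sum at a node of level \<open>k\<close>, in the form N (E|W|^2 - |E
  W|^2). The second moment \<open>v\<close> of a child's subtree sum is an argument because
  \<open>tree_sqmean\<close> is defined by recursion through this function.\<close>

definition tree_var_step :: "(nat \<Rightarrow> nat) \<Rightarrow> (nat \<Rightarrow> complex) \<Rightarrow> nat \<Rightarrow> nat \<Rightarrow> real \<Rightarrow> real" where
  "tree_var_step N c r k v = real (N (Suc k)) *
     (exp (2 * (Re (c (Suc k)))\<^sup>2) * v - (cmod (exp ((c (Suc k))\<^sup>2 / 2) * tree_mean N c r (Suc k)))\<^sup>2)"

primrec tree_sqmean :: "(nat \<Rightarrow> nat) \<Rightarrow> (nat \<Rightarrow> complex) \<Rightarrow> nat \<Rightarrow> nat \<Rightarrow> real" where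
  "tree_sqmean N c 0 k = 1"
| "tree_sqmean N c (Suc r) k = (cmod (tree_mean N c (Suc r) k))\<^sup>2
     + tree_var_step N c r k (tree_sqmean N c r (Suc k))"

lemma tree_sum_0_fun: "tree_sum N c 0 e = (\<lambda>x. 1)"
  and tree_sum_Suc_fun: "tree_sum N c (Suc r) e = (\<lambda>x. \<Sum>i=1..N (Suc (length e)).
     exp (c (Suc (length e)) * of_real (x (e @ [i]))) * tree_sum N c r (e @ [i]) x)"
  by (simp_all add: fun_eq_iff)

section \<open>Multi-indices and the expansion of a tree sum over its leaves\<close>

lemma length_multi_indices: "e \<in> multi_indices N k \<Longrightarrow> length e = k"
  by (simp add: multi_indices_def)

lemma append_in_multi_indices:
  assumes "e \<in> multi_indices N k" "i \<in> {1..N (Suc k)}"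
  shows "e @ [i] \<in> multi_indices N (Suc k)"
  using assms by (auto simp: multi_indices_def nth_append not_less le_Suc_eq Suc_le_eq)

text \<open>The descendants of \<open>e\<close> exactly \<open>r\<close> levels further down. Only
  the entries after the prefix are bounded, so at \<open>e = []\<close> this is
  \<open>multi_indices N r\<close>.\<close>

definition extensions :: "(nat \<Rightarrow> nat) \<Rightarrow> nat list \<Rightarrow> nat \<Rightarrow> nat list set" where
  "extensions N e r = {f. length f = length e + r \<and> take (length e) f = e \<and>
     (\<forall>i\<in>{length e + 1..length e + r}. 1 \<le> f ! (i - 1) \<and> f ! (i - 1) \<le> N i)}"

lemma extensions_0: "extensions N e 0 = {e}"
  by (auto simp: extensions_def)

lemma extensions_Suc: "extensions N e (Suc r) = (\<Union>i\<in>{1..N (Suc (length e))}. extensions N (e @ [i]) r)"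
proof (intro equalityI subsetI)
  fix f assume f: "f \<in> extensions N e (Suc r)"
  then have 1: "take (Suc (length e)) f = e @ [f ! length e]"
    by (simp add: extensions_def take_Suc_conv_app_nth)
  have "\<forall>i\<in>{length e + 1..length e + Suc r}. 1 \<le> f ! (i - 1) \<and> f ! (i - 1) \<le> N i"
    using f by (simp add: extensions_def)
  from bspec[OF this, of "Suc (length e)"] have "f ! length e \<in> {1..N (Suc (length e))}"
    by simp
  moreover have "f \<in> extensions N (e @ [f ! length e]) r"
    using f 1 by (simp add: extensions_def)
  ultimately show "f \<in> (\<Union>i\<in>{1..N (Suc (length e))}. extensions N (e @ [i]) r)"
    by blast
next
  fix f assume "f \<in> (\<Union>i\<in>{1..N (Suc (length e))}. extensions N (e @ [i]) r)"
  then obtain i where i: "i \<in> {1..N (Suc (length e))}" "f \<in> extensions N (e @ [i]) r" by blast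
  then have t: "take (Suc (length e)) f = e @ [i]" by (simp add: extensions_def)
  have "take (length e) f = take (length e) (take (Suc (length e)) f)" by (simp add: min_def)
  also have "\<dots> = e" unfolding t by simp
  finally have t': "take (length e) f = e" .
  have "f ! length e = take (Suc (length e)) f ! length e" by simp
  also have "\<dots> = i" unfolding t by simp
  finally have fi: "f ! length e = i" .
  have "1 \<le> f ! (j - 1) \<and> f ! (j - 1) \<le> N j" if j: "j \<in> {length e + 1..length e + Suc r}" for j
  proof (cases "j = Suc (length e)")
    case True
    then show ?thesis using i fi by simp
  next
    case False
    then show ?thesis using i(2) j by (simp add: extensions_def)
  qed
  then show "f \<in> extensions N e (Suc r)" using i(2) t' by (simp add: extensions_def)
qed

lemma finite_extensions: "finite (extensions N e r)"
  by (induction r arbitrary: e) (simp_all add: extensions_0 extensions_Suc)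

text \<open>Along a path the factors multiply to the exponential of a sum, and the first edge of a
  path partitions the descendants of \<open>e\<close>. At the root this identifies the recursion
  with the partition function.\<close>

lemma tree_sum_eq:
  "tree_sum N c r e x = (\<Sum>f\<in>extensions N e r. exp (\<Sum>j\<in>{length e + 1..length e + r}. c j * of_real (x (take j f))))"
proof (induction r arbitrary: e)
  case 0
  then show ?case by (simp add: extensions_0)
next
  case (Suc r)
  let ?l = "length e"
  have "(\<Sum>f\<in>extensions N e (Suc r). exp (\<Sum>j\<in>{?l + 1..?l + Suc r}. c j * of_real (x (take j f)))) =
    (\<Sum>i=1..N (Suc ?l). \<Sum>f\<in>extensions N (e @ [i]) r. exp (\<Sum>j\<in>{?l + 1..?l + Suc r}. c j * of_real (x (take j f))))"
    unfolding extensions_Suc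
  proof (rule sum.UNION_disjoint)
    show "\<forall>i\<in>{1..N (Suc (length e))}. \<forall>j\<in>{1..N (Suc (length e))}. i \<noteq> j \<longrightarrow> 
        extensions N (e @ [i]) r \<inter> extensions N (e @ [j]) r = {}"
      by (auto simp: extensions_def)
  qed (auto intro: finite_extensions)
  also have "\<dots> = (\<Sum>i=1..N (Suc ?l). exp (c (Suc ?l) * of_real (x (e @ [i]))) * tree_sum N c r (e @ [i]) x)"
  proof (rule sum.cong[OF refl])
    fix i
    have "(\<Sum>j\<in>{?l + 1..?l + Suc r}. c j * of_real (x (take j f))) = 
      c (Suc ?l) * of_real (x (e @ [i])) + (\<Sum>j\<in>{length (e @ [i]) + 1..length (e @ [i]) + r}. c j * of_real (x (take j f)))"
      if "f \<in> extensions N (e @ [i]) r" for f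
    proof -
      have "{?l + 1..?l + Suc r} = insert (Suc ?l) {length (e @ [i]) + 1..length (e @ [i]) + r}" by auto
      moreover have "take (Suc ?l) f = e @ [i]" using that by (simp add: extensions_def)
      ultimately show ?thesis by simp
    qed
    then show "(\<Sum>f\<in>extensions N (e @ [i]) r. exp (\<Sum>j\<in>{?l + 1..?l + Suc r}. c j * of_real (x (take j f)))) =
       exp (c (Suc ?l) * of_real (x (e @ [i]))) * tree_sum N c r (e @ [i]) x"
      unfolding Suc.IH sum_distrib_left by (intro sum.cong refl) (simp only: exp_add)
  qed
  finally show ?case by simp
qed

lemma grem_Z_eq_tree_sum:
  "grem_Z d a N \<xi> n \<beta> \<omega> = tree_sum N (\<lambda>j. \<beta> * of_real (sqrt (real n) * sqrt (a j))) d [] (\<lambda>f. \<xi> f \<omega>)"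
proof -
  have "extensions N [] d = multi_indices N d"
    by (auto simp: extensions_def multi_indices_def)
  then show ?thesis
    unfolding tree_sum_eq grem_Z_def grem_X_def
    by (auto intro!: sum.cong arg_cong[of _ _ exp] simp: sum_distrib_left mult_ac)
qed

section \<open>Independence inside one Gaussian tree\<close>

locale gaussian_tree = prob_space M for M :: "'w measure" +
  fixes d :: nat and N :: "nat \<Rightarrow> nat" and c :: "nat \<Rightarrow> complex" and \<xi> :: "nat list \<Rightarrow> 'w \<Rightarrow> real"
  assumes xi_indep: "indep_vars (\<lambda>_. borel) \<xi> (\<Union>j\<in>{1..d}. multi_indices N j)"
    and xi_normal: "\<And>j e. j \<in> {1..d} \<Longrightarrow> e \<in> multi_indices N j \<Longrightarrow>
      distributed M lborel (\<xi> e) std_normal_density"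
begin

definition nodes :: "nat list set" where
  "nodes = (\<Union>j\<in>{1..d}. multi_indices N j)"

text \<open>Strict descendants at every depth: they carry the variables that the subtree sum at
  \<open>e\<close> depends on, and the variable of \<open>e\<close> itself is not among
  them.\<close>

definition below :: "nat list \<Rightarrow> nat list set" where
  "below e = {f \<in> nodes. \<exists>s. s \<noteq> [] \<and> f = e @ s}"

lemma child_in_nodes:
  assumes "e \<in> multi_indices N k" "Suc k \<le> d" "i \<in> {1..N (Suc k)}"
  shows "e @ [i] \<in> nodes" "e @ [i] \<in> below e"
  using append_in_multi_indices[OF assms(1,3)] assms(2) by (auto simp: nodes_def below_def)

text \<open>Allows the whole array to be replaced by its restriction to a block of nodes, the form
  in which independence of blocks is available.\<close>

lemma tree_sum_cong:
  assumes "e \<in> multi_indices N k" "k + r \<le> d" "\<And>f. f \<in> below e \<Longrightarrow> x f = y f"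
  shows "tree_sum N c r e x = tree_sum N c r e y"
  using assms
proof (induction r arbitrary: e k)
  case (Suc r)
  have "x (e @ [i]) = y (e @ [i]) \<and> tree_sum N c r (e @ [i]) x = tree_sum N c r (e @ [i]) y"
    if i: "i \<in> {1..N (Suc k)}" for i
  proof
    show "x (e @ [i]) = y (e @ [i])" using child_in_nodes[OF Suc.prems(1) _ i] Suc.prems by simp
    show "tree_sum N c r (e @ [i]) x = tree_sum N c r (e @ [i]) y"
      using Suc.prems by (intro Suc.IH[OF append_in_multi_indices[OF Suc.prems(1) i]]) (auto simp: below_def)
  qed
  then show ?case using length_multi_indices[OF Suc.prems(1)] by (auto intro!: sum.cong)
qed simp

lemma tree_sum_measurable_PiM:
  assumes "e \<in> multi_indices N k" "k + r \<le> d" "below e \<subseteq> J"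
  shows "tree_sum N c r e \<in> borel_measurable (PiM J (\<lambda>_. borel))"
  using assms
proof (induction r arbitrary: e k)
  case (Suc r)
  have [measurable]: "(\<lambda>x. x (e @ [i])) \<in> borel_measurable (PiM J (\<lambda>_. borel))" if "i \<in> {1..N (Suc k)}" for i
    using child_in_nodes[OF Suc.prems(1) _ that] Suc.prems by (intro measurable_component_singleton) auto
  have [measurable]: "tree_sum N c r (e @ [i]) \<in> borel_measurable (PiM J (\<lambda>_. borel))" if "i \<in> {1..N (Suc k)}" for i
    using Suc.prems by (intro Suc.IH[OF append_in_multi_indices[OF Suc.prems(1) that]]) (auto simp: below_def)
  show ?case using length_multi_indices[OF Suc.prems(1)] unfolding tree_sum_Suc_fun by simp
qed (simp add: tree_sum_0_fun)

definition T :: "nat \<Rightarrow> nat list \<Rightarrow> 'w \<Rightarrow> complex" where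
  "T r e \<omega> = tree_sum N c r e (\<lambda>f. \<xi> f \<omega>)"

definition W :: "nat \<Rightarrow> nat list \<Rightarrow> nat \<Rightarrow> 'w \<Rightarrow> complex" where
  "W r e i \<omega> = exp (c (Suc (length e)) * of_real (\<xi> (e @ [i]) \<omega>)) * T r (e @ [i]) \<omega>"

definition Y :: "nat \<Rightarrow> nat list \<Rightarrow> nat \<Rightarrow> 'w \<Rightarrow> complex" where
  "Y r e i \<omega> = W r e i \<omega> - expectation (W r e i)"

lemma T_Suc: "e \<in> multi_indices N k \<Longrightarrow> T (Suc r) e \<omega> = (\<Sum>i=1..N (Suc k). W r e i \<omega>)"
  by (simp add: T_def W_def length_multi_indices)

text \<open>Siblings have disjoint blocks \<open>K i\<close>, each consisting of the child and its
  strict descendants, and \<open>W r e i\<close> is a measurable function of the variables in its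
  block.\<close>

lemma indep_W:
  assumes e: "e \<in> multi_indices N k" and k: "Suc k + r \<le> d"
  shows "indep_vars (\<lambda>_. borel) (W r e) {1..N (Suc k)}"
proof -
  define K where "K = (\<lambda>i. insert (e @ [i]) (below (e @ [i])))"
  define G where "G = (\<lambda>i x. exp (c (Suc k) * of_real (x (e @ [i]))) * tree_sum N c r (e @ [i]) x)"
  have disj: "disjoint_family_on K {1..N (Suc k)}"
    by (auto simp: disjoint_family_on_def K_def below_def)
  have sub: "K i \<subseteq> nodes" if "i \<in> {1..N (Suc k)}" for i
    using child_in_nodes[OF e _ that] k by (auto simp: K_def below_def)
  have ind: "indep_vars (\<lambda>i. PiM (K i) (\<lambda>_. borel)) (\<lambda>i \<omega>. restrict (\<lambda>f. \<xi> f \<omega>) (K i)) {1..N (Suc k)}"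
    using xi_indep sub disj unfolding nodes_def by (rule indep_vars_restrict)
  have Gm: "G i \<in> borel_measurable (PiM (K i) (\<lambda>_. borel))" if i: "i \<in> {1..N (Suc k)}" for i
  proof -
    have [measurable]: "(\<lambda>x. x (e @ [i])) \<in> borel_measurable (PiM (K i) (\<lambda>_. borel))"
      by (intro measurable_component_singleton) (auto simp: K_def)
    have [measurable]: "tree_sum N c r (e @ [i]) \<in> borel_measurable (PiM (K i) (\<lambda>_. borel))"
      using k by (intro tree_sum_measurable_PiM[OF append_in_multi_indices[OF e i]]) (auto simp: K_def)
    show ?thesis unfolding G_def by measurable
  qed
  have "indep_vars (\<lambda>_. borel) (\<lambda>i \<omega>. G i (restrict (\<lambda>f. \<xi> f \<omega>) (K i))) {1..N (Suc k)}"
    using ind Gm by (rule indep_vars_compose2)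
  moreover have "G i (restrict (\<lambda>f. \<xi> f \<omega>) (K i)) = W r e i \<omega>" if i: "i \<in> {1..N (Suc k)}" for i \<omega>
  proof -
    have "tree_sum N c r (e @ [i]) (restrict (\<lambda>f. \<xi> f \<omega>) (K i)) = tree_sum N c r (e @ [i]) (\<lambda>f. \<xi> f \<omega>)"
      using k by (intro tree_sum_cong[OF append_in_multi_indices[OF e i]]) (auto simp: K_def)
    then show ?thesis
      using length_multi_indices[OF e] by (simp add: G_def W_def T_def K_def)
  qed
  ultimately show ?thesis
    by (subst indep_vars_cong[OF refl _ refl, of _ "W r e" "\<lambda>i \<omega>. G i (restrict (\<lambda>f. \<xi> f \<omega>) (K i))"]) (auto simp: fun_eq_iff)
qed

text \<open>The blocks are now the child alone and its strict descendants. The real variable is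
  embedded into the complex numbers because \<open>indep_var\<close> takes two variables with values
  in one type.\<close>

lemma indep_child:
  assumes e: "e \<in> multi_indices N k" and k: "Suc k + r \<le> d" and i: "i \<in> {1..N (Suc k)}"
  shows "indep_var borel (\<lambda>\<omega>. complex_of_real (\<xi> (e @ [i]) \<omega>)) borel (T r (e @ [i]))"
proof -
  let ?e = "e @ [i]"
  have "indep_var (PiM {?e} (\<lambda>_. borel)) (\<lambda>\<omega>. restrict (\<lambda>f. \<xi> f \<omega>) {?e})
     (PiM (below ?e) (\<lambda>_. borel)) (\<lambda>\<omega>. restrict (\<lambda>f. \<xi> f \<omega>) (below ?e))"
    using child_in_nodes[OF e _ i] k
    by (intro indep_var_restrict[OF xi_indep]) (auto simp: below_def nodes_def)
  then have "indep_var borel ((\<lambda>x. complex_of_real (x ?e)) \<circ> (\<lambda>\<omega>. restrict (\<lambda>f. \<xi> f \<omega>) {?e}))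
     borel (tree_sum N c r ?e \<circ> (\<lambda>\<omega>. restrict (\<lambda>f. \<xi> f \<omega>) (below ?e)))"
    using k by (intro indep_var_compose[where ?M1.0="PiM {?e} (\<lambda>_. borel)" and ?M2.0="PiM (below ?e) (\<lambda>_. borel)"]
        tree_sum_measurable_PiM[OF append_in_multi_indices[OF e i]]) auto
  also have "(\<lambda>x. complex_of_real (x ?e)) \<circ> (\<lambda>\<omega>. restrict (\<lambda>f. \<xi> f \<omega>) {?e}) = (\<lambda>\<omega>. of_real (\<xi> ?e \<omega>))" by auto
  also have "tree_sum N c r ?e \<circ> (\<lambda>\<omega>. restrict (\<lambda>f. \<xi> f \<omega>) (below ?e)) = T r ?e"
    unfolding T_def comp_def fun_eq_iff
    using k by (intro allI tree_sum_cong[OF append_in_multi_indices[OF e i]]) auto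
  finally show ?thesis .
qed

text \<open>By independence each moment is a Gaussian factor times the moment of the subtree. For E
  W^2 the factor e^{2 c^2} has modulus e^{2 (Re c)^2 - 2 (Im c)^2}, against e^{2 (Re c)^2} for
  E|W|^2; this gap makes the limit isotropic.\<close>

lemma
  assumes e: "e \<in> multi_indices N k" and k: "Suc k + r \<le> d" and i: "i \<in> {1..N (Suc k)}"
  shows W_measurable: "W r e i \<in> borel_measurable M"
    and W_powr_integrable: "integrable M (\<lambda>\<omega>. cmod (T r (e @ [i]) \<omega>) powr p) \<Longrightarrow>
      integrable M (\<lambda>\<omega>. cmod (W r e i \<omega>) powr p)"
    and W_powr_moment: "integrable M (\<lambda>\<omega>. cmod (T r (e @ [i]) \<omega>) powr p) \<Longrightarrow>
      expectation (\<lambda>\<omega>. cmod (W r e i \<omega>) powr p) =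
        exp (p\<^sup>2 * (Re (c (Suc k)))\<^sup>2 / 2) * expectation (\<lambda>\<omega>. cmod (T r (e @ [i]) \<omega>) powr p)"
    and W_mean: "integrable M (T r (e @ [i])) \<Longrightarrow>
      expectation (W r e i) = exp ((c (Suc k))\<^sup>2 / 2) * expectation (T r (e @ [i]))"
    and W_square_mean: "integrable M (\<lambda>\<omega>. (T r (e @ [i]) \<omega>)\<^sup>2) \<Longrightarrow>
      expectation (\<lambda>\<omega>. (W r e i \<omega>)\<^sup>2) = exp (2 * (c (Suc k))\<^sup>2) * expectation (\<lambda>\<omega>. (T r (e @ [i]) \<omega>)\<^sup>2)"
proof -
  let ?e = "e @ [i]" and ?c = "c (Suc k)"
  have nrm: "distributed M lborel (\<xi> ?e) std_normal_density"
    using append_in_multi_indices[OF e i] k by (intro xi_normal) auto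
  note iv = indep_child[OF e k i]
  have len: "length e = k" by (rule length_multi_indices[OF e])
  show "W r e i \<in> borel_measurable M" 
    using indep_W[OF e k] i by (auto simp: indep_vars_def)
  {
    assume T: "integrable M (\<lambda>\<omega>. cmod (T r ?e \<omega>) powr p)"
    have iv2: "indep_var borel (\<lambda>\<omega>. cmod (exp (?c * of_real (\<xi> ?e \<omega>))) powr p) borel (\<lambda>\<omega>. cmod (T r ?e \<omega>) powr p)"
    proof -
      have "(\<lambda>x. cmod (exp (?c * x)) powr p) \<in> borel_measurable borel" "(\<lambda>x::complex. cmod x powr p) \<in> borel_measurable borel"
        by measurable
      from indep_var_compose[OF iv this] show ?thesis by (simp only: comp_def)
    qed
    have eq: "cmod (W r e i \<omega>) powr p = cmod (exp (?c * of_real (\<xi> ?e \<omega>))) powr p * cmod (T r ?e \<omega>) powr p" for \<omega>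
      unfolding W_def len norm_mult by (simp add: powr_mult)
    note m = std_normal_norm_exp_powr_moment[OF nrm, of ?c p]
    show "integrable M (\<lambda>\<omega>. cmod (W r e i \<omega>) powr p)"
      unfolding eq using iv2 m(1) T by (rule indep_var_integrable)
    show "expectation (\<lambda>\<omega>. cmod (W r e i \<omega>) powr p) =
        exp (p\<^sup>2 * (Re ?c)\<^sup>2 / 2) * expectation (\<lambda>\<omega>. cmod (T r ?e \<omega>) powr p)"
      using iv2 m(1) T by (simp only: eq indep_var_lebesgue_integral m(2))
  }
  {
    assume T: "integrable M (T r ?e)"
    have iv2: "indep_var borel (\<lambda>\<omega>. exp (?c * of_real (\<xi> ?e \<omega>))) borel (T r ?e)"
    proof -
      have "(\<lambda>x. exp (?c * x)) \<in> borel_measurable borel" "(\<lambda>x. x :: complex) \<in> borel_measurable borel"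
        by measurable
      from indep_var_compose[OF iv this] show ?thesis by (simp only: comp_def)
    qed
    note m = std_normal_exp_moment[OF nrm, of ?c]
    show "expectation (W r e i) = exp (?c\<^sup>2 / 2) * expectation (T r ?e)"
      using indep_var_lebesgue_integral[OF iv2 m(1) T] m(2) len by (simp add: W_def[abs_def])
  }
  {
    assume T: "integrable M (\<lambda>\<omega>. (T r ?e \<omega>)\<^sup>2)"
    have iv2: "indep_var borel (\<lambda>\<omega>. exp ((2 * ?c) * of_real (\<xi> ?e \<omega>))) borel (\<lambda>\<omega>. (T r ?e \<omega>)\<^sup>2)"
    proof -
      have "(\<lambda>x. exp ((2 * ?c) * x)) \<in> borel_measurable borel" "(\<lambda>x. x\<^sup>2 :: complex) \<in> borel_measurable borel"
        by measurable
      from indep_var_compose[OF iv this] show ?thesis by (simp only: comp_def)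
    qed
    note m = std_normal_exp_moment[OF nrm, of "2 * ?c"]
    have eq: "(W r e i \<omega>)\<^sup>2 = exp ((2 * ?c) * of_real (\<xi> ?e \<omega>)) * (T r ?e \<omega>)\<^sup>2" for \<omega>
      by (simp only: W_def len power_mult_distrib mult.assoc exp_double)
    show "expectation (\<lambda>\<omega>. (W r e i \<omega>)\<^sup>2) = exp (2 * ?c\<^sup>2) * expectation (\<lambda>\<omega>. (T r ?e \<omega>)\<^sup>2)"
      using iv2 m(1) T by (simp only: eq indep_var_lebesgue_integral m(2)) (simp add: power_mult_distrib)
  }
qed

end

section \<open>Moments of the subtree sums and the one-level estimate\<close>

context gaussian_tree
begin

text \<open>The qualitative invariant of the induction over levels: the moment of order 2 + s is
  only claimed to be finite, its size being the subject of \<open>T_powr_le\<close>.\<close>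

definition tree_moments :: "real \<Rightarrow> nat \<Rightarrow> nat \<Rightarrow> nat list \<Rightarrow> bool" where
  "tree_moments s r k e \<longleftrightarrow> T r e \<in> borel_measurable M \<and>
     integrable M (\<lambda>\<omega>. cmod (T r e \<omega>) powr (2 + s)) \<and>
     expectation (T r e) = tree_mean N c r k \<and>
     expectation (\<lambda>\<omega>. (cmod (T r e \<omega>))\<^sup>2) = tree_sqmean N c r k"

text \<open>The children enter through the assumption \<open>child\<close>, so that these facts
  serve inside the induction that proves \<open>tree_moments\<close> as well as after it.\<close>

lemma
  assumes e: "e \<in> multi_indices N k" and k: "Suc k + r \<le> d" and s: "0 < s" "s \<le> 1"
    and child: "\<And>i. i \<in> {1..N (Suc k)} \<Longrightarrow> tree_moments s r (Suc k) (e @ [i])"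
  shows Y_indep: "indep_vars (\<lambda>_. borel) (Y r e) {1..N (Suc k)}"
    and W_integrable: "\<And>i. i \<in> {1..N (Suc k)} \<Longrightarrow> integrable M (W r e i)"
    and W_expectation: "\<And>i. i \<in> {1..N (Suc k)} \<Longrightarrow>
      expectation (W r e i) = exp ((c (Suc k))\<^sup>2 / 2) * tree_mean N c r (Suc k)"
    and W_square: "\<And>i. i \<in> {1..N (Suc k)} \<Longrightarrow> integrable M (\<lambda>\<omega>. (cmod (W r e i \<omega>))\<^sup>2)"
      "\<And>i. i \<in> {1..N (Suc k)} \<Longrightarrow>
      expectation (\<lambda>\<omega>. (cmod (W r e i \<omega>))\<^sup>2) = exp (2 * (Re (c (Suc k)))\<^sup>2) * tree_sqmean N c r (Suc k)"
    and Y_measurable: "\<And>i. i \<in> {1..N (Suc k)} \<Longrightarrow> Y r e i \<in> borel_measurable M"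
    and Y_mean: "\<And>i. i \<in> {1..N (Suc k)} \<Longrightarrow> expectation (Y r e i) = 0"
    and Y_square: "\<And>i. i \<in> {1..N (Suc k)} \<Longrightarrow> integrable M (\<lambda>\<omega>. (cmod (Y r e i \<omega>))\<^sup>2)"
      "\<And>i. i \<in> {1..N (Suc k)} \<Longrightarrow> expectation (\<lambda>\<omega>. (cmod (Y r e i \<omega>))\<^sup>2) =
        exp (2 * (Re (c (Suc k)))\<^sup>2) * tree_sqmean N c r (Suc k)
          - (cmod (exp ((c (Suc k))\<^sup>2 / 2) * tree_mean N c r (Suc k)))\<^sup>2"
    and Y_powr: "\<And>i. i \<in> {1..N (Suc k)} \<Longrightarrow> integrable M (\<lambda>\<omega>. cmod (Y r e i \<omega>) powr (2 + s))"
      "\<And>i. i \<in> {1..N (Suc k)} \<Longrightarrow> expectation (\<lambda>\<omega>. cmod (Y r e i \<omega>) powr (2 + s)) \<le>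
        2 powr (2 + s) * (exp ((2 + s)\<^sup>2 * (Re (c (Suc k)))\<^sup>2 / 2) * expectation (\<lambda>\<omega>. cmod (T r (e @ [i]) \<omega>) powr (2 + s))
          + cmod (exp ((c (Suc k))\<^sup>2 / 2) * tree_mean N c r (Suc k)) powr (2 + s))"
    and T_Suc_centered: "\<And>\<omega>. T (Suc r) e \<omega> - tree_mean N c (Suc r) k = (\<Sum>i=1..N (Suc k). Y r e i \<omega>)"
proof -
  let ?p = "2 + s" and ?c = "c (Suc k)"
  show "indep_vars (\<lambda>_. borel) (Y r e) {1..N (Suc k)}"
    unfolding Y_def[abs_def] by (rule indep_vars_compose2[OF indep_W[OF e k]]) measurable
  fix i assume i: "i \<in> {1..N (Suc k)}"
  from child[OF i] have [measurable]: "T r (e @ [i]) \<in> borel_measurable M"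
    and Tp: "integrable M (\<lambda>\<omega>. cmod (T r (e @ [i]) \<omega>) powr ?p)"
    and Tm: "expectation (T r (e @ [i])) = tree_mean N c r (Suc k)"
    and Tv: "expectation (\<lambda>\<omega>. (cmod (T r (e @ [i]) \<omega>))\<^sup>2) = tree_sqmean N c r (Suc k)"
    by (auto simp: tree_moments_def)
  have T2: "integrable M (\<lambda>\<omega>. (cmod (T r (e @ [i]) \<omega>))\<^sup>2)"
    using integrable_square_of_powr[OF _ Tp] s by simp
  then have T2p: "integrable M (\<lambda>\<omega>. cmod (T r (e @ [i]) \<omega>) powr 2)" by (simp add: powr_2_norm)
  have T1: "integrable M (T r (e @ [i]))" using integrable_of_square[OF _ T2] by simp
  note [measurable] = W_measurable[OF e k i]
  show W2: "integrable M (\<lambda>\<omega>. (cmod (W r e i \<omega>))\<^sup>2)"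
    using W_powr_integrable[OF e k i T2p] by (simp add: powr_2_norm)
  show W1: "integrable M (W r e i)" using integrable_of_square[OF _ W2] by simp
  show Wm: "expectation (W r e i) = exp (?c\<^sup>2 / 2) * tree_mean N c r (Suc k)"
    using W_mean[OF e k i T1] Tm by simp
  show Wv: "expectation (\<lambda>\<omega>. (cmod (W r e i \<omega>))\<^sup>2) = exp (2 * (Re ?c)\<^sup>2) * tree_sqmean N c r (Suc k)"
    using W_powr_moment[OF e k i T2p] Tv by (simp add: powr_2_norm)
  show Ym[measurable]: "Y r e i \<in> borel_measurable M" unfolding Y_def[abs_def] by measurable
  show "expectation (Y r e i) = 0" using W1 by (simp add: Y_def[abs_def] prob_space)
  show "integrable M (\<lambda>\<omega>. (cmod (Y r e i \<omega>))\<^sup>2)"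
    unfolding Y_def by (rule square_moment_centered(1)[OF _ W2]) measurable
  have "expectation (\<lambda>\<omega>. (cmod (Y r e i \<omega>))\<^sup>2) = expectation (\<lambda>\<omega>. (cmod (W r e i \<omega>))\<^sup>2) - (cmod (expectation (W r e i)))\<^sup>2"
    unfolding Y_def by (rule square_moment_centered(2)[OF _ W2]) measurable
  then show "expectation (\<lambda>\<omega>. (cmod (Y r e i \<omega>))\<^sup>2) =
        exp (2 * (Re ?c)\<^sup>2) * tree_sqmean N c r (Suc k)
          - (cmod (exp (?c\<^sup>2 / 2) * tree_mean N c r (Suc k)))\<^sup>2"
    unfolding Wv Wm .
  have Wp: "integrable M (\<lambda>\<omega>. cmod (W r e i \<omega>) powr ?p)" by (rule W_powr_integrable[OF e k i Tp])
  let ?m = "expectation (W r e i)"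
  have le: "cmod (Y r e i \<omega>) powr ?p \<le> 2 powr ?p * (cmod (W r e i \<omega>) powr ?p + cmod ?m powr ?p)" for \<omega>
    using norm_add_powr_le[of ?p "W r e i \<omega>" "- ?m"] s by (simp add: Y_def)
  have i2: "integrable M (\<lambda>\<omega>. 2 powr ?p * (cmod (W r e i \<omega>) powr ?p + cmod ?m powr ?p))"
    using Wp by simp
  show Yp: "integrable M (\<lambda>\<omega>. cmod (Y r e i \<omega>) powr ?p)"
    by (rule Bochner_Integration.integrable_bound[OF i2]) (use le in auto)
  have "expectation (\<lambda>\<omega>. cmod (Y r e i \<omega>) powr ?p) \<le>
      expectation (\<lambda>\<omega>. 2 powr ?p * (cmod (W r e i \<omega>) powr ?p + cmod ?m powr ?p))"
    by (rule integral_mono[OF Yp i2 le])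
  also have "\<dots> = 2 powr ?p * (expectation (\<lambda>\<omega>. cmod (W r e i \<omega>) powr ?p) + cmod ?m powr ?p)"
    using Wp by (simp add: prob_space)
  finally show "expectation (\<lambda>\<omega>. cmod (Y r e i \<omega>) powr ?p) \<le>
        2 powr ?p * (exp (?p\<^sup>2 * (Re ?c)\<^sup>2 / 2) * expectation (\<lambda>\<omega>. cmod (T r (e @ [i]) \<omega>) powr ?p)
          + cmod (exp (?c\<^sup>2 / 2) * tree_mean N c r (Suc k)) powr ?p)"
    unfolding W_powr_moment[OF e k i Tp] Wm .
next
  fix \<omega>
  have "expectation (W r e i) = exp ((c (Suc k))\<^sup>2 / 2) * tree_mean N c r (Suc k)" if i: "i \<in> {1..N (Suc k)}" for i
  proof -
    have "integrable M (T r (e @ [i]))"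
      using child[OF i] s integrable_of_square integrable_square_of_powr[of "T r (e @ [i])" "2 + s"]
      by (auto simp: tree_moments_def)
    then show ?thesis using W_mean[OF e k i] child[OF i] by (simp add: tree_moments_def)
  qed
  then show "T (Suc r) e \<omega> - tree_mean N c (Suc r) k = (\<Sum>i=1..N (Suc k). Y r e i \<omega>)"
    by (simp add: T_Suc[OF e] Y_def sum_subtractf)
qed

lemma tree_moments:
  assumes "e \<in> multi_indices N k" "k + r \<le> d" "0 < s" "s \<le> 1"
  shows "tree_moments s r k e"
  using assms(1,2)
proof (induction r arbitrary: e k)
  case 0
  show ?case by (simp add: tree_moments_def T_def[abs_def] prob_space)
next
  case (Suc r)
  note e = Suc.prems(1) and s = assms(3,4)
  have k: "Suc k + r \<le> d" using Suc.prems by simp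
  have child: "tree_moments s r (Suc k) (e @ [i])" if "i \<in> {1..N (Suc k)}" for i
    using k by (intro Suc.IH append_in_multi_indices[OF e that]) auto
  note facts = e k s child
  let ?m = "tree_mean N c (Suc r) k"
  have Teq: "T (Suc r) e \<omega> = (\<Sum>i=1..N (Suc k). Y r e i \<omega>) + ?m" for \<omega>
    using T_Suc_centered[OF facts, of \<omega>] by (metis diff_add_cancel)
  have [measurable]: "(\<lambda>\<omega>. \<Sum>i=1..N (Suc k). Y r e i \<omega>) \<in> borel_measurable M"
    using Y_measurable[OF facts] by simp
  have Tm[measurable]: "T (Suc r) e \<in> borel_measurable M"
    unfolding fun_eq_iff[THEN iffD2, OF allI, OF Teq] by measurable
  \<comment> \<open>Only integrability is wanted here; adding 1 to the variance gives a positive V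
    even for a node without children.\<close>
  have "integrable M (\<lambda>\<omega>. cmod (\<Sum>i=1..N (Suc k). Y r e i \<omega>) powr (2 + s))"
    by (rule powr_moment_indep_sum(1)[OF _ Y_indep[OF facts] s Y_powr(1)[OF facts] Y_mean[OF facts],
          where V = "(\<Sum>i=1..N (Suc k). expectation (\<lambda>\<omega>. (cmod (Y r e i \<omega>))\<^sup>2)) + 1"])
       (assumption | simp add: add_nonneg_pos sum_nonneg)+
  then have i2: "integrable M (\<lambda>\<omega>. 2 powr (2 + s) * (cmod (\<Sum>i=1..N (Suc k). Y r e i \<omega>) powr (2 + s) + cmod ?m powr (2 + s)))"
    by simp
  have Tp: "integrable M (\<lambda>\<omega>. cmod (T (Suc r) e \<omega>) powr (2 + s))"
  proof (rule Bochner_Integration.integrable_bound[OF i2])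
    have "cmod (T (Suc r) e \<omega>) powr (2 + s) \<le> 
       2 powr (2 + s) * (cmod (\<Sum>i=1..N (Suc k). Y r e i \<omega>) powr (2 + s) + cmod ?m powr (2 + s))" for \<omega>
      unfolding Teq using s by (intro norm_add_powr_le) auto
    then show "AE \<omega> in M. norm (cmod (T (Suc r) e \<omega>) powr (2 + s)) \<le>
        norm (2 powr (2 + s) * (cmod (\<Sum>i=1..N (Suc k). Y r e i \<omega>) powr (2 + s) + cmod ?m powr (2 + s)))"
      by (intro AE_I2) (simp add: abs_of_nonneg)
  qed measurable
  have Tmean: "expectation (T (Suc r) e) = ?m"
    unfolding T_Suc[OF e, abs_def] using W_integrable[OF facts] W_expectation[OF facts] by simp
  have T2: "integrable M (\<lambda>\<omega>. (cmod (T (Suc r) e \<omega>))\<^sup>2)"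
    using integrable_square_of_powr[OF Tm Tp] s by simp
  have "expectation (\<lambda>\<omega>. (cmod (T (Suc r) e \<omega>))\<^sup>2) =
     (cmod ?m)\<^sup>2 + expectation (\<lambda>\<omega>. (cmod (T (Suc r) e \<omega> - ?m))\<^sup>2)"
    using square_moment_centered(2)[OF Tm T2] unfolding Tmean by simp
  also have "expectation (\<lambda>\<omega>. (cmod (T (Suc r) e \<omega> - ?m))\<^sup>2) = 
      (\<Sum>i=1..N (Suc k). expectation (\<lambda>\<omega>. (cmod (Y r e i \<omega>))\<^sup>2))"
  proof -
    have "expectation (\<lambda>\<omega>. (cmod (\<Sum>i=1..N (Suc k). Y r e i \<omega>))\<^sup>2) =
        (\<Sum>i=1..N (Suc k). expectation (\<lambda>\<omega>. (cmod (Y r e i \<omega>))\<^sup>2))"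
      by (rule conjunct2[OF square_moment_indep_sum[OF finite_atLeastAtMost Y_indep[OF facts] Y_square(1)[OF facts] Y_mean[OF facts]]])
    then show ?thesis by (simp only: Teq add_diff_cancel_right')
  qed
  also have "\<dots> = tree_var_step N c r k (tree_sqmean N c r (Suc k))"
    using Y_square(2)[OF facts] by (simp add: tree_var_step_def)
  finally have "expectation (\<lambda>\<omega>. (cmod (T (Suc r) e \<omega>))\<^sup>2) = tree_sqmean N c (Suc r) k" by simp
  with Tm Tp Tmean show ?case by (simp add: tree_moments_def)
qed

lemma tree_moments_mean_le:
  assumes "tree_moments s r k e" "0 < s"
  shows "(cmod (tree_mean N c r k))\<^sup>2 \<le> tree_sqmean N c r k"
proof -
  have T: "T r e \<in> borel_measurable M" "integrable M (\<lambda>\<omega>. cmod (T r e \<omega>) powr (2 + s))"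
    "expectation (T r e) = tree_mean N c r k"
    "expectation (\<lambda>\<omega>. (cmod (T r e \<omega>))\<^sup>2) = tree_sqmean N c r k"
    using assms(1) by (auto simp: tree_moments_def)
  have "0 \<le> expectation (\<lambda>\<omega>. (cmod (T r e \<omega> - expectation (T r e)))\<^sup>2)" by simp
  also have "\<dots> = tree_sqmean N c r k - (cmod (tree_mean N c r k))\<^sup>2"
    using square_moment_centered(2)[OF T(1) integrable_square_of_powr[OF T(1,2)]] T assms by simp
  finally show ?thesis by simp
qed

text \<open>
  One level of the recursion. Jensen's inequality gives $|E\,W|^2 \le \rho\, E|W|^2$ with
  $\rho = e^{-|c|^2}$, so centring the summands costs only the factor $1 - \rho$ in the variance.
\<close>

lemma
  fixes C s :: real
  assumes e: "e \<in> multi_indices N k" and k: "Suc k + r \<le> d" and s: "0 < s" "s \<le> 1"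
    and N1: "N (Suc k) \<ge> 1" and c0: "c (Suc k) \<noteq> 0"
    and v: "tree_sqmean N c r (Suc k) > 0" and C: "C \<ge> 0"
    and child_le: "\<And>i. i \<in> {1..N (Suc k)} \<Longrightarrow> expectation (\<lambda>\<omega>. cmod (T r (e @ [i]) \<omega>) powr (2 + s))
       \<le> C * tree_sqmean N c r (Suc k) powr ((2 + s) / 2)"
  defines "\<rho> \<equiv> exp (- (cmod (c (Suc k)))\<^sup>2)"
    and "VS \<equiv> tree_var_step N c r k (tree_sqmean N c r (Suc k))"
    and "L \<equiv> 2 powr (2 + s) * (C + 1) * exp ((2 + s) * s * (Re (c (Suc k)))\<^sup>2 / 2) * real (N (Suc k)) powr (- s / 2)
      * (1 - exp (- (cmod (c (Suc k)))\<^sup>2)) powr (- (2 + s) / 2)"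
  shows var_step_pos: "0 < VS"
    and sum_Y_powr_le: "(\<Sum>i=1..N (Suc k). expectation (\<lambda>\<omega>. cmod (Y r e i \<omega>) powr (2 + s))) \<le> L * VS powr ((2 + s) / 2)"
    and Y_pseudo_variance_le: "cmod (\<Sum>i=1..N (Suc k). expectation (\<lambda>\<omega>. (Y r e i \<omega>)\<^sup>2))
       \<le> (exp (- 2 * (Im (c (Suc k)))\<^sup>2) + \<rho>) / (1 - \<rho>) * VS"
    and T_powr_le: "expectation (\<lambda>\<omega>. cmod (T (Suc r) e \<omega>) powr (2 + s)) \<le>
       2 powr (2 + s) * (5 + L) * tree_sqmean N c (Suc r) k powr ((2 + s) / 2)"
proof -
  let ?p = "2 + s" and ?c = "c (Suc k)" and ?N = "N (Suc k)" and ?m = "tree_mean N c r (Suc k)"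
  define u where "u = Re ?c"
  \<comment> \<open>E|W_i|^2, the same for all children.\<close>
  define V where "V = exp (2 * (Re ?c)\<^sup>2) * tree_sqmean N c r (Suc k)"
  \<comment> \<open>What remains of e^{p^2 u^2 / 2} after division by V's factor (e^{2 u^2})^{p/2} =
    e^{p u^2}: the exponent is p (p - 2) u^2 / 2 with p - 2 = s.\<close>
  define g where "g = exp (?p * s * u\<^sup>2 / 2)"
  let ?v = "tree_sqmean N c r (Suc k)"
  have child: "tree_moments s r (Suc k) (e @ [i])" if "i \<in> {1..?N}" for i
    using k s by (intro tree_moments append_in_multi_indices[OF e that]) auto
  note facts = e k s child
  have \<rho>: "0 < \<rho>" "\<rho> < 1" using c0 by (auto simp: \<rho>_def)
  have V0: "V > 0" using v by (simp add: V_def)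
  have g1: "1 \<le> g" using s by (simp add: g_def)
  have m2: "(cmod ?m)\<^sup>2 \<le> ?v" using tree_moments_mean_le[OF child, of 1] N1 s by simp
  have "(cmod (exp (?c\<^sup>2 / 2) * ?m))\<^sup>2 = exp (Re (?c\<^sup>2)) * (cmod ?m)\<^sup>2"
    by (simp add: norm_mult power_mult_distrib norm_exp_eq_Re power2_eq_square flip: exp_add)
  also have "\<dots> \<le> exp (Re (?c\<^sup>2)) * ?v" by (intro mult_left_mono m2) auto
  \<comment> \<open>Re (c^2) = 2 (Re c)^2 - |c|^2 produces the factor \<rho>.\<close>
  also have "\<dots> = \<rho> * V"
    unfolding \<rho>_def V_def mult.assoc[symmetric] exp_add[symmetric]
    by (simp add: cmod_power2 Re_power2 algebra_simps)
  finally have mW: "(cmod (exp (?c\<^sup>2 / 2) * ?m))\<^sup>2 \<le> \<rho> * V" .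
  have "real ?N * (V - \<rho> * V) \<le> real ?N * (V - (cmod (exp (?c\<^sup>2 / 2) * ?m))\<^sup>2)"
    by (intro mult_left_mono diff_left_mono mW) auto
  then have VSge: "(1 - \<rho>) * (real ?N * V) \<le> VS"
    unfolding VS_def tree_var_step_def V_def by (simp add: algebra_simps)
  have "0 < (1 - \<rho>) * (real ?N * V)" using \<rho> V0 N1 by simp
  with VSge show VS0: "0 < VS" by simp
  have Yle: "expectation (\<lambda>\<omega>. cmod (Y r e i \<omega>) powr ?p) \<le> 2 powr ?p * (C + 1) * g * V powr (?p / 2)"
    if i: "i \<in> {1..?N}" for i
  proof -
    have "V powr (?p / 2) = exp (?p * u\<^sup>2) * ?v powr (?p / 2)"
      using v by (simp add: V_def powr_mult u_def powr_def[of "exp _"])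
    then have 1: "exp (?p\<^sup>2 * u\<^sup>2 / 2) * ?v powr (?p / 2) = g * V powr (?p / 2)"
      by (simp add: g_def mult.assoc[symmetric] exp_add[symmetric]) 
         (simp add: power2_eq_square field_simps)
    have "exp (?p\<^sup>2 * u\<^sup>2 / 2) * expectation (\<lambda>\<omega>. cmod (T r (e @ [i]) \<omega>) powr ?p) \<le>
       exp (?p\<^sup>2 * u\<^sup>2 / 2) * (C * ?v powr (?p / 2))"
      by (intro mult_left_mono child_le i) auto
    also have "\<dots> = C * (exp (?p\<^sup>2 * u\<^sup>2 / 2) * ?v powr (?p / 2))" by simp
    also have "\<dots> = C * g * V powr (?p / 2)" unfolding 1 by simp
    finally have a: "exp (?p\<^sup>2 * u\<^sup>2 / 2) * expectation (\<lambda>\<omega>. cmod (T r (e @ [i]) \<omega>) powr ?p) \<le> C * g * V powr (?p / 2)" .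
    have "cmod (exp (?c\<^sup>2 / 2) * ?m) powr ?p = ((cmod (exp (?c\<^sup>2 / 2) * ?m))\<^sup>2) powr (?p / 2)"
      by (simp only: square_powr_half[OF norm_ge_zero])
    also have "\<dots> \<le> V powr (?p / 2)"
    proof (intro powr_mono2)
      have "\<rho> * V \<le> 1 * V" using \<rho> V0 by (intro mult_right_mono) auto
      with mW show "(cmod (exp (?c\<^sup>2 / 2) * ?m))\<^sup>2 \<le> V" by linarith
    qed (use s in auto)
    also have "\<dots> \<le> g * V powr (?p / 2)" using mult_right_mono[OF g1, of "V powr (?p / 2)"] by simp
    finally have b: "cmod (exp (?c\<^sup>2 / 2) * ?m) powr ?p \<le> g * V powr (?p / 2)" .
    have "expectation (\<lambda>\<omega>. cmod (Y r e i \<omega>) powr ?p) \<le> 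
       2 powr ?p * (C * g * V powr (?p / 2) + g * V powr (?p / 2))"
      by (rule order_trans[OF Y_powr(2)[OF facts i]])
         (use a b in \<open>auto intro!: mult_left_mono add_mono simp: u_def\<close>)
    then show ?thesis by (simp add: algebra_simps)
  qed
  \<comment> \<open>E Y^2 = E W^2 - (E W)^2. The first term loses the factor e^{-2 (Im c)^2} against
    V, the second is at most \<rho> V.\<close>
  have pv: "cmod (expectation (\<lambda>\<omega>. (Y r e i \<omega>)\<^sup>2)) \<le> (exp (- 2 * (Im ?c)\<^sup>2) + \<rho>) * V" if i: "i \<in> {1..?N}" for i
  proof -
    let ?T = "T r (e @ [i])"
    have T: "?T \<in> borel_measurable M" "integrable M (\<lambda>\<omega>. cmod (?T \<omega>) powr ?p)"
        "expectation (\<lambda>\<omega>. (cmod (?T \<omega>))\<^sup>2) = ?v"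
      using child[OF i] by (auto simp: tree_moments_def)
    have T2: "integrable M (\<lambda>\<omega>. (?T \<omega>)\<^sup>2)"
      using integrable_square_of_powr[OF T(1,2)] T(1) s
      by (subst integrable_norm_iff[symmetric]) (simp_all add: norm_power)
    have W2: "integrable M (\<lambda>\<omega>. (W r e i \<omega>)\<^sup>2)"
      using W_square(1)[OF facts i] W_measurable[OF e k i]
      by (subst integrable_norm_iff[symmetric]) (simp_all add: norm_power)
    let ?w = "expectation (W r e i)"
    have "expectation (\<lambda>\<omega>. (Y r e i \<omega>)\<^sup>2) = expectation (\<lambda>\<omega>. (W r e i \<omega>)\<^sup>2 - 2 * ?w * W r e i \<omega> + ?w\<^sup>2)"
      by (simp add: Y_def power2_diff algebra_simps)
    also have "\<dots> = expectation (\<lambda>\<omega>. (W r e i \<omega>)\<^sup>2) - ?w\<^sup>2"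
      using W2 W_integrable[OF facts i] by (simp add: prob_space power2_eq_square)
    finally have "cmod (expectation (\<lambda>\<omega>. (Y r e i \<omega>)\<^sup>2)) \<le> cmod (expectation (\<lambda>\<omega>. (W r e i \<omega>)\<^sup>2)) + (cmod ?w)\<^sup>2"
      using norm_triangle_ineq4[of "expectation (\<lambda>\<omega>. (W r e i \<omega>)\<^sup>2)" "?w\<^sup>2"] by (simp add: norm_power)
    also have "(cmod ?w)\<^sup>2 \<le> \<rho> * V" using mW W_expectation[OF facts i] by simp
    also have "cmod (expectation (\<lambda>\<omega>. (W r e i \<omega>)\<^sup>2)) = exp (2 * Re (?c\<^sup>2)) * cmod (expectation (\<lambda>\<omega>. (?T \<omega>)\<^sup>2))"
      by (simp add: W_square_mean[OF e k i T2] norm_mult norm_exp_eq_Re)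
    also have "cmod (expectation (\<lambda>\<omega>. (?T \<omega>)\<^sup>2)) \<le> ?v"
      using integral_norm_bound[of M "\<lambda>\<omega>. (?T \<omega>)\<^sup>2"] T(3) by (simp add: norm_power)
    also have "exp (2 * Re (?c\<^sup>2)) * ?v = exp (- 2 * (Im ?c)\<^sup>2) * V"
      unfolding V_def mult.assoc[symmetric] exp_add[symmetric] by (simp add: Re_power2 algebra_simps)
    finally show ?thesis by (simp add: algebra_simps)
  qed
  have "cmod (\<Sum>i=1..?N. expectation (\<lambda>\<omega>. (Y r e i \<omega>)\<^sup>2)) \<le> real ?N * ((exp (- 2 * (Im ?c)\<^sup>2) + \<rho>) * V)"
    using sum_norm_le[of "{1..?N}", OF pv] by simp
  also have "\<dots> = (exp (- 2 * (Im ?c)\<^sup>2) + \<rho>) / (1 - \<rho>) * ((1 - \<rho>) * (real ?N * V))"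
    using \<rho> by simp
  also have "\<dots> \<le> (exp (- 2 * (Im ?c)\<^sup>2) + \<rho>) / (1 - \<rho>) * VS"
    using \<rho> by (intro mult_left_mono VSge) auto
  finally show "cmod (\<Sum>i=1..?N. expectation (\<lambda>\<omega>. (Y r e i \<omega>)\<^sup>2)) \<le> (exp (- 2 * (Im ?c)\<^sup>2) + \<rho>) / (1 - \<rho>) * VS" .
  have VSp: "(1 - \<rho>) powr (?p / 2) * (real ?N powr (?p / 2) * V powr (?p / 2)) \<le> VS powr (?p / 2)"
  proof -
    have "((1 - \<rho>) * (real ?N * V)) powr (?p / 2) \<le> VS powr (?p / 2)"
      using VSge \<rho> V0 s by (intro powr_mono2) auto
    then show ?thesis using \<rho> V0 by (simp add: powr_mult)
  qed
  have "(\<Sum>i=1..?N. expectation (\<lambda>\<omega>. cmod (Y r e i \<omega>) powr ?p)) \<le> real ?N * (2 powr ?p * (C + 1) * g * V powr (?p / 2))"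
    using sum_mono[of "{1..?N}", OF Yle] by simp
  \<comment> \<open>L collects N^{1 - p/2} = N^{-s/2} and the inverse of (1 - \<rho>)^{p/2}, the
    loss in the lower bound \<open>VSge\<close> for the variance.\<close>
  also have "\<dots> = L * ((1 - \<rho>) powr (?p / 2) * (real ?N powr (?p / 2) * V powr (?p / 2)))"
  proof -
    have 1: "(1 - \<rho>) powr (- ?p / 2) * (1 - \<rho>) powr (?p / 2) = 1"
      using \<rho> by (simp flip: powr_add) (simp add: add_divide_distrib[symmetric])
    have 2: "real ?N powr (- s / 2) * real ?N powr (?p / 2) = real ?N"
      using N1 by (simp flip: powr_add) (simp add: diff_divide_distrib[symmetric])
    have 3: "L = 2 powr ?p * (C + 1) * g * real ?N powr (- s / 2) * (1 - \<rho>) powr (- ?p / 2)"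
      by (simp only: L_def g_def \<rho>_def u_def)
    have "L * ((1 - \<rho>) powr (?p / 2) * (real ?N powr (?p / 2) * V powr (?p / 2))) =
       2 powr ?p * (C + 1) * g * (real ?N powr (- s / 2) * real ?N powr (?p / 2))
         * ((1 - \<rho>) powr (- ?p / 2) * (1 - \<rho>) powr (?p / 2)) * V powr (?p / 2)"
      unfolding 3 by (simp only: mult_ac)
    then show ?thesis unfolding 1 2 by (simp only: mult_ac mult_1_right mult_1_left)
  qed
  also have "\<dots> \<le> L * VS powr (?p / 2)"
    using C by (intro mult_left_mono VSp) (auto simp: L_def)
  finally show sumY: "(\<Sum>i=1..?N. expectation (\<lambda>\<omega>. cmod (Y r e i \<omega>) powr ?p)) \<le> L * VS powr (?p / 2)" .
  let ?m' = "tree_mean N c (Suc r) k" and ?v' = "tree_sqmean N c (Suc r) k"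
  let ?S = "\<lambda>\<omega>. \<Sum>i=1..?N. Y r e i \<omega>"
  have "VS = (\<Sum>i=1..?N. expectation (\<lambda>\<omega>. (cmod (Y r e i \<omega>))\<^sup>2))"
    using Y_square(2)[OF facts] by (simp add: VS_def tree_var_step_def)
  note ros = powr_moment_indep_sum[OF _ Y_indep[OF facts] s Y_powr(1)[OF facts] Y_mean[OF facts] eq_refl[OF this[symmetric]] VS0]
  have T': "tree_moments s (Suc r) k e" using k s by (intro tree_moments e) auto
  have v': "?v' = (cmod ?m')\<^sup>2 + VS" by (simp add: VS_def)
  have i2: "integrable M (\<lambda>\<omega>. 2 powr ?p * (cmod (?S \<omega>) powr ?p + cmod ?m' powr ?p))"
    using ros(1) by simp
  have "cmod (T (Suc r) e \<omega>) powr ?p \<le> 2 powr ?p * (cmod (?S \<omega>) powr ?p + cmod ?m' powr ?p)" for \<omega>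
  proof -
    have "T (Suc r) e \<omega> = ?S \<omega> + ?m'"
      using T_Suc_centered[OF facts, of \<omega>] by (metis diff_add_cancel)
    then show ?thesis using norm_add_powr_le[of ?p "?S \<omega>" ?m'] s by (simp only: add_nonneg_nonneg)
  qed
  then have "expectation (\<lambda>\<omega>. cmod (T (Suc r) e \<omega>) powr ?p) \<le>
     expectation (\<lambda>\<omega>. 2 powr ?p * (cmod (?S \<omega>) powr ?p + cmod ?m' powr ?p))"
    using T' i2 by (intro integral_mono) (auto simp: tree_moments_def)
  also have "\<dots> = 2 powr ?p * (expectation (\<lambda>\<omega>. cmod (?S \<omega>) powr ?p) + cmod ?m' powr ?p)"
    using ros(1) by (simp add: prob_space)
  also have "\<dots> \<le> 2 powr ?p * ((4 * VS powr (?p / 2) + L * VS powr (?p / 2)) + ?v' powr (?p / 2))"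
  proof (intro mult_left_mono add_mono)
    show "expectation (\<lambda>\<omega>. cmod (?S \<omega>) powr ?p) \<le> 4 * VS powr (?p / 2) + L * VS powr (?p / 2)"
      using ros(2) sumY by simp
    have "cmod ?m' powr ?p = ((cmod ?m')\<^sup>2) powr (?p / 2)"
      by (simp only: square_powr_half[OF norm_ge_zero])
    also have "\<dots> \<le> ?v' powr (?p / 2)" unfolding v' using VS0 s by (intro powr_mono2) auto
    finally show "cmod ?m' powr ?p \<le> ?v' powr (?p / 2)" .
  qed auto
  \<comment> \<open>Both the variance and the squared mean are at most their sum \<open>?v'\<close>,
    whichever of them dominates. The 5 is the 4 of the moment inequality plus 1 for the
    mean.\<close>
  also have "\<dots> \<le> 2 powr ?p * ((4 * ?v' powr (?p / 2) + L * ?v' powr (?p / 2)) + ?v' powr (?p / 2))"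
  proof -
    have "VS powr (?p / 2) \<le> ?v' powr (?p / 2)" unfolding v' using VS0 s by (intro powr_mono2) auto
    then show ?thesis using C by (intro mult_left_mono add_mono) (auto simp: L_def)
  qed
  finally show "expectation (\<lambda>\<omega>. cmod (T (Suc r) e \<omega>) powr ?p) \<le> 2 powr ?p * (5 + L) * ?v' powr (?p / 2)"
    by (simp add: algebra_simps)
qed

end

section \<open>The subcritical regime\<close>

lemma exp_neg_mult_nat_tendsto_0:
  fixes \<kappa> :: real
  assumes "\<kappa> > 0"
  shows "(\<lambda>n. exp (- (\<kappa> * real n))) \<longlonglongrightarrow> 0"
proof -
  have "(\<lambda>n. exp (- \<kappa>) ^ n) \<longlonglongrightarrow> 0" using assms by (intro LIMSEQ_realpow_zero) auto
  then show ?thesis by (simp add: exp_of_nat_mult[symmetric] mult.commute)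
qed

lemma tree_sum_real:
  assumes "\<And>j. Im (c j) = 0"
  shows "Im (tree_sum N c r e x) = 0"
proof (induction r arbitrary: e)
  case (Suc r)
  have "Im (exp (c j * of_real y)) = 0" for j y using assms by (simp add: Im_exp)
  with Suc show ?case by simp
qed simp

section \<open>Growth rates of the coefficients, the level sizes and the moments\<close>

locale grem_subcritical = grem d a \<alpha> N M \<xi>
  for d :: nat and a \<alpha> :: "nat \<Rightarrow> real" and N :: "nat \<Rightarrow> nat \<Rightarrow> nat"
    and M :: "nat \<Rightarrow> 'w measure" and \<xi> :: "nat \<Rightarrow> nat list \<Rightarrow> 'w \<Rightarrow> real" +
  fixes \<beta> :: complex
  assumes beta_nonzero: "\<beta> \<noteq> 0"
    and Re_beta: "\<bar>Re \<beta>\<bar> < grem_sigma a \<alpha> 1 / 2"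
begin

definition coef :: "nat \<Rightarrow> nat \<Rightarrow> complex" where
  "coef n j = \<beta> * of_real (sqrt (real n) * sqrt (a j))"

sublocale tree: gaussian_tree "M n" d "N n" "coef n" "\<xi> n" for n
proof -
  interpret prob_space "M n" by (rule prob_space_M)
  show "gaussian_tree (M n) d (N n) (\<xi> n)"
    by unfold_locales (use xi_indep xi_normal in auto)
qed

lemma coef_squares:
  assumes "j \<in> {1..d}"
  shows "(cmod (coef n j))\<^sup>2 = (cmod \<beta>)\<^sup>2 * a j * real n"
    and "(Re (coef n j))\<^sup>2 = (Re \<beta>)\<^sup>2 * a j * real n"
    and "(Im (coef n j))\<^sup>2 = (Im \<beta>)\<^sup>2 * a j * real n"
  using a_pos[OF assms] by (simp_all add: coef_def norm_mult power_mult_distrib)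

text \<open>The ordering \<sigma>_1 \<le> \<sigma>_j carries the condition at the first level to
  every level: together the two bounds give 2 (Re \<beta>)^2 a_j < log \<alpha>_j, the Lyapunov
  condition in the limit s = 0.\<close>

lemma Re_beta_less_ln:
  assumes j: "j \<in> {1..d}"
  shows "4 * (Re \<beta>)\<^sup>2 < (grem_sigma a \<alpha> 1)\<^sup>2"
    and "(grem_sigma a \<alpha> 1)\<^sup>2 * a j \<le> 2 * ln (\<alpha> j)"
proof -
  have sq: "(grem_sigma a \<alpha> j)\<^sup>2 = 2 * ln (\<alpha> j) / a j" if "j \<in> {1..d}" for j
    using a_pos[OF that] alpha_gt_1[OF that] by (simp add: grem_sigma_def)
  have 1: "1 \<in> {1..d}" using d_ge_1 by simp
  have pos: "0 \<le> grem_sigma a \<alpha> 1"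
    using a_pos[OF 1] alpha_gt_1[OF 1] by (simp add: grem_sigma_def)
  have "(2 * \<bar>Re \<beta>\<bar>)\<^sup>2 < (grem_sigma a \<alpha> 1)\<^sup>2" using Re_beta by (intro power_strict_mono) auto
  then show "4 * (Re \<beta>)\<^sup>2 < (grem_sigma a \<alpha> 1)\<^sup>2" by (simp add: power_mult_distrib)
  have "grem_sigma a \<alpha> 1 \<le> grem_sigma a \<alpha> j"
    using sigma_increasing 1 j unfolding strict_mono_on_def by (cases "j = 1") (auto intro: less_imp_le)
  then have "(grem_sigma a \<alpha> 1)\<^sup>2 \<le> (grem_sigma a \<alpha> j)\<^sup>2" using pos by (intro power_mono)
  then show "(grem_sigma a \<alpha> 1)\<^sup>2 * a j \<le> 2 * ln (\<alpha> j)"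
    using sq[OF j] a_pos[OF j] by (simp add: field_simps)
qed

text \<open>The inequality is strict at s = 0. One s serves all levels because the gap \<Delta> is
  measured from \<sigma>_1^2, before multiplication by a_j.\<close>

lemma lyapunov_exponent_exists:
  obtains s where "0 < s" "s \<le> 1" "\<And>j. j \<in> {1..d} \<Longrightarrow> (2 + s) * (Re \<beta>)\<^sup>2 * a j < ln (\<alpha> j)"
proof -
  define \<Delta> where "\<Delta> = (grem_sigma a \<alpha> 1)\<^sup>2 - 4 * (Re \<beta>)\<^sup>2"
  have \<Delta>: "\<Delta> > 0" using Re_beta_less_ln(1)[of 1] d_ge_1 by (simp add: \<Delta>_def)
  \<comment> \<open>It suffices that 2 s (Re \<beta>)^2 < \<Delta>. The added 1 keeps the
    denominator positive at Re \<beta> = 0 and makes this inequality strict.\<close>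
  define s where "s = min 1 (\<Delta> / (4 * (Re \<beta>)\<^sup>2 + 1))"
  have pos: "4 * (Re \<beta>)\<^sup>2 + 1 > 0" by (intro add_nonneg_pos) auto
  have s: "0 < s" "s \<le> 1" using \<Delta> pos by (auto simp: s_def)
  have "s * (4 * (Re \<beta>)\<^sup>2 + 1) \<le> \<Delta>"
  proof -
    have "s \<le> \<Delta> / (4 * (Re \<beta>)\<^sup>2 + 1)" by (simp add: s_def)
    then show ?thesis using pos by (simp add: pos_le_divide_eq)
  qed
  moreover have "s * (4 * (Re \<beta>)\<^sup>2 + 1) = 2 * (2 * s * (Re \<beta>)\<^sup>2) + s" by (simp add: algebra_simps)
  moreover have "0 \<le> 2 * s * (Re \<beta>)\<^sup>2" using s by simp
  ultimately have "2 * s * (Re \<beta>)\<^sup>2 < \<Delta>" using s by linarith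
  then have lt: "2 * ((2 + s) * (Re \<beta>)\<^sup>2) < (grem_sigma a \<alpha> 1)\<^sup>2" by (simp add: \<Delta>_def algebra_simps)
  show thesis
  proof (rule that[OF s])
    fix j assume j: "j \<in> {1..d}"
    have "2 * ((2 + s) * (Re \<beta>)\<^sup>2) * a j < (grem_sigma a \<alpha> 1)\<^sup>2 * a j"
      using lt a_pos[OF j] by (rule mult_strict_right_mono)
    with Re_beta_less_ln(2)[OF j] show "(2 + s) * (Re \<beta>)\<^sup>2 * a j < ln (\<alpha> j)" by linarith
  qed
qed

lemma N_eventually_ge_1: "\<forall>\<^sub>F n in sequentially. \<forall>j\<in>{1..d}. N n j \<ge> 1"
proof (intro eventually_ball_finite ballI)
  fix j assume j: "j \<in> {1..d}"
  have "\<forall>\<^sub>F n in sequentially. real (N n j) / \<alpha> j ^ n > 0"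
    using N_asymp[OF j] by (rule order_tendstoD) simp
  then show "\<forall>\<^sub>F n in sequentially. N n j \<ge> 1"
    by eventually_elim (auto simp: Suc_le_eq intro: Nat.gr0I)
qed simp

lemma exp_coef_tendsto_0:
  assumes j: "j \<in> {1..d}"
  shows "(\<lambda>n. exp (- (cmod (coef n j))\<^sup>2)) \<longlonglongrightarrow> 0"
  unfolding coef_squares[OF j]
  using beta_nonzero a_pos[OF j] by (intro exp_neg_mult_nat_tendsto_0) auto

text \<open>At j = 1 this is the share of a single summand in the variance at the root, the \<delta>
  of \<open>char_indep_sum_complex_approx\<close>.\<close>

lemma N_inverse_tendsto_0:
  assumes j: "j \<in> {1..d}"
  shows "(\<lambda>n. 1 / real (N n j)) \<longlonglongrightarrow> 0"
proof -
  have "(\<lambda>n. inverse (real (N n j) / \<alpha> j ^ n) * (1 / \<alpha> j) ^ n) \<longlonglongrightarrow> inverse 1 * 0"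
    using alpha_gt_1[OF j] by (intro tendsto_mult tendsto_inverse N_asymp j LIMSEQ_realpow_zero) auto
  moreover have "inverse (real (N n j) / \<alpha> j ^ n) * (1 / \<alpha> j) ^ n = 1 / real (N n j)" for n
    using alpha_gt_1[OF j] by (simp add: power_divide)
  ultimately show ?thesis by (simp only: mult_zero_right)
qed

text \<open>
  A bound for $\sum_i E|Y_i|^{2+s} / (\sum_i E|Y_i|^2)^{(2+s)/2}$ over the children of a node at
  level $j - 1$. Up to constants it is $N_{n,j}^{-s/2} e^{(2+s) s \sigma^2 a_j n / 2}$, so it vanishes
  if $(2+s) \sigma^2 a_j < \log \alpha_j$; since $4 \sigma^2 < \sigma_1^2$, this holds for small
  $s$.
\<close>

definition lyapunov_ratio :: "real \<Rightarrow> real \<Rightarrow> nat \<Rightarrow> nat \<Rightarrow> real" where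
  "lyapunov_ratio s C n j = 2 powr (2 + s) * (C + 1) * exp ((2 + s) * s * (Re (coef n j))\<^sup>2 / 2)
     * real (N n j) powr (- s / 2) * (1 - exp (- (cmod (coef n j))\<^sup>2)) powr (- (2 + s) / 2)"

lemma lyapunov_ratio_tendsto_0:
  assumes j: "j \<in> {1..d}" and s: "0 < s" and lt: "(2 + s) * (Re \<beta>)\<^sup>2 * a j < ln (\<alpha> j)"
  shows "(\<lambda>n. lyapunov_ratio s C n j) \<longlonglongrightarrow> 0"
proof -
  \<comment> \<open>The net exponential rate: N_{n,j}^{-s/2} decays like e^{- (s/2) n log
    \<alpha>_j}, the Gaussian factor grows like e^{(2+s) s (Re \<beta>)^2 a_j n / 2}.\<close>
  define \<kappa> where "\<kappa> = s / 2 * (ln (\<alpha> j) - (2 + s) * (Re \<beta>)\<^sup>2 * a j)"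
  have \<kappa>: "\<kappa> > 0" using s lt by (simp add: \<kappa>_def)
  have \<alpha>: "\<alpha> j > 1" by (rule alpha_gt_1[OF j])
  have "(\<lambda>n. 2 powr (2 + s) * (C + 1) * exp (- (\<kappa> * real n)) * (real (N n j) / \<alpha> j ^ n) powr (- s / 2)
      * (1 - exp (- (cmod (coef n j))\<^sup>2)) powr (- (2 + s) / 2)) \<longlonglongrightarrow>
      2 powr (2 + s) * (C + 1) * 0 * 1 powr (- s / 2) * (1 - 0) powr (- (2 + s) / 2)"
    by (intro tendsto_mult tendsto_const exp_neg_mult_nat_tendsto_0 \<kappa> tendsto_powr N_asymp j
          tendsto_diff exp_coef_tendsto_0) auto
  then have lim: "(\<lambda>n. 2 powr (2 + s) * (C + 1) * exp (- (\<kappa> * real n)) * (real (N n j) / \<alpha> j ^ n) powr (- s / 2)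
      * (1 - exp (- (cmod (coef n j))\<^sup>2)) powr (- (2 + s) / 2)) \<longlonglongrightarrow> 0" by simp
  show ?thesis
  proof (rule Lim_transform_eventually[OF lim])
    have "exp (- (\<kappa> * real n)) * (real (N n j) / \<alpha> j ^ n) powr (- s / 2) = 
       exp ((2 + s) * s * (Re (coef n j))\<^sup>2 / 2) * real (N n j) powr (- s / 2)" for n
    proof -
      have "(\<alpha> j ^ n) powr (- s / 2) = exp (- s / 2 * (real n * ln (\<alpha> j)))"
        using \<alpha> by (simp add: powr_def ln_realpow)
      then have "(real (N n j) / \<alpha> j ^ n) powr (- s / 2) = real (N n j) powr (- s / 2) * exp (s / 2 * (real n * ln (\<alpha> j)))"
        using \<alpha> by (simp add: powr_divide exp_minus field_simps)
      moreover have "exp (- (\<kappa> * real n)) * exp (s / 2 * (real n * ln (\<alpha> j))) = exp ((2 + s) * s * (Re (coef n j))\<^sup>2 / 2)"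
        unfolding exp_add[symmetric] coef_squares[OF j] \<kappa>_def
        by (intro arg_cong[where f = exp]) (simp add: field_simps)
      moreover have "exp (- (\<kappa> * real n)) * (real (N n j) powr (- s / 2) * exp (s / 2 * (real n * ln (\<alpha> j)))) =
          (exp (- (\<kappa> * real n)) * exp (s / 2 * (real n * ln (\<alpha> j)))) * real (N n j) powr (- s / 2)"
        by (simp only: mult_ac)
      ultimately show ?thesis by simp
    qed
    then have "A * exp (- (\<kappa> * real n)) * (real (N n j) / \<alpha> j ^ n) powr (- s / 2) * B =
       A * exp ((2 + s) * s * (Re (coef n j))\<^sup>2 / 2) * real (N n j) powr (- s / 2) * B" for n A B
      by (simp only: mult.assoc[of A])
    then show "\<forall>\<^sub>F n in sequentially. 2 powr (2 + s) * (C + 1) * exp (- (\<kappa> * real n)) * (real (N n j) / \<alpha> j ^ n) powr (- s / 2)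
      * (1 - exp (- (cmod (coef n j))\<^sup>2)) powr (- (2 + s) / 2) = lyapunov_ratio s C n j"
      unfolding lyapunov_ratio_def by (simp only: simp_thms eventually_True)
  qed
qed

lemma coef_nonzero: "n \<ge> 1 \<Longrightarrow> j \<in> {1..d} \<Longrightarrow> coef n j \<noteq> 0"
  using beta_nonzero a_pos[of j] by (simp add: coef_def)

text \<open>The constant of the level below enters the next one only through
  \<open>lyapunov_ratio\<close>, which tends to 0. Once it is below 1, the factor 5 + L of the
  one-level estimate is at most 6, so constants do not accumulate over the levels.\<close>

lemma moment_bound_eventually:
  assumes s: "0 < s" "s \<le> 1" and lt: "\<And>j. j \<in> {1..d} \<Longrightarrow> (2 + s) * (Re \<beta>)\<^sup>2 * a j < ln (\<alpha> j)"
    and "k + r \<le> d"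
  shows "\<exists>C\<ge>0. \<forall>\<^sub>F n in sequentially. tree_sqmean (N n) (coef n) r k > 0 \<and>
    (\<forall>e\<in>multi_indices (N n) k. (\<integral>\<omega>. cmod (tree.T n r e \<omega>) powr (2 + s) \<partial>M n)
       \<le> C * tree_sqmean (N n) (coef n) r k powr ((2 + s) / 2))"
  using assms(4)
proof (induction r arbitrary: k)
  case 0
  show ?case by (intro exI[of _ 1]) (simp add: tree.T_def tree.prob_space)
next
  case (Suc r)
  have "Suc k + r \<le> d" using Suc.prems by simp
  from Suc.IH[OF this] obtain C where C: "C \<ge> 0" and ev: "\<forall>\<^sub>F n in sequentially. tree_sqmean (N n) (coef n) r (Suc k) > 0 \<and>
    (\<forall>e\<in>multi_indices (N n) (Suc k). (\<integral>\<omega>. cmod (tree.T n r e \<omega>) powr (2 + s) \<partial>M n)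
       \<le> C * tree_sqmean (N n) (coef n) r (Suc k) powr ((2 + s) / 2))" 
    by blast
  have k: "Suc k \<in> {1..d}" "Suc k + r \<le> d" using Suc.prems by auto
  have "\<forall>\<^sub>F n in sequentially. lyapunov_ratio s C n (Suc k) < 1"
    using lyapunov_ratio_tendsto_0[OF k(1) s(1) lt[OF k(1)]] by (rule order_tendstoD) simp
  with ev N_eventually_ge_1 eventually_ge_at_top[of 1]
  have "\<forall>\<^sub>F n in sequentially. tree_sqmean (N n) (coef n) (Suc r) k > 0 \<and>
    (\<forall>e\<in>multi_indices (N n) k. (\<integral>\<omega>. cmod (tree.T n (Suc r) e \<omega>) powr (2 + s) \<partial>M n)
       \<le> 2 powr (2 + s) * 6 * tree_sqmean (N n) (coef n) (Suc r) k powr ((2 + s) / 2))"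
  proof eventually_elim
    case (elim n)
    have step: "tree_var_step (N n) (coef n) r k (tree_sqmean (N n) (coef n) r (Suc k)) > 0 \<and>
      (\<integral>\<omega>. cmod (tree.T n (Suc r) e \<omega>) powr (2 + s) \<partial>M n)
       \<le> 2 powr (2 + s) * (5 + lyapunov_ratio s C n (Suc k)) * tree_sqmean (N n) (coef n) (Suc r) k powr ((2 + s) / 2)"
      if e: "e \<in> multi_indices (N n) k" for e
      using elim k C coef_nonzero[of n "Suc k"] append_in_multi_indices[OF e] unfolding lyapunov_ratio_def
      by (intro conjI tree.var_step_pos[OF e k(2) s] tree.T_powr_le[OF e k(2) s]) auto
    \<comment> \<open>Positivity of the variance is stated at a node; all N_{n,j} being at least 1,
      the node with all entries 1 exists.\<close>
    have "replicate k 1 \<in> multi_indices (N n) k"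
      using elim k by (auto simp: multi_indices_def)
    from step[OF this] have "tree_sqmean (N n) (coef n) (Suc r) k > 0"
      by (simp add: add_nonneg_pos)
    moreover have "(\<integral>\<omega>. cmod (tree.T n (Suc r) e \<omega>) powr (2 + s) \<partial>M n)
       \<le> 2 powr (2 + s) * 6 * tree_sqmean (N n) (coef n) (Suc r) k powr ((2 + s) / 2)"
      if e: "e \<in> multi_indices (N n) k" for e
      using step[OF e] elim by (elim conjE order_trans) (intro mult_right_mono mult_left_mono; simp)
    ultimately show ?case by blast
  qed
  then show ?case by (intro exI[of _ "2 powr (2 + s) * 6"]) simp
qed

definition level1_variance :: "nat \<Rightarrow> real" where
  "level1_variance n = tree_var_step (N n) (coef n) (d - 1) 0 (tree_sqmean (N n) (coef n) (d - 1) 1)"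

definition normalized :: "nat \<Rightarrow> 'w \<Rightarrow> complex" where
  "normalized n \<omega> = (tree.T n d [] \<omega> - tree_mean (N n) (coef n) d 0) / of_real (sqrt (level1_variance n))"

lemma root_in_multi_indices: "[] \<in> multi_indices (N n) 0"
  by (simp add: multi_indices_def)

lemma d_eq: "d = Suc (d - 1)"
  using d_ge_1 by simp

text \<open>\<open>level1_variance\<close> is the variance of the whole partition function: the
  first-level summands contain their subtrees, so summing their variances accounts for all
  levels.\<close>

lemma root_moments:
  shows "tree.T n d [] \<in> borel_measurable (M n)"
    and "integrable (M n) (\<lambda>\<omega>. (cmod (tree.T n d [] \<omega>))\<^sup>2)"
    and "(\<integral>\<omega>. tree.T n d [] \<omega> \<partial>M n) = tree_mean (N n) (coef n) d 0"
    and "complex_variance (M n) (tree.T n d []) = level1_variance n"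
proof -
  \<comment> \<open>Finiteness of moments holds for every s in (0, 1]; the growth condition on s
    matters only for their size.\<close>
  have m: "tree.tree_moments n 1 d 0 []"
    by (intro tree.tree_moments root_in_multi_indices) auto
  then show *: "tree.T n d [] \<in> borel_measurable (M n)"
    "(\<integral>\<omega>. tree.T n d [] \<omega> \<partial>M n) = tree_mean (N n) (coef n) d 0"
    by (auto simp: tree.tree_moments_def)
  from m have "integrable (M n) (\<lambda>\<omega>. cmod (tree.T n d [] \<omega>) powr (2 + 1))"
    unfolding tree.tree_moments_def by blast
  from tree.integrable_square_of_powr[OF *(1) this]
  show "integrable (M n) (\<lambda>\<omega>. (cmod (tree.T n d [] \<omega>))\<^sup>2)" by simp
  have "(\<integral>\<omega>. (cmod (tree.T n d [] \<omega>))\<^sup>2 \<partial>M n) = tree_sqmean (N n) (coef n) d 0"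
    using m by (simp add: tree.tree_moments_def)
  also have "\<dots> = (cmod (tree_mean (N n) (coef n) d 0))\<^sup>2 + level1_variance n"
    by (subst (1 2) d_eq) (simp add: level1_variance_def)
  finally show "complex_variance (M n) (tree.T n d []) = level1_variance n"
    by (simp add: complex_variance_def *(2))
qed

text \<open>An inequality, because division by a vanishing \<open>level1_variance\<close> yields 0.
  In this form it holds for every n.\<close>

lemma normalized_square:
  shows "normalized n \<in> borel_measurable (M n)"
    and "integrable (M n) (\<lambda>\<omega>. (cmod (normalized n \<omega>))\<^sup>2)"
    and "(\<integral>\<omega>. (cmod (normalized n \<omega>))\<^sup>2 \<partial>M n) \<le> 1"
proof -
  let ?V = "level1_variance n"
  note sc = tree.square_moment_centered[OF root_moments(1,2), of n, unfolded root_moments(3)]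
  note [measurable] = root_moments(1)[of n]
  have V: "(\<integral>\<omega>. (cmod (tree.T n d [] \<omega> - tree_mean (N n) (coef n) d 0))\<^sup>2 \<partial>M n) = ?V"
    using sc(2) root_moments(4)[of n] root_moments(3)[of n] by (simp add: complex_variance_def)
  moreover have "0 \<le> (\<integral>\<omega>. (cmod (tree.T n d [] \<omega> - tree_mean (N n) (coef n) d 0))\<^sup>2 \<partial>M n)" by simp
  ultimately have V0: "0 \<le> ?V" by simp
  have eq: "(cmod (normalized n \<omega>))\<^sup>2 = (cmod (tree.T n d [] \<omega> - tree_mean (N n) (coef n) d 0))\<^sup>2 / ?V" for \<omega>
    using V0 by (simp add: normalized_def norm_divide power_divide)
  show "normalized n \<in> borel_measurable (M n)" unfolding normalized_def[abs_def] by measurable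
  show "integrable (M n) (\<lambda>\<omega>. (cmod (normalized n \<omega>))\<^sup>2)" unfolding eq using sc(1) by simp
  show "(\<integral>\<omega>. (cmod (normalized n \<omega>))\<^sup>2 \<partial>M n) \<le> 1" unfolding eq using V by simp
qed

lemma tree_Y_real:
  assumes "Im \<beta> = 0"
  shows "Im (tree.Y n r e i \<omega>) = 0"
proof -
  have c: "Im (coef n j) = 0" for j using assms by (simp add: coef_def)
  have W: "Im (tree.W n r e i \<omega>) = 0" for \<omega>
  proof -
    have "Im (tree.T n r (e @ [i]) \<omega>) = 0" unfolding tree.T_def using c by (rule tree_sum_real)
    moreover have "Im (exp (coef n j * of_real y)) = 0" for j y using c by (simp add: Im_exp)
    ultimately show ?thesis unfolding tree.W_def by simp
  qed
  have "tree.W n r e i = (\<lambda>\<omega>. of_real (Re (tree.W n r e i \<omega>)))"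
    using W by (auto simp: complex_eq_iff)
  then have "Im (\<integral>\<omega>. tree.W n r e i \<omega> \<partial>M n) = 0"
    by (metis Im_complex_of_real integral_complex_of_real)
  then show ?thesis using W by (simp add: tree.Y_def)
qed

text \<open>The \<open>q\<close> of \<open>char_indep_sum_complex_approx\<close>: limit 0 means an
  isotropic Gaussian law, limit 1 one on the real axis.\<close>

definition pseudo_variance :: "nat \<Rightarrow> complex" where
  "pseudo_variance n = (\<Sum>i=1..N n 1. \<integral>\<omega>. (tree.Y n (d - 1) [] i \<omega>)\<^sup>2 \<partial>M n) / of_real (level1_variance n)"

text \<open>The one-level estimate at k = 0, r = d - 1. Its \<open>C\<close> is the moment bound for
  subtrees hanging at level 1 and does not depend on n.\<close>

lemma root_step:
  assumes s: "0 < s" "s \<le> 1" and lt: "\<And>j. j \<in> {1..d} \<Longrightarrow> (2 + s) * (Re \<beta>)\<^sup>2 * a j < ln (\<alpha> j)"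
  obtains C where "\<forall>\<^sub>F n in sequentially. level1_variance n > 0 \<and> N n 1 \<ge> 1 \<and>
    (\<Sum>i=1..N n 1. \<integral>\<omega>. cmod (tree.Y n (d - 1) [] i \<omega>) powr (2 + s) \<partial>M n)
        \<le> lyapunov_ratio s C n 1 * level1_variance n powr ((2 + s) / 2) \<and>
    cmod (pseudo_variance n) \<le> (exp (- 2 * (Im (coef n 1))\<^sup>2) + exp (- (cmod (coef n 1))\<^sup>2)) / (1 - exp (- (cmod (coef n 1))\<^sup>2))"
proof -
  have d1: "1 + (d - 1) \<le> d" "1 \<in> {1..d}" "Suc 0 + (d - 1) \<le> d" using d_ge_1 by auto
  from moment_bound_eventually[OF s lt d1(1)] obtain C where C: "C \<ge> 0" and
    ev: "\<forall>\<^sub>F n in sequentially. tree_sqmean (N n) (coef n) (d - 1) 1 > 0 \<and>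
    (\<forall>e\<in>multi_indices (N n) 1. (\<integral>\<omega>. cmod (tree.T n (d - 1) e \<omega>) powr (2 + s) \<partial>M n)
       \<le> C * tree_sqmean (N n) (coef n) (d - 1) 1 powr ((2 + s) / 2))" by blast
  show thesis
  proof (rule that[of C])
    show "\<forall>\<^sub>F n in sequentially. level1_variance n > 0 \<and> N n 1 \<ge> 1 \<and>
    (\<Sum>i=1..N n 1. \<integral>\<omega>. cmod (tree.Y n (d - 1) [] i \<omega>) powr (2 + s) \<partial>M n)
        \<le> lyapunov_ratio s C n 1 * level1_variance n powr ((2 + s) / 2) \<and>
    cmod (pseudo_variance n) \<le> (exp (- 2 * (Im (coef n 1))\<^sup>2) + exp (- (cmod (coef n 1))\<^sup>2)) / (1 - exp (- (cmod (coef n 1))\<^sup>2))"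
      using ev N_eventually_ge_1 eventually_ge_at_top[of 1]
    proof eventually_elim
      case (elim n)
      have N1: "N n (Suc 0) \<ge> 1" using elim d1 by simp
      have c0: "coef n (Suc 0) \<noteq> 0" using coef_nonzero[of n 1] elim d1 by simp
      have v: "tree_sqmean (N n) (coef n) (d - 1) (Suc 0) > 0" using elim by simp
      have child: "(\<integral>\<omega>. cmod (tree.T n (d - 1) ([] @ [i]) \<omega>) powr (2 + s) \<partial>M n)
         \<le> C * tree_sqmean (N n) (coef n) (d - 1) (Suc 0) powr ((2 + s) / 2)" if "i \<in> {1..N n (Suc 0)}" for i
        using elim append_in_multi_indices[OF root_in_multi_indices that] by simp
      note step = root_in_multi_indices d1(3) s N1 c0 v C child
      have pos: "level1_variance n > 0"
        using tree.var_step_pos[OF step] by (simp add: level1_variance_def)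
      have "cmod (\<Sum>i=1..N n 1. \<integral>\<omega>. (tree.Y n (d - 1) [] i \<omega>)\<^sup>2 \<partial>M n) \<le>
          (exp (- 2 * (Im (coef n 1))\<^sup>2) + exp (- (cmod (coef n 1))\<^sup>2)) / (1 - exp (- (cmod (coef n 1))\<^sup>2)) * level1_variance n"
        using tree.Y_pseudo_variance_le[OF step] by (simp add: level1_variance_def)
      then have "cmod (pseudo_variance n) \<le> (exp (- 2 * (Im (coef n 1))\<^sup>2) + exp (- (cmod (coef n 1))\<^sup>2)) / (1 - exp (- (cmod (coef n 1))\<^sup>2))"
        unfolding pseudo_variance_def norm_divide norm_of_real abs_of_pos[OF pos] pos_divide_le_eq[OF pos] .
      moreover have "(\<Sum>i=1..N n 1. \<integral>\<omega>. cmod (tree.Y n (d - 1) [] i \<omega>) powr (2 + s) \<partial>M n)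
        \<le> lyapunov_ratio s C n 1 * level1_variance n powr ((2 + s) / 2)"
        using tree.sum_Y_powr_le[OF step] by (simp add: level1_variance_def lyapunov_ratio_def)
      ultimately show ?case using pos N1 by simp
    qed
  qed
qed

text \<open>The comparison is with the Gaussian transform \<open>?approx n\<close> that still has
  the pseudo-variance of stage n. The difference vanishes by Lyapunov's condition, and
  \<open>?approx\<close> converges because the pseudo-variance does.\<close>

lemma char_normalized_tendsto:
  "(\<lambda>n. \<integral>\<omega>. iexp (Re (w * normalized n \<omega>)) \<partial>M n) \<longlonglongrightarrow>
     exp (- ((cmod w)\<^sup>2 + Re (w\<^sup>2 * (if Im \<beta> \<noteq> 0 then 0 else 1))) / 4)"
proof -
  obtain s where s: "0 < s" "s \<le> 1" and lt: "\<And>j. j \<in> {1..d} \<Longrightarrow> (2 + s) * (Re \<beta>)\<^sup>2 * a j < ln (\<alpha> j)"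
    using lyapunov_exponent_exists by metis
  obtain C where ev: "\<forall>\<^sub>F n in sequentially. level1_variance n > 0 \<and> N n 1 \<ge> 1 \<and>
    (\<Sum>i=1..N n 1. \<integral>\<omega>. cmod (tree.Y n (d - 1) [] i \<omega>) powr (2 + s) \<partial>M n)
        \<le> lyapunov_ratio s C n 1 * level1_variance n powr ((2 + s) / 2) \<and>
    cmod (pseudo_variance n) \<le> (exp (- 2 * (Im (coef n 1))\<^sup>2) + exp (- (cmod (coef n 1))\<^sup>2)) / (1 - exp (- (cmod (coef n 1))\<^sup>2))"
    by (rule root_step[OF s lt])
  have d1: "1 \<in> {1..d}" "Suc 0 + (d - 1) \<le> d" using d_ge_1 by auto
  let ?q = "if Im \<beta> \<noteq> 0 then 0 else 1 :: complex"
  let ?approx = "\<lambda>n. complex_of_real (exp (- ((cmod w)\<^sup>2 + Re (w\<^sup>2 * pseudo_variance n)) / 4))"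
  let ?err = "\<lambda>n. cmod w powr (2 + s) * lyapunov_ratio s C n 1 + 1 / real (N n 1) * cmod w ^ 4"
  have facts: "[] \<in> multi_indices (N n) 0" "Suc 0 + (d - 1) \<le> d" "0 < s" "s \<le> 1"
     "\<And>i. i \<in> {1..N n (Suc 0)} \<Longrightarrow> tree.tree_moments n s (d - 1) (Suc 0) ([] @ [i])" for n
    using d1 s append_in_multi_indices[OF root_in_multi_indices[of n]] root_in_multi_indices
    by (auto intro!: tree.tree_moments)
  have centered: "tree.T n d [] \<omega> - tree_mean (N n) (coef n) d 0 = (\<Sum>i=1..N n 1. tree.Y n (d - 1) [] i \<omega>)" for n \<omega>
    using tree.T_Suc_centered[OF facts, of n \<omega>] d_eq by simp
  \<comment> \<open>All first-level summands have the same variance, so the share of each is exactly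
    1 / N_{n,1}.\<close>
  have EY2: "(\<integral>\<omega>. (cmod (tree.Y n (d - 1) [] i \<omega>))\<^sup>2 \<partial>M n) = 1 / real (N n 1) * level1_variance n"
    if "i \<in> {1..N n 1}" for n i
    using tree.Y_square(2)[OF facts, of n i] that by (simp add: level1_variance_def tree_var_step_def)
  have sumY2: "level1_variance n = (\<Sum>i=1..N n 1. \<integral>\<omega>. (cmod (tree.Y n (d - 1) [] i \<omega>))\<^sup>2 \<partial>M n)"
    if "N n 1 \<ge> 1" for n
    using EY2 that by simp
  have "\<forall>\<^sub>F n in sequentially. cmod ((\<integral>\<omega>. iexp (Re (w * normalized n \<omega>)) \<partial>M n) - ?approx n) \<le> ?err n"
    using ev
  proof eventually_elim
    case (elim n)
    let ?Y = "tree.Y n (d - 1) []" and ?I = "{1..N n 1}"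
    have "cmod ((\<integral>\<omega>. iexp (Re (w * ((\<Sum>i\<in>?I. ?Y i \<omega>) / of_real (sqrt (level1_variance n))))) \<partial>M n) - ?approx n) \<le>
      cmod w powr (2 + s) * ((\<Sum>i\<in>?I. \<integral>\<omega>. cmod (?Y i \<omega>) powr (2 + s) \<partial>M n) / level1_variance n powr ((2 + s) / 2))
       + 1 / real (N n 1) * cmod w ^ 4"
    proof (rule tree.char_indep_sum_complex_approx[OF finite_atLeastAtMost _ s])
      show "tree.indep_vars n (\<lambda>_. borel) ?Y ?I" using tree.Y_indep[OF facts] by simp
      show "integrable (M n) (\<lambda>\<omega>. cmod (?Y i \<omega>) powr (2 + s))" "(\<integral>\<omega>. ?Y i \<omega> \<partial>M n) = 0" if "i \<in> ?I" for i
        using tree.Y_powr(1)[OF facts, of n i] tree.Y_mean[OF facts, of n i] that by simp_all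
      show "level1_variance n = (\<Sum>i\<in>?I. \<integral>\<omega>. (cmod (?Y i \<omega>))\<^sup>2 \<partial>M n)" using sumY2 elim by blast
      show "0 < level1_variance n" using elim by blast
      show "(\<integral>\<omega>. (cmod (?Y i \<omega>))\<^sup>2 \<partial>M n) \<le> 1 / real (N n 1) * level1_variance n" if "i \<in> ?I" for i
        using EY2[OF that] by simp
      show "(\<Sum>i\<in>?I. \<integral>\<omega>. (?Y i \<omega>)\<^sup>2 \<partial>M n) = pseudo_variance n * of_real (level1_variance n)"
        using elim by (simp add: pseudo_variance_def)
    qed
    also have "\<dots> \<le> ?err n"
      using elim by (intro add_right_mono mult_left_mono) (auto simp: pos_divide_le_eq)
    finally show ?case by (simp only: normalized_def centered)
  qed
  moreover have "?err \<longlonglongrightarrow> cmod w powr (2 + s) * 0 + 0 * cmod w ^ 4"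
    using d1 s lt by (intro tendsto_add tendsto_mult tendsto_const lyapunov_ratio_tendsto_0 N_inverse_tendsto_0) auto
  then have "?err \<longlonglongrightarrow> 0" by simp
  ultimately have diff: "(\<lambda>n. (\<integral>\<omega>. iexp (Re (w * normalized n \<omega>)) \<partial>M n) - ?approx n) \<longlonglongrightarrow> 0"
    by (rule Lim_null_comparison)
  have q: "pseudo_variance \<longlonglongrightarrow> ?q"
  proof (cases "Im \<beta> = 0")
    case True
    have "\<forall>\<^sub>F n in sequentially. pseudo_variance n = 1"
      using ev
    proof eventually_elim
      case (elim n)
      have "(tree.Y n (d - 1) [] i \<omega>)\<^sup>2 = of_real ((cmod (tree.Y n (d - 1) [] i \<omega>))\<^sup>2)" for i \<omega>
        using tree_Y_real[OF True] unfolding cmod_power2 by (simp add: complex_eq_iff power2_eq_square)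
      then have "(\<Sum>i=1..N n 1. \<integral>\<omega>. (tree.Y n (d - 1) [] i \<omega>)\<^sup>2 \<partial>M n) = of_real (level1_variance n)"
        using elim sumY2[of n] by (simp only: integral_complex_of_real of_real_sum)
      then show ?case using elim by (simp add: pseudo_variance_def)
    qed
    from tendsto_eventually[OF this] show ?thesis using True by simp
  next
    case False
    have pos: "2 * (Im \<beta>)\<^sup>2 * a 1 > 0" using False a_pos[OF d1(1)] by simp
    have "(\<lambda>n. exp (- 2 * (Im (coef n 1))\<^sup>2)) \<longlonglongrightarrow> 0"
      using exp_neg_mult_nat_tendsto_0[OF pos] by (simp only: coef_squares(3)[OF d1(1)] mult.assoc mult_minus_left)
    then have "(\<lambda>n. (exp (- 2 * (Im (coef n 1))\<^sup>2) + exp (- (cmod (coef n 1))\<^sup>2)) / (1 - exp (- (cmod (coef n 1))\<^sup>2)))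
       \<longlonglongrightarrow> (0 + 0) / (1 - 0)"
      by (intro tendsto_divide tendsto_add tendsto_diff tendsto_const exp_coef_tendsto_0 d1) auto
    then have lim: "(\<lambda>n. (exp (- 2 * (Im (coef n 1))\<^sup>2) + exp (- (cmod (coef n 1))\<^sup>2)) / (1 - exp (- (cmod (coef n 1))\<^sup>2)))
       \<longlonglongrightarrow> 0" by simp
    have "pseudo_variance \<longlonglongrightarrow> 0"
      by (rule Lim_null_comparison[OF _ lim]) (use ev in \<open>auto elim: eventually_mono\<close>)
    then show ?thesis using False by simp
  qed
  have "?approx \<longlonglongrightarrow> exp (- ((cmod w)\<^sup>2 + Re (w\<^sup>2 * ?q)) / 4)"
    by (intro tendsto_of_real tendsto_exp tendsto_divide tendsto_minus tendsto_add tendsto_const tendsto_Re tendsto_mult q) auto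
  from tendsto_add[OF diff this] show ?thesis by simp
qed

lemma normalized_conv_in_distribution:
  "conv_in_distribution M normalized (if Im \<beta> \<noteq> 0 then N_C 1 else N_R 1)"
proof -
  define \<mu> where "\<mu> = (if Im \<beta> \<noteq> 0 then N_C 1 else N_R 1)"
  have \<mu>: "prob_space \<mu>" "sets \<mu> = sets borel" "integrable \<mu> (\<lambda>z. (cmod z)\<^sup>2)" "(\<integral>z. (cmod z)\<^sup>2 \<partial>\<mu>) \<le> 1"
    using N_C_moments[of 1] N_R_moments[of 1] by (auto simp: \<mu>_def)
  have char: "(\<lambda>n. \<integral>\<omega>. iexp (x * Re (normalized n \<omega>) + y * Im (normalized n \<omega>)) \<partial>M n)
      \<longlonglongrightarrow> (\<integral>z. iexp (x * Re z + y * Im z) \<partial>\<mu>)" for x y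
  proof -
    \<comment> \<open>The conjugate point w = x - \<i> y is taken because Re (w z) = x Re z + y Im
      z.\<close>
    have "(\<integral>z. iexp (x * Re z + y * Im z) \<partial>\<mu>) =
      exp (- ((cmod (Complex x (- y)))\<^sup>2 + Re ((Complex x (- y))\<^sup>2 * (if Im \<beta> \<noteq> 0 then 0 else 1))) / 4)"
      unfolding \<mu>_def using N_C_moments(3)[of 1 x y] N_R_moments(3)[of 1 x y]
      by (simp add: cmod_power2 Re_power2)
    then show ?thesis using char_normalized_tendsto[of "Complex x (- y)"] by simp
  qed
  show ?thesis
    unfolding conv_in_distribution_def \<mu>_def[symmetric]
  proof (intro allI impI)
    fix f :: "complex \<Rightarrow> real" assume f: "continuous_on UNIV f" "bounded (range f)"
    have [measurable]: "f \<in> borel_measurable borel" using f(1) by (rule borel_measurable_continuous_onI)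
    have "(\<integral>z. f z \<partial>distr (M n) borel (normalized n)) = (\<integral>\<omega>. f (normalized n \<omega>) \<partial>M n)" for n
      using normalized_square(1) by (subst integral_distr) auto
    moreover have "(\<lambda>n. \<integral>\<omega>. f (normalized n \<omega>) \<partial>M n) \<longlonglongrightarrow> (\<integral>z. f z \<partial>\<mu>)"
      by (rule tendsto_integral_of_char[where K = 1])
         (use prob_space_M normalized_square \<mu> char f in auto)
    ultimately show "(\<lambda>n. \<integral>z. f z \<partial>distr (M n) borel (normalized n)) \<longlonglongrightarrow> (\<integral>z. f z \<partial>\<mu>)" by simp
  qed
qed

end

theorem theorem2p4:
  fixes d :: nat
    and a \<alpha> :: "nat \<Rightarrow> real"
    and N :: "nat \<Rightarrow> nat \<Rightarrow> nat"
    and M :: "nat \<Rightarrow> 'w measure"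
    and \<xi> :: "nat \<Rightarrow> nat list \<Rightarrow> 'w \<Rightarrow> real"
    and \<beta> :: complex
  defines "Z \<equiv> \<lambda>n. grem_Z d a (N n) (\<xi> n) n \<beta>"
  assumes "grem d a \<alpha> N M \<xi>"
    and "\<beta> \<noteq> 0"
    and "\<bar>Re \<beta>\<bar> < grem_sigma a \<alpha> 1 / 2"
  shows "conv_in_distribution M
           (\<lambda>n \<omega>. (Z n \<omega> - (\<integral>\<omega>'. Z n \<omega>' \<partial>(M n)))
                    / complex_of_real (sqrt (complex_variance (M n) (Z n))))
           (if Im \<beta> \<noteq> 0 then N_C 1 else N_R 1)"
proof -
  interpret grem_subcritical d a \<alpha> N M \<xi> \<beta>
    using assms by (simp add: grem_subcritical_def grem_subcritical_axioms_def)
  have "Z n = tree.T n d []" for n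
    unfolding fun_eq_iff Z_def grem_Z_eq_tree_sum tree.T_def coef_def by simp
  then show ?thesis
    using normalized_conv_in_distribution
    by (simp add: normalized_def[abs_def] root_moments(3,4))
qed

end
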